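(* Let $p,q\in\mathbb N$ and let $T$ be a semi-infinite real banded matrix with $p$ subdiagonals and $q$ superdiagonals whose extreme diagonals have no zero entries. Assume that: (1) $T$ is bounded ($\|T\|_\infty<\infty$) and there exists $s\ge 0$ such that $T+sI$ has a positive bidiagonal factorization; (2) the left and right recursion polynomials $\{A^{(1)}_n,\dots,A^{(p)}_n\}_{n=0}^\infty$ and $\{B^{(1)}_n,\dots,B^{(q)}_n\}_{n=0}^\infty$ of $T$ are determined by initial condition matrices $\nu$ and $\xi$, respectively, such that $\nu^{-\top}=\Lambda\mathcal A$ and $\xi^{-1}=\mathcal B\Upsilon$, where $\mathcal A\in\mathbb R^{p\times p}$ is a nonnegative upper unitriangular matrix, $\mathcal B\in\mathbb R^{q\times q}$ is a nonnegative lower unitriangular matrix, and $\Lambda,\Upsilon$ are the matrices built from the positive bidiagonal factorization of $T+sI$. Then there exist $pq$ nondecreasing nonnegative functions $\psi_{b,a}$, $a\in\{1,\dots,p\}$, $b\in\{1,\dots,q\}$, and corresponding positive Lebesgue--Stieltjes measures $\mathrm d\psi_{b,a}$ supported on the compact interval $\Delta$, such that $$\sum_{a=1}^p\sum_{b=1}^q\int_\Delta B^{(b)}_l(x)\,\mathrm d\psi_{b,a}(x)\,A^{(a)}_k(x)=\delta_{k,l},\qquad k,l\in\mathbb N_0.$$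
   Context: $\mathbb N=\{1,2,\dots\}$, $\mathbb N_0=\{0,1,2,\dots\}$. Banded: $T=(T_{i,j})_{i,j\in\mathbb N_0}$ with $T_{i,j}=0$ if $i-j>p$ or $j-i>q$; extreme diagonals nonzero: $T_{n+p,n}\ne0$, $T_{n,n+q}\neq0$ for all $n\in\mathbb N_0$. $\|T\|_\infty=\sup_i\sum_j|T_{i,j}|$. For any semi-infinite matrix $M$, $M^{[N]}=(M_{i,j})_{0\le i,j\le N}$. Recursion polynomials: given lower unitriangular initial condition matrices $\nu\in\mathbb R^{p\times p}$ and $\xi\in\mathbb R^{q\times q}$, the polynomials $A^{(a)}_n(x)$, $a\in\{1,\dots,p\}$, are determined by $A^{(a)}_{i-1}=\nu_{i,a}$ for $i\in\{1,\dots,p\}$ and $\sum_{m=\max(0,n-q)}^{n+p}A^{(a)}_mT_{m,n}=xA^{(a)}_n$ for $n\in\mathbb N_0$; the polynomials $B^{(b)}_n(x)$, $b\in\{1,\dots,q\}$, are determined by $B^{(b)}_{i-1}=\xi_{i,b}$ for $i\in\{1,\dots,q\}$ and $\sum_{m=\max(0,n-p)}^{n+q}T_{n,m}B^{(b)}_m=xB^{(b)}_n$ for $n\in\mathbb N_0$. Positive bidiagonal factorization (PBF) of a banded matrix $M$ with $p$ subdiagonals and $q$ superdiagonals: $M=L_1\cdots L_p\,D\,U_q\cdots U_1$, where $D=\mathrm{diag}(D_0,D_1,\dots)$, each $L_k$ is lower bidiagonal with ones on the diagonal and subdiagonal entries $(L_k)_{i+1,i}=L_{k|i}$, each $U_k$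 is upper bidiagonal with ones on the diagonal and superdiagonal entries $(U_k)_{i,i+1}=U_{k|i}$, and $L_{k|i}>0$, $U_{k|i}>0$, $D_i>0$ for all $i\in\mathbb N_0$. Matrices $\Lambda\in\mathbb R^{p\times p}$, $\Upsilon\in\mathbb R^{q\times q}$ associated with a PBF: with $e_1$ the first canonical column vector (of size $p$, respectively $q$), $\Lambda$ has columns $\Lambda^{(1)}=e_1$ and $\Lambda^{(k)}=\frac1{r_k}L_1^{[p-1]}\cdots L_{k-1}^{[p-1]}e_1$, $r_k=L_{k-1|0}L_{k-2|1}\cdots L_{1|k-2}$, $k\in\{2,\dots,p\}$; $\Upsilon$ has rows $\Upsilon^{(1)}=e_1^\top$ and $\Upsilon^{(k)}=\frac1{s_k}e_1^\top U_{k-1}^{[q-1]}\cdots U_1^{[q-1]}$, $s_k=U_{k-1|0}U_{k-2|1}\cdots U_{1|k-2}$, $k\in\{2,\dots,q\}$. ($\Lambda$ is upper unitriangular and $\Upsilon$ is lower unitriangular.) $\Delta$ is the smallest closed interval containing all eigenvalues of all the truncations $T^{[N]}$, $N\in\mathbb N_0$ (these are real under the hypotheses). *)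

theory Defs
  imports
    "HOL-Analysis.Set_Integral"
    "HOL-Analysis.Lebesgue_Measure"
    "Jordan_Normal_Form.Char_Poly"
    "Jordan_Normal_Form.Gauss_Jordan_Elimination"
begin

section \<open>Semi-infinite matrices\<close>

type_synonym semi_inf = "nat \<Rightarrow> nat \<Rightarrow> real"

definition banded :: "nat \<Rightarrow> nat \<Rightarrow> semi_inf \<Rightarrow> bool" where
  "banded p q T \<longleftrightarrow> (\<forall>i j. i > j + p \<or> j > i + q \<longrightarrow> T i j = 0)"

definition extreme_diagonals_nonzero :: "nat \<Rightarrow> nat \<Rightarrow> semi_inf \<Rightarrow> bool" where
  "extreme_diagonals_nonzero p q T \<longleftrightarrow> (\<forall>n. T (n + p) n \<noteq> 0 \<and> T n (n + q) \<noteq> 0)"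

definition inf_norm :: "semi_inf \<Rightarrow> ennreal" where
  "inf_norm T = (SUP i. \<Sum>j. ennreal \<bar>T i j\<bar>)"

definition semi_id :: semi_inf where
  "semi_id = (\<lambda>i j. if i = j then 1 else 0)"

definition semi_add_scaled_id :: "semi_inf \<Rightarrow> real \<Rightarrow> semi_inf" where
  "semi_add_scaled_id T s = (\<lambda>i j. T i j + s * semi_id i j)"

text \<open>The series below is only used for left factors with finitely many nonzero
  entries in each row, for which it is a finite sum.\<close>

definition semi_mult :: "semi_inf \<Rightarrow> semi_inf \<Rightarrow> semi_inf" where
  "semi_mult M N = (\<lambda>i j. \<Sum>k. M i k * N k j)"

definition semi_prod :: "semi_inf list \<Rightarrow> semi_inf" where
  "semi_prod Ms = foldr semi_mult Ms semi_id"

text \<open>The principal truncation \<open>M\<^sup>[\<^sup>N\<^sup>]\<close> keeps the indices \<open>0, \<dots>, N\<close>, so it has size \<open>N + 1\<close>.\<close>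

definition truncation :: "semi_inf \<Rightarrow> nat \<Rightarrow> real mat" where
  "truncation M N = mat (Suc N) (Suc N) (\<lambda>(i, j). M i j)"

section \<open>Positive bidiagonal factorizations\<close>

definition lower_bidiagonal :: "(nat \<Rightarrow> real) \<Rightarrow> semi_inf" where
  "lower_bidiagonal l = (\<lambda>i j. if i = j then 1 else if i = Suc j then l j else 0)"

definition upper_bidiagonal :: "(nat \<Rightarrow> real) \<Rightarrow> semi_inf" where
  "upper_bidiagonal u = (\<lambda>i j. if i = j then 1 else if j = Suc i then u i else 0)"

definition semi_diag :: "(nat \<Rightarrow> real) \<Rightarrow> semi_inf" where
  "semi_diag d = (\<lambda>i j. if i = j then d i else 0)"

text \<open>\<open>L k i\<close> and \<open>U k i\<close> stand for \<open>L\<^sub>k\<^sub>|\<^sub>i\<close> and \<open>U\<^sub>k\<^sub>|\<^sub>i\<close>; only \<open>k\<close> in \<open>{1..p}\<close>,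
  respectively \<open>{1..q}\<close>, is relevant.  The product is
  \<open>L\<^sub>1 \<cdots> L\<^sub>p D U\<^sub>q \<cdots> U\<^sub>1\<close>.\<close>

definition positive_bidiagonal_factorization ::
  "nat \<Rightarrow> nat \<Rightarrow> semi_inf \<Rightarrow> (nat \<Rightarrow> nat \<Rightarrow> real) \<Rightarrow> (nat \<Rightarrow> real) \<Rightarrow> (nat \<Rightarrow> nat \<Rightarrow> real) \<Rightarrow> bool" where
  "positive_bidiagonal_factorization p q M L D U \<longleftrightarrow>
     (\<forall>k\<in>{1..p}. \<forall>i. L k i > 0) \<and> (\<forall>k\<in>{1..q}. \<forall>i. U k i > 0) \<and> (\<forall>i. D i > 0) \<and>
     M = semi_prod (map (\<lambda>k. lower_bidiagonal (L k)) [1..<Suc p] @ [semi_diag D]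
           @ map (\<lambda>k. upper_bidiagonal (U k)) (rev [1..<Suc q]))"

section \<open>The matrices \<open>\<Lambda>\<close> and \<open>\<Upsilon>\<close> of a factorization\<close>

definition mat_list_prod :: "nat \<Rightarrow> real mat list \<Rightarrow> real mat" where
  "mat_list_prod n Ms = foldr (*) Ms (1\<^sub>m n)"

text \<open>For \<open>k = 1\<close> all products below are empty, so that column and row \<open>1\<close> are the first
  unit vector.  The row vector \<open>e\<^sub>1\<^sup>T M\<close> is written as \<open>M\<^sup>T e\<^sub>1\<close>.\<close>

definition Lambda_col :: "nat \<Rightarrow> (nat \<Rightarrow> nat \<Rightarrow> real) \<Rightarrow> nat \<Rightarrow> real vec" where
  "Lambda_col p L k =
     (1 / (\<Prod>j<k - 1. L (k - 1 - j) j)) \<cdot>\<^sub>v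
     (mat_list_prod p (map (\<lambda>m. truncation (lower_bidiagonal (L m)) (p - 1)) [1..<k]) *\<^sub>v unit_vec p 0)"

definition Lambda_mat :: "nat \<Rightarrow> (nat \<Rightarrow> nat \<Rightarrow> real) \<Rightarrow> real mat" where
  "Lambda_mat p L = mat_of_cols p (map (Lambda_col p L) [1..<Suc p])"

definition Upsilon_row :: "nat \<Rightarrow> (nat \<Rightarrow> nat \<Rightarrow> real) \<Rightarrow> nat \<Rightarrow> real vec" where
  "Upsilon_row q U k =
     (1 / (\<Prod>j<k - 1. U (k - 1 - j) j)) \<cdot>\<^sub>v
     ((mat_list_prod q (map (\<lambda>m. truncation (upper_bidiagonal (U m)) (q - 1)) (rev [1..<k])))\<^sup>T
        *\<^sub>v unit_vec q 0)"

definition Upsilon_mat :: "nat \<Rightarrow> (nat \<Rightarrow> nat \<Rightarrow> real) \<Rightarrow> real mat" where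
  "Upsilon_mat q U = mat_of_rows q (map (Upsilon_row q U) [1..<Suc q])"

section \<open>Triangular matrices\<close>

definition upper_unitriangular :: "nat \<Rightarrow> real mat \<Rightarrow> bool" where
  "upper_unitriangular n M \<longleftrightarrow>
     M \<in> carrier_mat n n \<and> upper_triangular M \<and> (\<forall>i<n. M $$ (i, i) = 1)"

definition lower_unitriangular :: "nat \<Rightarrow> real mat \<Rightarrow> bool" where
  "lower_unitriangular n M \<longleftrightarrow> upper_unitriangular n M\<^sup>T"

definition nonneg_entries :: "real mat \<Rightarrow> bool" where
  "nonneg_entries M \<longleftrightarrow> (\<forall>i<dim_row M. \<forall>j<dim_col M. M $$ (i, j) \<ge> 0)"

section \<open>Recursion polynomials\<close>

text \<open>\<open>A a n\<close> stands for \<open>A\<^sub>n\<^sup>(\<^sup>a\<^sup>)\<close> with \<open>a\<close> in \<open>{1..p}\<close>.  The matrices \<open>\<nu>\<close> and \<open>\<xi>\<close> are indexed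
  from \<open>0\<close>, whence the shifts by one.  Truncated subtraction makes \<open>n - q\<close> the
  maximum of \<open>0\<close> and \<open>n - q\<close>.\<close>

definition left_recursion_polynomials ::
  "nat \<Rightarrow> nat \<Rightarrow> semi_inf \<Rightarrow> real mat \<Rightarrow> (nat \<Rightarrow> nat \<Rightarrow> real poly) \<Rightarrow> bool" where
  "left_recursion_polynomials p q T \<nu> A \<longleftrightarrow>
     (\<forall>a\<in>{1..p}.
        (\<forall>i\<in>{1..p}. A a (i - 1) = [:\<nu> $$ (i - 1, a - 1):]) \<and>
        (\<forall>n. (\<Sum>m = n - q..n + p. Polynomial.smult (T m n) (A a m)) = [:0, 1:] * A a n))"

definition right_recursion_polynomials ::
  "nat \<Rightarrow> nat \<Rightarrow> semi_inf \<Rightarrow> real mat \<Rightarrow> (nat \<Rightarrow> nat \<Rightarrow> real poly) \<Rightarrow> bool" where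
  "right_recursion_polynomials p q T \<xi> B \<longleftrightarrow>
     (\<forall>b\<in>{1..q}.
        (\<forall>i\<in>{1..q}. B b (i - 1) = [:\<xi> $$ (i - 1, b - 1):]) \<and>
        (\<forall>n. (\<Sum>m = n - p..n + q. Polynomial.smult (T n m) (B b m)) = [:0, 1:] * B b n))"

section \<open>The interval \<open>\<Delta>\<close> and Lebesgue-Stieltjes measures\<close>

definition truncation_eigenvalues :: "semi_inf \<Rightarrow> complex set" where
  "truncation_eigenvalues T =
     {z. \<exists>N. eigenvalue (map_mat complex_of_real (truncation T N)) z}"

text \<open>If some eigenvalue were not real, no interval would qualify and \<open>Delta T\<close> would be the
  whole line; compactness of \<open>Delta T\<close> therefore entails that all eigenvalues are real.\<close>

definition Delta :: "semi_inf \<Rightarrow> real set" where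
  "Delta T = \<Inter>{I. closed I \<and> is_interval I \<and> truncation_eigenvalues T \<subseteq> complex_of_real ` I}"

text \<open>\<open>interval_measure F\<close> is meaningful only for right-continuous \<open>F\<close>.  Passing to right limits
  gives the Lebesgue-Stieltjes measure of an arbitrary nondecreasing function, with
  \<open>(a, b]\<close> having mass \<open>\<psi>(b+) - \<psi>(a+)\<close>.\<close>

definition lebesgue_stieltjes :: "(real \<Rightarrow> real) \<Rightarrow> real measure" where
  "lebesgue_stieltjes \<psi> = interval_measure (\<lambda>x. Lim (at_right x) \<psi>)"

end

theory Submission
  imports Defs
    "HOL-Computational_Algebra.Fundamental_Theorem_Algebra"
    "HOL-Probability.Helly_Selection"
begin

text \<open>
  Let \<open>v\<^sub>a\<close> be the columns of \<open>\<nu>\<close> inverse transposed, let \<open>w\<^sub>b\<close> be the rows of \<open>\<xi>\<close> inverse, and let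
  \<open>e\<^sub>0, e\<^sub>1, \<dots>\<close> be the unit vectors.  The recursions say that multiplication of the polynomials by
  \<open>x\<close> corresponds to the action of \<open>T\<close>, so that applying \<open>A a k\<close> evaluated at \<open>T\<close> to \<open>v\<^sub>a\<close> and
  summing over \<open>a\<close> gives \<open>e\<^sub>k\<close>, while the row vectors \<open>w\<^sub>b\<close> times \<open>B b l\<close> at \<open>T\<close> add up to the
  transpose of \<open>e\<^sub>l\<close> (\<open>recursion_reaches_unit_vectors\<close>).  Pairing both identities shows that the
  functionals \<open>f \<mapsto> w\<^sub>b f(T) v\<^sub>a\<close>, applied to \<open>B b l * A a k\<close> and summed over \<open>a\<close> and \<open>b\<close>, give the
  Kronecker delta (\<open>biorthogonal_truncation\<close>).  The content of the theorem is that each of these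
  functionals is integration against a positive measure on the interval \<open>Delta T\<close>.  As \<open>\<A>\<close> and \<open>\<B>\<close>
  are nonnegative, \<open>v\<^sub>a\<close> is a nonnegative combination of the vectors \<open>L\<^sub>1 \<cdots> L\<^sub>k\<^sub>-\<^sub>1 e\<^sub>0\<close> and \<open>w\<^sub>b\<close> is one
  of the rows number 0 of \<open>U\<^sub>l\<^sub>-\<^sub>1 \<cdots> U\<^sub>1\<close>; it suffices to treat such \<open>v\<close> and \<open>w\<close>.

  Replace \<open>T\<close> and \<open>M = T + s I\<close> by their truncations of size \<open>n\<close>.  The Hankel matrix with entries
  \<open>w M\<^sup>i\<^sup>+\<^sup>j v = (w M\<^sup>i) (M\<^sup>j v)\<close> is a Krylov matrix of rows times a Krylov matrix of columns.  Both are
  corners of products of nonnegative bidiagonal and diagonal matrices (\<open>ldu_tn_krylov\<close>).  An upper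
  bidiagonal factor can be moved past a lower one at the price of a positive diagonal factor
  (\<open>upper_lower_swap\<close>), so every such product has a factorization lower times diagonal times upper
  with positive pivots below \<open>n\<close>.  For the Hankel matrix, symmetry forces the two triangular factors to be
  transposes of each other, and it is positive definite (\<open>hankel_pd_factorization\<close>).  This replaces
  the determinantal theory of oscillatory matrices.

  For \<open>w = v = e\<^sub>0\<close>, positive definiteness makes \<open>e\<^sub>0\<close> a cyclic vector whose annihilating polynomial
  \<open>\<mu>\<close> of degree \<open>n\<close> has no factor \<open>(x - \<alpha>)\<^sup>2 + \<beta>\<^sup>2\<close> with real \<open>\<alpha>\<close> and \<open>\<beta>\<close>.  Hence \<open>\<mu>\<close> has \<open>n\<close> distinct
  real roots, and these are the eigenvalues of the truncation.  For the other pairs, Lagrange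
  interpolation at the roots writes the functional as a quadrature formula with nonnegative weights
  (\<open>gauss_quadrature\<close>).

  The eigenvalues are bounded by the norm of \<open>T\<close> and belong to \<open>Delta T\<close>, and the total mass of each
  quadrature formula does not depend on \<open>n\<close>.  So Helly's theorem yields weak limits along one
  common subsequence (\<open>quadrature_limit\<close>).  For \<open>n > k\<close> and \<open>n > l\<close> the orthogonality relation holds
  exactly for the quadrature formulas, and passes to the limit.
\<close>

section \<open>Semi-infinite matrices with finite rows and columns\<close>

abbreviation semi_mult_infix (infixr "\<odot>" 70) where "X \<odot> Y \<equiv> semi_mult X Y"

text \<open>
  All sums in products of such matrices are finite, which makes the product associative; for general
  semi-infinite matrices it is not.
\<close>

definition row_col_finite :: "semi_inf \<Rightarrow> bool" where
  "row_col_finite X \<longleftrightarrow> (\<forall>i. \<exists>n. \<forall>k>n. X i k = 0 \<and> X k i = 0)"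

definition semi_transpose :: "semi_inf \<Rightarrow> semi_inf" where
  "semi_transpose X = (\<lambda>i j. X j i)"

lemma semi_mult_eq_sum:
  assumes "\<And>k. k > n \<Longrightarrow> X i k * Y k j = 0"
  shows "(X \<odot> Y) i j = (\<Sum>k\<le>n. X i k * Y k j)"
  unfolding semi_mult_def by (rule suminf_finite) (use assms in \<open>auto simp: not_le\<close>)

lemma row_finiteD: "row_col_finite X \<Longrightarrow> \<exists>n. \<forall>k>n. X i k = 0"
  unfolding row_col_finite_def by meson

lemma row_col_finiteD:
  assumes "row_col_finite X"
  shows "\<exists>n. \<forall>i\<le>m. \<forall>k>n. X i k = 0 \<and> X k i = 0"
proof (induction m)
  case 0
  then show ?case using assms by (auto simp: row_col_finite_def)
next
  case (Suc m)
  then obtain n where n: "\<forall>i\<le>m. \<forall>k>n. X i k = 0 \<and> X k i = 0" by blast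
  obtain n' where "\<forall>k>n'. X (Suc m) k = 0 \<and> X k (Suc m) = 0"
    using assms unfolding row_col_finite_def by blast
  with n show ?case by (intro exI[of _ "max n n'"]) (auto simp: le_Suc_eq)
qed

lemma semi_transpose_semi_transpose [simp]: "semi_transpose (semi_transpose X) = X"
  by (simp add: semi_transpose_def)

lemma row_col_finite_semi_transpose [simp]: "row_col_finite (semi_transpose X) \<longleftrightarrow> row_col_finite X"
  by (simp add: row_col_finite_def semi_transpose_def conj_commute)

lemma semi_transpose_mult: "semi_transpose (X \<odot> Y) = semi_transpose Y \<odot> semi_transpose X"
  by (simp add: semi_transpose_def semi_mult_def mult.commute)

lemma row_col_finite_mult [simp]:
  assumes "row_col_finite X" "row_col_finite Y"
  shows "row_col_finite (X \<odot> Y)"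
proof -
  have *: "\<exists>n. \<forall>k>n. (X \<odot> Y) i k = 0" if X: "row_col_finite X" and Y: "row_col_finite Y" for X Y i
  proof -
    obtain a where a: "\<forall>k>a. X i k = 0" using row_finiteD[OF X] by blast
    obtain b where b: "\<forall>m\<le>a. \<forall>k>b. Y m k = 0 \<and> Y k m = 0"
    using row_col_finiteD[OF Y] by blast
    have "(X \<odot> Y) i k = 0" if "k > b" for k
      using semi_mult_eq_sum[of a X i Y k] a b that by simp
    then show ?thesis by blast
  qed
  have "\<exists>n. \<forall>k>n. (X \<odot> Y) i k = 0 \<and> (X \<odot> Y) k i = 0" for i
  proof -
    obtain n where n: "\<forall>k>n. (X \<odot> Y) i k = 0" using *[OF assms] by blast
    obtain n' where "\<forall>k>n'. (semi_transpose Y \<odot> semi_transpose X) i k = 0" using * assms by fastforce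
    then have "\<forall>k>n'. semi_transpose (X \<odot> Y) i k = 0" by (simp add: semi_transpose_mult)
    then have "\<forall>k>n'. (X \<odot> Y) k i = 0" by (simp add: semi_transpose_def)
    with n show ?thesis by (intro exI[of _ "max n n'"]) auto
  qed
  then show ?thesis by (simp add: row_col_finite_def)
qed

lemma semi_mult_assoc:
  assumes "row_col_finite X" "row_col_finite Y"
  shows "(X \<odot> Y) \<odot> Z = X \<odot> Y \<odot> Z"
proof (intro ext)
  fix i j
  obtain a where a: "\<forall>k>a. X i k = 0" using row_finiteD[OF assms(1)] by blast
  obtain b where b: "\<forall>m\<le>a. \<forall>k>b. Y m k = 0 \<and> Y k m = 0"
    using row_col_finiteD[OF assms(2)] by blast
  have XY: "(X \<odot> Y) i k = (\<Sum>m\<le>a. X i m * Y m k)" for k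
    by (rule semi_mult_eq_sum) (simp add: a)
  have YZ: "(Y \<odot> Z) m j = (\<Sum>k\<le>b. Y m k * Z k j)" if "m \<le> a" for m
    by (rule semi_mult_eq_sum) (simp add: b that)
  have "((X \<odot> Y) \<odot> Z) i j = (\<Sum>k\<le>b. (X \<odot> Y) i k * Z k j)"
    by (rule semi_mult_eq_sum) (simp add: XY b)
  also have "\<dots> = (\<Sum>k\<le>b. \<Sum>m\<le>a. X i m * Y m k * Z k j)"
    by (simp add: XY sum_distrib_right)
  also have "\<dots> = (\<Sum>m\<le>a. \<Sum>k\<le>b. X i m * Y m k * Z k j)" by (rule sum.swap)
  also have "\<dots> = (\<Sum>m\<le>a. X i m * (Y \<odot> Z) m j)"
    by (simp add: YZ sum_distrib_left mult.assoc)
  also have "\<dots> = (X \<odot> Y \<odot> Z) i j"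
    by (rule semi_mult_eq_sum[symmetric]) (simp add: a)
  finally show "((X \<odot> Y) \<odot> Z) i j = (X \<odot> Y \<odot> Z) i j" .
qed

lemma lower_bidiagonal_apply:
    "lower_bidiagonal l i j = (if i = j then 1 else if i = Suc j then l j else 0)"
  and upper_bidiagonal_apply:
    "upper_bidiagonal l i j = (if i = j then 1 else if j = Suc i then l i else 0)"
  and semi_diag_apply: "semi_diag d i j = (if i = j then d i else 0)"
  and semi_id_apply: "semi_id i j = (if i = j then 1 else 0)"
  by (simp_all add: lower_bidiagonal_def upper_bidiagonal_def semi_diag_def semi_id_def)

lemma lower_bidiagonal_mult:
  "(lower_bidiagonal l \<odot> X) i j = X i j + (case i of 0 \<Rightarrow> 0 | Suc k \<Rightarrow> l k * X k j)"
proof -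
  have "(lower_bidiagonal l \<odot> X) i j = (\<Sum>k\<le>i. lower_bidiagonal l i k * X k j)"
    by (rule semi_mult_eq_sum) (auto simp: lower_bidiagonal_def)
  also have "\<dots> = X i j + (case i of 0 \<Rightarrow> 0 | Suc k \<Rightarrow> l k * X k j)"
  proof (cases i)
    case (Suc k)
    have "(\<Sum>m<k. lower_bidiagonal l (Suc k) m * X m j) = 0"
      by (rule sum.neutral) (auto simp: lower_bidiagonal_def)
    then show ?thesis
      by (simp add: Suc lower_bidiagonal_def lessThan_Suc_atMost[symmetric])
  qed (simp add: lower_bidiagonal_def)
  finally show ?thesis .
qed

lemma upper_bidiagonal_mult: "(upper_bidiagonal u \<odot> X) i j = X i j + u i * X (Suc i) j"
proof -
  have "(upper_bidiagonal u \<odot> X) i j = (\<Sum>k\<le>Suc i. upper_bidiagonal u i k * X k j)"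
    by (rule semi_mult_eq_sum) (auto simp: upper_bidiagonal_def)
  also have "(\<Sum>m<i. upper_bidiagonal u i m * X m j) = 0"
    by (rule sum.neutral) (auto simp: upper_bidiagonal_def)
  then have "(\<Sum>k\<le>Suc i. upper_bidiagonal u i k * X k j) = X i j + u i * X (Suc i) j"
    by (simp add: upper_bidiagonal_def lessThan_Suc_atMost[symmetric])
  finally show ?thesis .
qed

lemma semi_diag_mult: "(semi_diag d \<odot> X) i j = d i * X i j"
proof -
  have "(semi_diag d \<odot> X) i j = (\<Sum>k\<le>i. semi_diag d i k * X k j)"
    by (rule semi_mult_eq_sum) (auto simp: semi_diag_def)
  also have "\<dots> = d i * X i j"
    by (subst sum.remove[of _ i]) (auto simp: semi_diag_def intro!: sum.neutral)
  finally show ?thesis .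
qed

lemma semi_transpose_lower [simp]: "semi_transpose (lower_bidiagonal l) = upper_bidiagonal l"
  and semi_transpose_upper [simp]: "semi_transpose (upper_bidiagonal l) = lower_bidiagonal l"
  and semi_transpose_diag [simp]: "semi_transpose (semi_diag d) = semi_diag d"
  and semi_transpose_id [simp]: "semi_transpose semi_id = semi_id"
  by (auto simp: semi_transpose_def lower_bidiagonal_def upper_bidiagonal_def semi_diag_def semi_id_def fun_eq_iff)

lemma mult_semi_diag: "(X \<odot> semi_diag d) i j = X i j * d j"
proof -
  have "(X \<odot> semi_diag d) i j = semi_transpose (semi_transpose (semi_diag d) \<odot> semi_transpose X) i j"
    by (simp only: semi_transpose_mult semi_transpose_semi_transpose)
  then show ?thesis by (simp add: semi_transpose_def[of "_ \<odot> _"] semi_diag_mult) (simp add: semi_transpose_def)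
qed

lemma semi_id_eq_diag: "semi_id = semi_diag (\<lambda>_. 1)"
  by (auto simp: semi_id_def semi_diag_def fun_eq_iff)

lemma semi_id_mult [simp]: "semi_id \<odot> X = X" and mult_semi_id [simp]: "X \<odot> semi_id = X"
  by (auto simp: semi_id_eq_diag semi_diag_mult mult_semi_diag fun_eq_iff)

lemma row_col_finite_basic [simp]:
  "row_col_finite (lower_bidiagonal l)" "row_col_finite (upper_bidiagonal l)"
  "row_col_finite (semi_diag d)" "row_col_finite semi_id"
  unfolding row_col_finite_def lower_bidiagonal_def upper_bidiagonal_def semi_diag_def semi_id_def
  by (intro allI exI[of _ "Suc _"], auto)+

section \<open>Products of nonnegative bidiagonal matrices\<close>

text \<open>
  The monoid generated by the nonnegative unit lower bidiagonal matrices.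
\<close>

inductive lower_tn :: "semi_inf \<Rightarrow> bool" where
  id: "lower_tn semi_id"
| cons: "(\<And>i. l i \<ge> 0) \<Longrightarrow> lower_tn X \<Longrightarrow> lower_tn (lower_bidiagonal l \<odot> X)"

definition upper_tn :: "semi_inf \<Rightarrow> bool" where
  "upper_tn X \<longleftrightarrow> lower_tn (semi_transpose X)"

text \<open>
  Truncating to size \<open>n\<close> makes all pivots from some index on vanish.  Once zero, the pivots
  have to stay zero: only then can a diagonal matrix be moved past a bidiagonal one.
\<close>

definition pivots :: "nat \<Rightarrow> (nat \<Rightarrow> real) \<Rightarrow> bool" where
  "pivots n d \<longleftrightarrow> (\<forall>i. d i \<ge> 0) \<and> (\<forall>i. d i = 0 \<longrightarrow> d (Suc i) = 0) \<and> (\<forall>i<n. d i > 0)"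

text \<open>
  Among finite matrices, those of this form with positive pivots are exactly the invertible totally
  nonnegative ones.  The description by factors is preserved by products for elementary reasons,
  whereas the one by minors would call for the Cauchy--Binet formula.
\<close>

definition ldu_tn :: "nat \<Rightarrow> semi_inf \<Rightarrow> bool" where
  "ldu_tn n G \<longleftrightarrow> (\<exists>X d Y. lower_tn X \<and> pivots n d \<and> upper_tn Y \<and> G = X \<odot> semi_diag d \<odot> Y)"

lemma lower_tn_row_col_finite [simp]: "lower_tn X \<Longrightarrow> row_col_finite X"
  by (induction rule: lower_tn.induct) auto

lemma upper_tn_row_col_finite [simp]: "upper_tn X \<Longrightarrow> row_col_finite X"
  unfolding upper_tn_def using lower_tn_row_col_finite by fastforce

lemma ldu_tn_row_col_finite [simp]: "ldu_tn n G \<Longrightarrow> row_col_finite G"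
  by (auto simp: ldu_tn_def)

lemma lower_tn_mult: "lower_tn X \<Longrightarrow> lower_tn Y \<Longrightarrow> lower_tn (X \<odot> Y)"
  by (induction rule: lower_tn.induct) (auto simp: semi_mult_assoc intro: lower_tn.cons)

lemma upper_tn_mult: "upper_tn X \<Longrightarrow> upper_tn Y \<Longrightarrow> upper_tn (X \<odot> Y)"
  by (simp add: upper_tn_def semi_transpose_mult lower_tn_mult)

lemma lower_tn_bidiagonal: "(\<And>i. l i \<ge> 0) \<Longrightarrow> lower_tn (lower_bidiagonal l)"
  using lower_tn.cons[OF _ lower_tn.id] by simp

lemma upper_tn_bidiagonal: "(\<And>i. l i \<ge> 0) \<Longrightarrow> upper_tn (upper_bidiagonal l)"
  by (simp add: upper_tn_def lower_tn_bidiagonal)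

lemma upper_tn_id: "upper_tn semi_id"
  by (simp add: upper_tn_def lower_tn.id)

lemma lower_tn_entries: "lower_tn X \<Longrightarrow> X i i = 1 \<and> (\<forall>j>i. X i j = 0)"
proof (induction arbitrary: i rule: lower_tn.induct)
  case (cons l X)
  then show ?case by (auto simp: lower_bidiagonal_mult split: nat.split)
qed (auto simp: semi_id_apply)

lemma upper_tn_entries: "upper_tn X \<Longrightarrow> X i i = 1 \<and> (\<forall>j>i. X j i = 0)"
  using lower_tn_entries[of "semi_transpose X" i] by (simp add: upper_tn_def semi_transpose_def)

lemma pivots_mult: "pivots n d \<Longrightarrow> pivots n d' \<Longrightarrow> pivots n (\<lambda>i. d i * d' i)"
  by (auto simp: pivots_def)

lemma diag_diag: "semi_diag d \<odot> semi_diag d' = semi_diag (\<lambda>i. d i * d' i)"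
  by (auto simp: fun_eq_iff semi_diag_mult) (auto simp: semi_diag_apply)

text \<open>
  \<open>D L(l) = L(l') D\<close> holds for \<open>l'\<^sub>i d\<^sub>i = d\<^sub>i\<^sub>+\<^sub>1 l\<^sub>i\<close>, which can be solved if \<open>d\<^sub>i = 0\<close> implies
  \<open>d\<^sub>i\<^sub>+\<^sub>1 = 0\<close>.
\<close>

lemma diag_lower_swap:
  assumes d: "pivots n d" and X: "lower_tn X"
  shows "\<exists>X'. lower_tn X' \<and> semi_diag d \<odot> X = X' \<odot> semi_diag d"
  using X
proof (induction rule: lower_tn.induct)
  case id
  show ?case by (intro exI[of _ semi_id]) (simp add: lower_tn.id)
next
  case (cons l X)
  then obtain X' where X': "lower_tn X'" "semi_diag d \<odot> X = X' \<odot> semi_diag d" by blast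
  define l' where "l' i = d (Suc i) * l i / d i" for i
  have l': "l' i \<ge> 0" for i using d cons(1) by (auto simp: l'_def pivots_def)
  \<comment> \<open>For \<open>d i = 0\<close> both sides vanish, so it does not matter that then \<open>l' i = 0\<close> by division by zero.\<close>
  have *: "l' i * d i = d (Suc i) * l i" for i
    using d by (auto simp: l'_def pivots_def)
  have "semi_diag d \<odot> lower_bidiagonal l = lower_bidiagonal l' \<odot> semi_diag d"
    using * by (auto simp: fun_eq_iff semi_diag_mult mult_semi_diag lower_bidiagonal_apply)
  then have "semi_diag d \<odot> lower_bidiagonal l \<odot> X = (lower_bidiagonal l' \<odot> X') \<odot> semi_diag d"
    using X' cons(2) by (metis semi_mult_assoc row_col_finite_basic lower_tn_row_col_finite)
  then show ?case using lower_tn.cons[of l', OF l' X'(1)] by blast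
qed

lemma upper_diag_swap:
  assumes d: "pivots n d" and Y: "upper_tn Y"
  shows "\<exists>Y'. upper_tn Y' \<and> Y \<odot> semi_diag d = semi_diag d \<odot> Y'"
proof -
  obtain X where X: "lower_tn X" "semi_diag d \<odot> semi_transpose Y = X \<odot> semi_diag d"
    using diag_lower_swap[OF d] Y by (auto simp: upper_tn_def)
  have "Y \<odot> semi_diag d = semi_transpose (semi_diag d \<odot> semi_transpose Y)" by (simp add: semi_transpose_mult)
  also have "\<dots> = semi_diag d \<odot> semi_transpose X" by (simp add: X(2) semi_transpose_mult)
  finally show ?thesis using X(1) by (intro exI[of _ "semi_transpose X"]) (simp add: upper_tn_def)
qed

text \<open>
  One step of the differential quotient-difference algorithm.  Comparing entries, the pivots satisfy
  \<open>d\<^sub>i\<^sub>+\<^sub>1 = 1 + u\<^sub>i\<^sub>+\<^sub>1 l\<^sub>i\<^sub>+\<^sub>1 - u\<^sub>i l\<^sub>i / d\<^sub>i\<close>.  The subtraction disappears for \<open>t\<^sub>i = d\<^sub>i - u\<^sub>i l\<^sub>i\<close>, because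
  \<open>t\<^sub>i\<^sub>+\<^sub>1 = 1 - u\<^sub>i l\<^sub>i / d\<^sub>i = t\<^sub>i / d\<^sub>i\<close>; so \<open>t\<close> and \<open>d\<close> stay positive.
\<close>

lemma upper_lower_swap:
  assumes u: "\<And>i. u i \<ge> 0" and l: "\<And>i. l i \<ge> 0"
  shows "\<exists>l' d u'. (\<forall>i. l' i \<ge> 0) \<and> (\<forall>i. d i > 0) \<and> (\<forall>i. u' i \<ge> 0) \<and>
    upper_bidiagonal u \<odot> lower_bidiagonal l =
    lower_bidiagonal l' \<odot> semi_diag d \<odot> upper_bidiagonal u'"
proof -
  define t where "t = rec_nat 1 (\<lambda>i x. x / (x + u i * l i))"
  define d where "d i = t i + u i * l i" for i
  have t0: "t 0 = 1" and tS: "t (Suc i) = t i / d i" for i by (simp_all add: t_def d_def)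
  have tpos: "t i > 0" for i
  proof (induction i)
    case (Suc i)
    then have "d i > 0" using u[of i] l[of i] by (simp add: d_def add_pos_nonneg)
    with Suc show ?case by (simp add: tS)
  qed (simp add: t0)
  have dpos: "d i > 0" for i using tpos[of i] u[of i] l[of i] by (simp add: d_def add_pos_nonneg)
  have dS: "d (Suc i) + u i * l i / d i = 1 + u (Suc i) * l (Suc i)" for i
  proof -
    have "t i / d i + u i * l i / d i = 1"
      using dpos[of i] by (simp add: add_divide_distrib[symmetric]) (simp add: d_def)
    then show ?thesis by (simp add: d_def[of "Suc i"] tS)
  qed
  have "(upper_bidiagonal u \<odot> lower_bidiagonal l) i j =
    (lower_bidiagonal (\<lambda>i. l i / d i) \<odot> semi_diag d \<odot> upper_bidiagonal (\<lambda>i. u i / d i)) i j" for i j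
    using dpos[of i] dpos[of "i-1"] dS[of "i-1"]
    by (cases i) (auto simp: upper_bidiagonal_mult lower_bidiagonal_mult semi_diag_mult
        lower_bidiagonal_apply upper_bidiagonal_apply d_def[of 0] t0 mult.commute split: nat.splits)
  then show ?thesis using u l dpos
    by (intro exI[of _ "\<lambda>i. l i / d i"] exI[of _ d] exI[of _ "\<lambda>i. u i / d i"])
       (auto simp: fun_eq_iff less_imp_le)
qed

lemma pivots_pos: "(\<And>i. d i > 0) \<Longrightarrow> pivots n d"
  unfolding pivots_def by (metis less_imp_le less_irrefl)

lemma upper_lower_tn_swap:
  assumes "lower_tn X" "\<And>i. u i \<ge> 0"
  shows "\<exists>X' d u'. lower_tn X' \<and> (\<forall>i. d i > 0) \<and> (\<forall>i. u' i \<ge> 0) \<and>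
    upper_bidiagonal u \<odot> X = X' \<odot> semi_diag d \<odot> upper_bidiagonal u'"
  using assms
proof (induction arbitrary: u rule: lower_tn.induct)
  case id
  show ?case using id
    by (intro exI[of _ semi_id] exI[of _ "\<lambda>_. 1"] exI[of _ u])
       (simp add: lower_tn.id semi_id_eq_diag[symmetric])
next
  case (cons l X)
  obtain l1 d1 u1 where 1: "\<forall>i. l1 i \<ge> 0" "\<forall>i. d1 i > 0" "\<forall>i. u1 i \<ge> 0"
    "upper_bidiagonal u \<odot> lower_bidiagonal l = lower_bidiagonal l1 \<odot> semi_diag d1 \<odot> upper_bidiagonal u1"
    using upper_lower_swap[of u l] cons by blast
  obtain X2 d2 u2 where 2: "lower_tn X2" "\<forall>i. d2 i > 0" "\<forall>i. u2 i \<ge> 0"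
    "upper_bidiagonal u1 \<odot> X = X2 \<odot> semi_diag d2 \<odot> upper_bidiagonal u2"
    using cons.IH[of u1] 1 by blast
  obtain X3 where 3: "lower_tn X3" "semi_diag d1 \<odot> X2 = X3 \<odot> semi_diag d1"
    using diag_lower_swap[OF pivots_pos 2(1)] 1(2) by blast
  have "upper_bidiagonal u \<odot> lower_bidiagonal l \<odot> X
      = lower_bidiagonal l1 \<odot> semi_diag d1 \<odot> upper_bidiagonal u1 \<odot> X"
    using 1(4) cons(2) by (simp add: semi_mult_assoc[symmetric])
  also have "\<dots> = lower_bidiagonal l1 \<odot> (semi_diag d1 \<odot> X2) \<odot> semi_diag d2 \<odot> upper_bidiagonal u2"
    using 2 by (simp add: semi_mult_assoc)
  also have "\<dots> = (lower_bidiagonal l1 \<odot> X3) \<odot> semi_diag (\<lambda>i. d1 i * d2 i) \<odot> upper_bidiagonal u2"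
    using 3 by (simp add: semi_mult_assoc diag_diag[symmetric])
  finally show ?case
    using lower_tn.cons[of l1 X3] 1 2 3 by (metis mult_pos_pos)
qed

lemma ldu_tnI:
  "lower_tn X \<Longrightarrow> pivots n d \<Longrightarrow> upper_tn Y \<Longrightarrow> G = X \<odot> semi_diag d \<odot> Y \<Longrightarrow> ldu_tn n G"
  unfolding ldu_tn_def by blast

lemma ldu_tnE:
  assumes "ldu_tn n G"
  obtains X d Y where "lower_tn X" "pivots n d" "upper_tn Y" "G = X \<odot> semi_diag d \<odot> Y"
  using assms unfolding ldu_tn_def by blast

lemma ldu_tn_lower:
  assumes X: "lower_tn X" and G: "ldu_tn n G" shows "ldu_tn n (X \<odot> G)"
proof -
  obtain X' d Y where G: "lower_tn X'" "pivots n d" "upper_tn Y" "G = X' \<odot> semi_diag d \<odot> Y"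
    using G by (rule ldu_tnE)
  then have "X \<odot> G = (X \<odot> X') \<odot> semi_diag d \<odot> Y" using X by (simp add: semi_mult_assoc)
  then show ?thesis using ldu_tnI lower_tn_mult[OF X G(1)] G(2,3) by blast
qed

lemma ldu_tn_diag:
  assumes d: "pivots n d" and G: "ldu_tn n G" shows "ldu_tn n (semi_diag d \<odot> G)"
proof -
  obtain X e Y where G: "lower_tn X" "pivots n e" "upper_tn Y" "G = X \<odot> semi_diag e \<odot> Y"
    using G by (rule ldu_tnE)
  obtain X' where X': "lower_tn X'" "semi_diag d \<odot> X = X' \<odot> semi_diag d"
    using diag_lower_swap[OF d G(1)] by blast
  have "semi_diag d \<odot> G = (semi_diag d \<odot> X) \<odot> semi_diag e \<odot> Y"
    using G by (simp add: semi_mult_assoc)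
  also have "\<dots> = X' \<odot> semi_diag (\<lambda>i. d i * e i) \<odot> Y"
    using X' by (simp add: semi_mult_assoc diag_diag[symmetric])
  finally show ?thesis using X'(1) G(3) pivots_mult[OF d G(2)] ldu_tnI by blast
qed

lemma ldu_tn_upper_bidiagonal:
  assumes u: "\<And>i. u i \<ge> 0" and G: "ldu_tn n G" shows "ldu_tn n (upper_bidiagonal u \<odot> G)"
proof -
  obtain X e Y where G: "lower_tn X" "pivots n e" "upper_tn Y" "G = X \<odot> semi_diag e \<odot> Y"
    using G by (rule ldu_tnE)
  obtain X' d u' where 1: "lower_tn X'" "\<forall>i. d i > 0" "\<forall>i. u' i \<ge> 0"
    "upper_bidiagonal u \<odot> X = X' \<odot> semi_diag d \<odot> upper_bidiagonal u'"
    using upper_lower_tn_swap[of X u, OF G(1) u] by blast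
  have u': "upper_tn (upper_bidiagonal u')" using 1 by (simp add: upper_tn_bidiagonal)
  obtain Y' where Y': "upper_tn Y'" "upper_bidiagonal u' \<odot> semi_diag e = semi_diag e \<odot> Y'"
    using upper_diag_swap[OF G(2) u'] by blast
  have "upper_bidiagonal u \<odot> G = (upper_bidiagonal u \<odot> X) \<odot> semi_diag e \<odot> Y"
    using G by (simp add: semi_mult_assoc)
  also have "\<dots> = X' \<odot> semi_diag d \<odot> (upper_bidiagonal u' \<odot> semi_diag e) \<odot> Y"
    using 1 by (simp add: semi_mult_assoc)
  also have "\<dots> = X' \<odot> semi_diag (\<lambda>i. d i * e i) \<odot> (Y' \<odot> Y)"
    using Y' 1 by (simp add: semi_mult_assoc diag_diag[symmetric])
  finally show ?thesis
    using 1(1) upper_tn_mult[OF Y'(1) G(3)] pivots_mult[OF pivots_pos G(2)] 1(2) ldu_tnI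
    by blast
qed

lemma ldu_tn_upper:
  assumes "upper_tn Y" "ldu_tn n G" shows "ldu_tn n (Y \<odot> G)"
proof -
  have "lower_tn X \<Longrightarrow> ldu_tn n G \<Longrightarrow> ldu_tn n (semi_transpose X \<odot> G)" for X G
  proof (induction arbitrary: G rule: lower_tn.induct)
    case (cons l X)
    then show ?case
      using ldu_tn_upper_bidiagonal[of l n G] by (simp add: semi_transpose_mult semi_mult_assoc)
  qed simp
  from this[of "semi_transpose Y" G] assms show ?thesis by (simp add: upper_tn_def)
qed

text \<open>
  The factors of \<open>F\<close> are absorbed into \<open>G\<close> from the right to the left; every absorption restores
  the order lower, diagonal, upper.
\<close>

lemma ldu_tn_mult:
  assumes "ldu_tn n F" "ldu_tn n G" shows "ldu_tn n (F \<odot> G)"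
proof -
  obtain X e Y where F: "lower_tn X" "pivots n e" "upper_tn Y" "F = X \<odot> semi_diag e \<odot> Y"
    using assms(1) by (rule ldu_tnE)
  then show ?thesis
    using assms(2) by (simp add: semi_mult_assoc ldu_tn_lower ldu_tn_diag ldu_tn_upper)
qed

lemma ldu_tn_semi_transpose:
  assumes "ldu_tn n G" shows "ldu_tn n (semi_transpose G)"
proof -
  obtain X d Y where *: "lower_tn X" "pivots n d" "upper_tn Y" "G = X \<odot> semi_diag d \<odot> Y"
    using assms by (rule ldu_tnE)
  then have "semi_transpose G = semi_transpose Y \<odot> semi_diag d \<odot> semi_transpose X"
    by (simp add: semi_transpose_mult semi_mult_assoc)
  moreover have "lower_tn (semi_transpose Y)" "upper_tn (semi_transpose X)" using * by (simp_all add: upper_tn_def)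
  ultimately show ?thesis using *(2) ldu_tnI by blast
qed

lemma ldu_tn_basic:
  "pivots n d \<Longrightarrow> ldu_tn n (semi_diag d)"
  "(\<And>i. l i \<ge> 0) \<Longrightarrow> ldu_tn n (lower_bidiagonal l)"
  "(\<And>i. l i \<ge> 0) \<Longrightarrow> ldu_tn n (upper_bidiagonal l)"
  "ldu_tn n semi_id"
proof -
  show id: "ldu_tn n semi_id"
    by (rule ldu_tnI[OF lower_tn.id pivots_pos[of "\<lambda>_. 1"] upper_tn_id])
       (simp_all add: semi_id_eq_diag[symmetric])
  show "pivots n d \<Longrightarrow> ldu_tn n (semi_diag d)" using ldu_tn_diag[OF _ id] by simp
  show "(\<And>i. l i \<ge> 0) \<Longrightarrow> ldu_tn n (lower_bidiagonal l)"
    using ldu_tn_lower[OF lower_tn_bidiagonal id] by simp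
  show "(\<And>i. l i \<ge> 0) \<Longrightarrow> ldu_tn n (upper_bidiagonal l)"
    using ldu_tn_upper_bidiagonal[OF _ id] by simp
qed

section \<open>Krylov matrices\<close>

text \<open>
  The direct sum of the scalar 1 and \<open>X\<close>.
\<close>

definition one_plus :: "semi_inf \<Rightarrow> semi_inf" where
  "one_plus X = (\<lambda>i j. case i of 0 \<Rightarrow> if j = 0 then 1 else 0
     | Suc i' \<Rightarrow> (case j of 0 \<Rightarrow> 0 | Suc j' \<Rightarrow> X i' j'))"

text \<open>
  The row \<open>e\<^sub>0\<close> put on top of \<open>X\<close>.
\<close>

definition border :: "semi_inf \<Rightarrow> semi_inf" where
  "border X = (\<lambda>i j. case i of 0 \<Rightarrow> if j = 0 then 1 else 0 | Suc i' \<Rightarrow> X i' j)"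

text \<open>
  Bordering affects only the rightmost factor of a product in an essential way; the other factors are
  merely shifted.  This reduces the Krylov matrix of a product to bordering one bidiagonal matrix.
\<close>

lemma border_mult:
  assumes "row_col_finite X"
  shows "border (X \<odot> Y) = one_plus X \<odot> border Y"
proof (intro ext)
  fix i j
  show "border (X \<odot> Y) i j = (one_plus X \<odot> border Y) i j"
  proof (cases i)
    case 0
    have "(one_plus X \<odot> border Y) 0 j = (\<Sum>k\<le>0. one_plus X 0 k * border Y k j)"
      by (rule semi_mult_eq_sum) (auto simp: one_plus_def)
    then show ?thesis by (simp add: 0 border_def one_plus_def)
  next
    case (Suc m)
    obtain a where a: "\<forall>k>a. X m k = 0" using row_finiteD[OF assms] by blast
    have "(one_plus X \<odot> border Y) i j = (\<Sum>k\<le>Suc a. one_plus X (Suc m) k * border Y k j)"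
      unfolding Suc by (rule semi_mult_eq_sum) (auto simp: one_plus_def a split: nat.split)
    also have "\<dots> = (\<Sum>k\<le>a. X m k * Y k j)"
      by (subst sum.atMost_Suc_shift) (simp add: one_plus_def border_def)
    also have "\<dots> = (X \<odot> Y) m j" by (rule semi_mult_eq_sum[symmetric]) (simp add: a)
    finally show ?thesis by (simp add: Suc border_def)
  qed
qed

lemma one_plus_mult:
  assumes "row_col_finite X"
  shows "one_plus (X \<odot> Y) = one_plus X \<odot> one_plus Y"
proof (intro ext)
  fix i j
  show "one_plus (X \<odot> Y) i j = (one_plus X \<odot> one_plus Y) i j"
  proof (cases i)
    case 0
    have "(one_plus X \<odot> one_plus Y) 0 j = (\<Sum>k\<le>0. one_plus X 0 k * one_plus Y k j)"
      by (rule semi_mult_eq_sum) (auto simp: one_plus_def)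
    then show ?thesis by (simp add: 0 one_plus_def)
  next
    case (Suc m)
    obtain a where a: "\<forall>k>a. X m k = 0" using row_finiteD[OF assms] by blast
    have "(one_plus X \<odot> one_plus Y) i j = (\<Sum>k\<le>Suc a. one_plus X (Suc m) k * one_plus Y k j)"
      unfolding Suc by (rule semi_mult_eq_sum) (auto simp: one_plus_def a split: nat.split)
    also have "\<dots> = (\<Sum>k\<le>a. X m k * one_plus Y (Suc k) j)"
      by (subst sum.atMost_Suc_shift) (simp add: one_plus_def)
    also have "\<dots> = one_plus (X \<odot> Y) i j"
      using semi_mult_eq_sum[of a X m Y] a by (cases j) (simp_all add: Suc one_plus_def)
    finally show ?thesis ..
  qed
qed

lemma one_plus_lower: "one_plus (lower_bidiagonal l) = lower_bidiagonal (case_nat 0 l)"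
  and one_plus_diag: "one_plus (semi_diag d) = semi_diag (case_nat 1 d)"
  and one_plus_id: "one_plus semi_id = semi_id"
  and one_plus_semi_transpose: "semi_transpose (one_plus X) = one_plus (semi_transpose X)"
  by (auto simp: one_plus_def lower_bidiagonal_apply semi_diag_apply semi_id_apply semi_transpose_def fun_eq_iff
      split: nat.splits)

lemma lower_tn_one_plus: "lower_tn X \<Longrightarrow> lower_tn (one_plus X)"
proof (induction rule: lower_tn.induct)
  case (cons l X)
  then show ?case
    by (simp add: one_plus_mult one_plus_lower) (intro lower_tn.cons, auto split: nat.split)
qed (simp add: one_plus_id lower_tn.id)

lemma ldu_tn_one_plus:
  assumes "ldu_tn n G" shows "ldu_tn n (one_plus G)"
proof -
  obtain X d Y where *: "lower_tn X" "pivots n d" "upper_tn Y" "G = X \<odot> semi_diag d \<odot> Y"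
    using assms by (rule ldu_tnE)
  then have "one_plus G = one_plus X \<odot> semi_diag (case_nat 1 d) \<odot> one_plus Y"
    by (simp add: one_plus_mult one_plus_diag)
  moreover have "pivots n (case_nat 1 d)" using *(2) by (auto simp: pivots_def split: nat.splits)
  moreover have "upper_tn (one_plus Y)"
    using *(3) by (simp add: upper_tn_def one_plus_semi_transpose lower_tn_one_plus)
  ultimately show ?thesis
    using lower_tn_one_plus[OF *(1)] ldu_tnI by blast
qed

primrec semi_pow :: "semi_inf \<Rightarrow> nat \<Rightarrow> semi_inf" where
  "semi_pow M 0 = semi_id"
| "semi_pow M (Suc k) = semi_pow M k \<odot> M"

text \<open>
  The Krylov matrix of \<open>M\<close> has the rows \<open>e\<^sub>0 M\<^sup>i\<close>.  It is the row \<open>e\<^sub>0\<close> followed by the Krylov matrix times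
  \<open>M\<close>, that is, it equals (1 + Krylov matrix) times the bordered \<open>M\<close>, where + is the direct sum.
  Unfolding this \<open>k\<close> times gives a finite product whose rows \<open>0, \<dots>, k\<close> are already correct.
\<close>

primrec krylov :: "semi_inf \<Rightarrow> nat \<Rightarrow> semi_inf" where
  "krylov M 0 = semi_id"
| "krylov M (Suc k) = one_plus (krylov M k) \<odot> border M"

lemma ldu_tn_krylov: "ldu_tn n (border M) \<Longrightarrow> ldu_tn n (krylov M k)"
  by (induction k) (simp_all add: ldu_tn_basic ldu_tn_mult ldu_tn_one_plus)

lemma krylov_row:
  assumes fin: "\<And>j. row_col_finite (krylov M j)" and "i \<le> k"
  shows "krylov M k i = semi_pow M i 0"
  using \<open>i \<le> k\<close>
proof (induction k arbitrary: i)
  case (Suc k)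
  have "krylov M (Suc k) = border (krylov M k \<odot> M)"
    using fin by (simp add: border_mult)
  then show ?case using Suc
    by (cases i) (auto simp: border_def semi_id_apply fun_eq_iff semi_mult_def)
qed simp

text \<open>
  The truncation of size \<open>n\<close>, kept as a semi-infinite matrix: the Krylov matrix of a truncation of size
  \<open>n\<close> is a product of factors that reach beyond the index \<open>n\<close>.
\<close>

definition corner :: "nat \<Rightarrow> semi_inf \<Rightarrow> semi_inf" where
  "corner n X = (\<lambda>i j. if i < n \<and> j < n then X i j else 0)"

abbreviation corner_id :: "nat \<Rightarrow> semi_inf" where
  "corner_id n \<equiv> semi_diag (\<lambda>i. if i < n then 1 else 0)"

lemma corner_eq_corner_id: "corner n X = corner_id n \<odot> X \<odot> corner_id n"
  by (auto simp: corner_def fun_eq_iff semi_diag_mult mult_semi_diag)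

lemma ldu_tn_corner_id: "ldu_tn n (corner_id n)"
  by (rule ldu_tn_basic) (auto simp: pivots_def)

lemma ldu_tn_corner: "ldu_tn n X \<Longrightarrow> ldu_tn n (corner n X)"
  by (simp add: corner_eq_corner_id ldu_tn_mult ldu_tn_corner_id)

text \<open>
  Row 0 is \<open>e\<^sub>0\<close> and row \<open>i + 1\<close> has the entries 1 and \<open>u\<^sub>i\<close> at \<open>i\<close> and \<open>i + 1\<close>.  So bordering turns an upper
  bidiagonal matrix into a lower bidiagonal one, with the diagonal \<open>1, u\<^sub>0, u\<^sub>1, \<dots>\<close>; positivity of the
  superdiagonal is what makes the first \<open>n\<close> pivots positive.
\<close>

lemma ldu_tn_border_corner_upper:
  assumes "n \<ge> 1" "\<And>i. u i > 0"
  shows "ldu_tn n (border (corner n (upper_bidiagonal u)))"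
proof -
  define d where "d = case_nat 1 (\<lambda>i. if Suc i < n then u i else 0)"
  have u0: "u i \<noteq> 0" for i using assms(2)[of i] by simp
  have d: "pivots n d" using assms u0 by (auto simp: pivots_def d_def less_imp_le split: nat.splits)
  have "border (corner n (upper_bidiagonal u)) = lower_bidiagonal (\<lambda>i. 1 / d i) \<odot> semi_diag d"
    using assms(1) u0
    by (auto simp: fun_eq_iff mult_semi_diag lower_bidiagonal_apply border_def corner_def
        upper_bidiagonal_apply d_def split: nat.splits)
  moreover have "1 / d i \<ge> 0" for i using d by (simp add: pivots_def)
  ultimately show ?thesis using d by (simp add: ldu_tn_mult ldu_tn_basic)
qed

section \<open>Positive definite Hankel matrices\<close>

text \<open>
  Uniqueness of the factorization for symmetric \<open>G\<close>: compare column \<open>k\<close> with row \<open>k\<close>, the earlier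
  columns being settled by induction.
\<close>

lemma ldu_tn_symmetric_factor:
  assumes X: "lower_tn X" and Y: "upper_tn Y" and d: "pivots n d"
    and G: "G = X \<odot> semi_diag d \<odot> Y"
    and sym: "\<And>i j. i < n \<Longrightarrow> j < n \<Longrightarrow> G i j = G j i"
    and "i < n" "k < n"
  shows "X i k = Y k i"
  using \<open>i < n\<close> \<open>k < n\<close>
proof (induction k arbitrary: i rule: less_induct)
  case (less k)
  have G': "G i j = (\<Sum>m\<le>k. X i m * (d m * Y m j))" if "i = k \<or> j = k" for i j
    unfolding G using that lower_tn_entries[OF X] upper_tn_entries[OF Y]
    by (subst semi_mult_eq_sum[of k]) (auto simp: semi_diag_mult)
  have eq: "X i m * (d m * Y m k) = X k m * (d m * Y m i)" if "m < k" for m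
    using less.IH[of m i] less.IH[of m k] that less.prems by simp
  have "G i k = G k i" using sym less.prems by simp
  then have "(\<Sum>m<k. X i m * (d m * Y m k)) + X i k * (d k * Y k k) =
      (\<Sum>m<k. X k m * (d m * Y m i)) + X k k * (d k * Y k i)"
    by (simp add: G' lessThan_Suc_atMost[symmetric])
  then have "X i k * d k = d k * Y k i"
    using eq lower_tn_entries[OF X, of k] upper_tn_entries[OF Y, of k] by simp
  moreover have "d k > 0" using d less.prems by (simp add: pivots_def)
  ultimately show ?case by simp
qed

definition hankel_form :: "nat \<Rightarrow> (nat \<Rightarrow> real) \<Rightarrow> (nat \<Rightarrow> real) \<Rightarrow> real" where
  "hankel_form n h c = (\<Sum>i<n. \<Sum>j<n. c i * c j * h (i + j))"

definition hankel_pd :: "nat \<Rightarrow> (nat \<Rightarrow> real) \<Rightarrow> bool" where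
  "hankel_pd n h \<longleftrightarrow> (\<forall>c. 0 \<le> hankel_form n h c \<and> (hankel_form n h c = 0 \<longrightarrow> (\<forall>i<n. c i = 0)))"

text \<open>
  With \<open>Y\<close> the transpose of \<open>X\<close> on the corner, the quadratic form is a sum of squares with positive
  coefficients, and unitriangularity of \<open>X\<close> gives definiteness.
\<close>

lemma ldu_tn_hankel_pd:
  assumes "ldu_tn n G" and h: "\<And>i j. i < n \<Longrightarrow> j < n \<Longrightarrow> G i j = h (i + j)"
  shows "hankel_pd n h"
proof -
  obtain X d Y where *: "lower_tn X" "pivots n d" "upper_tn Y" "G = X \<odot> semi_diag d \<odot> Y"
    using assms(1) by (rule ldu_tnE)
  have sym: "X i k = Y k i" if "i < n" "k < n" for i k
    using ldu_tn_symmetric_factor[OF *(1,3,2,4) _ that] h by (simp add: add.commute)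
  have d: "d k > 0" if "k < n" for k using * that by (simp add: pivots_def)
  have hX: "h (i + j) = (\<Sum>k<n. d k * X i k * X j k)" if "i < n" "j < n" for i j
  proof -
    have "G i j = (\<Sum>k\<le>n - 1. X i k * (d k * Y k j))"
      unfolding * using lower_tn_entries[OF *(1)] that
      by (subst semi_mult_eq_sum[of "n - 1"]) (auto simp: semi_diag_mult)
    also have "{..n - 1} = {..<n}" using that by auto
    finally show ?thesis using h[OF that] sym[OF that(2)] by (simp add: mult.assoc mult.left_commute)
  qed
  have form: "hankel_form n h c = (\<Sum>k<n. d k * (\<Sum>i<n. c i * X i k)\<^sup>2)" for c
  proof -
    have "hankel_form n h c = (\<Sum>i<n. \<Sum>j<n. \<Sum>k<n. d k * ((c i * X i k) * (c j * X j k)))"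
      unfolding hankel_form_def
      by (intro sum.cong refl) (simp add: hX sum_distrib_left mult_ac)
    also have "\<dots> = (\<Sum>i<n. \<Sum>k<n. \<Sum>j<n. d k * ((c i * X i k) * (c j * X j k)))"
      by (intro sum.cong refl sum.swap)
    also have "\<dots> = (\<Sum>k<n. \<Sum>i<n. \<Sum>j<n. d k * ((c i * X i k) * (c j * X j k)))"
      by (rule sum.swap)
    also have "\<dots> = (\<Sum>k<n. d k * (\<Sum>i<n. \<Sum>j<n. (c i * X i k) * (c j * X j k)))"
      by (simp add: sum_distrib_left)
    finally show ?thesis by (simp add: power2_eq_square sum_product)
  qed
  have "\<forall>i<n. c i = 0" if "hankel_form n h c = 0" for c
  proof -
    have "\<forall>k\<in>{..<n}. d k * (\<Sum>i<n. c i * X i k)\<^sup>2 = 0"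
      using that unfolding form by (subst (asm) sum_nonneg_eq_0_iff) (auto simp: d less_imp_le)
    then have s: "(\<Sum>i<n. c i * X i k) = 0" if "k < n" for k using d[OF that] that by force
    have "c k = 0" if "k < n" for k using that
    proof (induction "n - k" arbitrary: k rule: less_induct)
      case less
      have "(\<Sum>i<n. c i * X i k) = (\<Sum>i<n. if i = k then c k else 0)"
      proof (intro sum.cong refl)
        fix i assume "i \<in> {..<n}"
        then show "c i * X i k = (if i = k then c k else 0)"
          using less.hyps[of i] less.prems lower_tn_entries[OF *(1), of i]
          by (cases i k rule: linorder_cases) auto
      qed
      with s[OF less.prems] less.prems show ?case by simp
    qed
    then show ?thesis by blast
  qed
  moreover have "0 \<le> hankel_form n h c" for c
    unfolding form by (intro sum_nonneg) (auto simp: d less_imp_le)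
  ultimately show ?thesis unfolding hankel_pd_def by blast
qed

lemma row_col_finite_semi_pow [simp]: "row_col_finite M \<Longrightarrow> row_col_finite (semi_pow M k)"
  by (induction k) auto

lemma semi_pow_intertwine:
  assumes fin: "row_col_finite M" "row_col_finite N" "row_col_finite C" and "C \<odot> M = N \<odot> C"
  shows "C \<odot> semi_pow M k = semi_pow N k \<odot> C"
proof (induction k)
  case (Suc k)
  have "C \<odot> semi_pow M (Suc k) = (C \<odot> semi_pow M k) \<odot> M" by (simp add: semi_mult_assoc fin)
  also have "\<dots> = semi_pow N k \<odot> C \<odot> M" by (simp add: Suc semi_mult_assoc fin)
  also have "\<dots> = semi_pow N (Suc k) \<odot> C" by (simp add: assms semi_mult_assoc)
  finally show ?case .
qed simp

lemma semi_pow_add: "row_col_finite M \<Longrightarrow> semi_pow M (i + j) = semi_pow M i \<odot> semi_pow M j"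
  by (induction j) (auto simp: semi_mult_assoc)

lemma semi_pow_commute: "row_col_finite M \<Longrightarrow> M \<odot> semi_pow M k = semi_pow M k \<odot> M"
  using semi_pow_intertwine[of M M M] by simp

lemma semi_transpose_semi_pow: "row_col_finite M \<Longrightarrow> semi_transpose (semi_pow M k) = semi_pow (semi_transpose M) k"
  by (induction k) (simp_all add: semi_transpose_mult semi_pow_commute)

lemma row_col_finite_corner [simp]: "row_col_finite (corner n X)"
  unfolding row_col_finite_def corner_def by (intro allI exI[of _ n]) auto

lemma corner_mult_lower:
  assumes "row_col_finite X" and "\<And>i j. j > i \<Longrightarrow> X i j = 0"
  shows "corner n (X \<odot> Y) = corner n X \<odot> corner n Y"
proof -
  have "(X \<odot> Y) i j = (corner n X \<odot> corner n Y) i j" if "i < n" "j < n" for i j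
    using that assms(2)[of i] by (simp add: semi_mult_eq_sum[of i] corner_def)
  moreover have "(corner n X \<odot> corner n Y) i j = 0" if "\<not> (i < n \<and> j < n)" for i j
    using that by (subst semi_mult_eq_sum[of n]) (auto simp: corner_def)
  ultimately show ?thesis by (auto simp: corner_def[of n "X \<odot> Y"] fun_eq_iff)
qed

lemma semi_transpose_corner: "semi_transpose (corner n X) = corner n (semi_transpose X)"
  by (auto simp: corner_def semi_transpose_def fun_eq_iff)

lemma corner_mult_upper:
  assumes "row_col_finite Y" and "\<And>i j. i > j \<Longrightarrow> Y i j = 0"
  shows "corner n (X \<odot> Y) = corner n X \<odot> corner n Y"
proof -
  have "semi_transpose Y i j = 0" if "j > i" for i j using assms(2) that by (simp add: semi_transpose_def)
  then have "semi_transpose (corner n (X \<odot> Y)) = semi_transpose (corner n X \<odot> corner n Y)"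
    unfolding semi_transpose_corner semi_transpose_mult
    by (intro corner_mult_lower) (use assms in auto)
  then show ?thesis by (metis semi_transpose_semi_transpose)
qed

text \<open>
  The two given factorizations of \<open>M\<close> say that conjugation by \<open>F\<close> moves \<open>M\<close> to a matrix \<open>P\<close> with
  rightmost factor \<open>U(u)\<close>, and conjugation by \<open>E\<close> moves the transpose of \<open>M\<close> to a matrix \<open>Q\<close> with rightmost
  factor \<open>U(l)\<close>.  The invertibility of \<open>F\<close> and \<open>E\<close> is replaced by the intertwining relations
  \<open>F M = P F\<close> and \<open>M E = E Q\<^sup>T\<close>.  Row \<open>i\<close> of the Krylov matrix of \<open>P\<close> times \<open>F\<close> is then \<open>e\<^sub>0 F M\<^sup>i\<close>, dually for
  \<open>Q\<close> and \<open>E\<close>, so that the Hankel matrix is a corner of the product \<open>G\<close> below.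
\<close>

lemma hankel_pd_factorization:
  assumes n: "n \<ge> 1"
    and F: "ldu_tn n F" and E: "ldu_tn n E"
    and C: "ldu_tn n C" and C': "ldu_tn n C'"
    and u: "\<And>i. u i > 0" and l: "\<And>i. l i > 0"
    and M1: "M = C \<odot> corner n (upper_bidiagonal u) \<odot> F"
    and M2: "M = E \<odot> corner n (lower_bidiagonal l) \<odot> C'"
  shows "hankel_pd n (\<lambda>k. (F \<odot> semi_pow M k \<odot> E) 0 0)"
proof -
  have bid: "ldu_tn n (corner n (upper_bidiagonal u))" "ldu_tn n (corner n (lower_bidiagonal l))"
    using u l by (auto intro!: ldu_tn_corner ldu_tn_basic less_imp_le)
  note fin [simp] = F[THEN ldu_tn_row_col_finite] E[THEN ldu_tn_row_col_finite]
    C[THEN ldu_tn_row_col_finite] C'[THEN ldu_tn_row_col_finite] 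
  have finM [simp]: "row_col_finite M" by (simp add: M1)
  define P where "P = (F \<odot> C) \<odot> corner n (upper_bidiagonal u)"
  define Q where "Q = (semi_transpose E \<odot> semi_transpose C') \<odot> corner n (upper_bidiagonal l)"
  have [simp]: "row_col_finite P" "row_col_finite Q" by (simp_all add: P_def Q_def)
  have bP: "ldu_tn n (border P)" unfolding P_def
    by (subst border_mult)
       (auto intro!: ldu_tn_mult ldu_tn_one_plus ldu_tn_border_corner_upper F C n u)
  have bQ: "ldu_tn n (border Q)" unfolding Q_def
    by (subst border_mult)
       (auto intro!: ldu_tn_mult ldu_tn_one_plus ldu_tn_border_corner_upper ldu_tn_semi_transpose E C' n l)
  have FM: "F \<odot> semi_pow M k = semi_pow P k \<odot> F" for k
    by (rule semi_pow_intertwine) (simp_all add: M1 P_def semi_mult_assoc)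
  have "M \<odot> E = E \<odot> semi_transpose Q"
    by (simp add: M2 Q_def semi_transpose_mult semi_transpose_corner semi_mult_assoc)
  then have "semi_transpose E \<odot> semi_transpose M = Q \<odot> semi_transpose E" by (metis semi_transpose_mult semi_transpose_semi_transpose)
  then have ME: "semi_transpose E \<odot> semi_pow (semi_transpose M) k = semi_pow Q k \<odot> semi_transpose E" for k
    by (intro semi_pow_intertwine) simp_all
  have ME: "semi_pow M k \<odot> E = E \<odot> semi_transpose (semi_pow Q k)" for k
  proof -
    have "semi_transpose (semi_pow M k \<odot> E) = semi_transpose E \<odot> semi_pow (semi_transpose M) k"
      by (simp add: semi_transpose_mult semi_transpose_semi_pow)
    also have "\<dots> = semi_transpose (E \<odot> semi_transpose (semi_pow Q k))" by (simp add: ME semi_transpose_mult)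
    finally show ?thesis by (metis semi_transpose_semi_transpose)
  qed
  define G where "G = krylov P n \<odot> (F \<odot> E) \<odot> semi_transpose (krylov Q n)"
  have kP: "ldu_tn n (krylov P k)" and kQ: "ldu_tn n (krylov Q k)" for k
    using bP bQ by (simp_all add: ldu_tn_krylov)
  have [simp]: "row_col_finite (krylov P k)" "row_col_finite (krylov Q k)" for k
    using kP[of k] kQ[of k] by simp_all
  have "G i j = (F \<odot> semi_pow M (i + j) \<odot> E) 0 0" if "i < n" "j < n" for i j
  proof -
    have rP: "krylov P n i = semi_pow P i 0" using that by (intro krylov_row) auto
    have rQ: "krylov Q n j = semi_pow Q j 0" using that by (intro krylov_row) auto
    have "G i j = (semi_pow P i \<odot> (F \<odot> E) \<odot> semi_transpose (krylov Q n)) 0 j"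
      by (simp add: G_def semi_mult_def rP)
    also have "\<dots> = ((semi_pow P i \<odot> (F \<odot> E)) \<odot> semi_transpose (krylov Q n)) 0 j"
      by (simp add: semi_mult_assoc)
    also have "\<dots> = ((semi_pow P i \<odot> (F \<odot> E)) \<odot> semi_transpose (semi_pow Q j)) 0 0"
      unfolding semi_mult_def[of "semi_pow P i \<odot> (F \<odot> E)"] by (simp add: semi_transpose_def rQ)
    also have "(semi_pow P i \<odot> (F \<odot> E)) \<odot> semi_transpose (semi_pow Q j) =
        (semi_pow P i \<odot> F) \<odot> E \<odot> semi_transpose (semi_pow Q j)"
      by (simp add: semi_mult_assoc)
    also have "\<dots> = F \<odot> semi_pow M (i + j) \<odot> E"
      by (simp add: FM[symmetric] ME[symmetric] semi_pow_add semi_mult_assoc)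
    finally show ?thesis .
  qed
  moreover have "ldu_tn n G" unfolding G_def
    by (intro ldu_tn_mult ldu_tn_semi_transpose kP kQ F E)
  ultimately show ?thesis by (rule ldu_tn_hankel_pd[rotated])
qed

section \<open>Polynomials acting on vectors\<close>

definition mat_vec :: "nat \<Rightarrow> semi_inf \<Rightarrow> (nat \<Rightarrow> real) \<Rightarrow> nat \<Rightarrow> real" where
  "mat_vec n X v = (\<lambda>i. if i < n then \<Sum>j<n. X i j * v j else 0)"

definition inner_upto :: "nat \<Rightarrow> (nat \<Rightarrow> real) \<Rightarrow> (nat \<Rightarrow> real) \<Rightarrow> real" where
  "inner_upto n w v = (\<Sum>i<n. w i * v i)"

definition poly_act :: "nat \<Rightarrow> semi_inf \<Rightarrow> real poly \<Rightarrow> (nat \<Rightarrow> real) \<Rightarrow> nat \<Rightarrow> real" where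
  "poly_act n X f v = (\<lambda>i. \<Sum>k\<le>degree f. coeff f k * (mat_vec n X ^^ k) v i)"

lemma poly_act_eq_sum:
  assumes "\<And>k. k > m \<Longrightarrow> coeff f k = 0"
  shows "poly_act n X f v i = (\<Sum>k\<le>m. coeff f k * (mat_vec n X ^^ k) v i)"
  unfolding poly_act_def
proof (rule sum.mono_neutral_left)
  show "{..degree f} \<subseteq> {..m}" using degree_le[of m f] assms by auto
qed (auto simp: coeff_eq_0)

lemma mat_vec_lin: "mat_vec n X (\<lambda>i. a * v i + b * w i) = (\<lambda>i. a * mat_vec n X v i + b * mat_vec n X w i)"
  by (auto simp: mat_vec_def fun_eq_iff sum.distrib sum_distrib_left algebra_simps)

lemma poly_act_0 [simp]: "poly_act n X 0 v = (\<lambda>_. 0)"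
  by (simp add: poly_act_def fun_eq_iff)

lemma poly_act_1 [simp]: "poly_act n X 1 v = v"
  by (simp add: poly_act_def fun_eq_iff)

lemma poly_act_pCons [simp]:
  "poly_act n X (pCons a f) v = (\<lambda>i. a * v i + poly_act n X f (mat_vec n X v) i)"
proof
  fix i
  have "poly_act n X (pCons a f) v i = (\<Sum>k\<le>Suc (degree f). coeff (pCons a f) k * (mat_vec n X ^^ k) v i)"
    by (rule poly_act_eq_sum) (auto simp: coeff_pCons coeff_eq_0 split: nat.split)
  also have "\<dots> = a * v i + (\<Sum>k\<le>degree f. coeff f k * (mat_vec n X ^^ k) (mat_vec n X v) i)"
    by (subst sum.atMost_Suc_shift) (simp add: funpow_Suc_right del: funpow.simps)
  finally show "poly_act n X (pCons a f) v i = a * v i + poly_act n X f (mat_vec n X v) i"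
    by (simp add: poly_act_def)
qed

lemma poly_act_vec_lin:
  "poly_act n X f (\<lambda>i. a * v i + b * w i) = (\<lambda>i. a * poly_act n X f v i + b * poly_act n X f w i)"
  by (induction f arbitrary: v w) (auto simp: mat_vec_lin fun_eq_iff algebra_simps)

lemma poly_act_zero_vec [simp]: "poly_act n X f (\<lambda>_. 0) = (\<lambda>_. 0)"
  using poly_act_vec_lin[of n X f 0 "\<lambda>_. 0" 0 "\<lambda>_. 0"] by simp

lemma poly_act_add: "poly_act n X (f + g) v = (\<lambda>i. poly_act n X f v i + poly_act n X g v i)"
proof
  fix i
  let ?m = "max (degree f) (degree g)"
  have "poly_act n X h v i = (\<Sum>k\<le>?m. coeff h k * (mat_vec n X ^^ k) v i)" 
    if "h = f \<or> h = g \<or> h = f + g" for h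
    by (rule poly_act_eq_sum) (use that in \<open>auto simp: coeff_eq_0\<close>)
  then show "poly_act n X (f + g) v i = poly_act n X f v i + poly_act n X g v i"
    by (simp add: sum.distrib algebra_simps)
qed

lemma poly_act_smult: "poly_act n X (Polynomial.smult a f) v = (\<lambda>i. a * poly_act n X f v i)"
proof
  fix i
  have "poly_act n X (Polynomial.smult a f) v i =
      (\<Sum>k\<le>degree f. coeff (Polynomial.smult a f) k * (mat_vec n X ^^ k) v i)"
    by (rule poly_act_eq_sum) (simp add: coeff_eq_0)
  then show "poly_act n X (Polynomial.smult a f) v i = a * poly_act n X f v i"
    by (simp add: poly_act_def sum_distrib_left mult.assoc)
qed

lemma poly_act_sum: "finite A \<Longrightarrow> poly_act n X (\<Sum>a\<in>A. f a) v = (\<lambda>i. \<Sum>a\<in>A. poly_act n X (f a) v i)"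
  by (induction A rule: finite_induct) (auto simp: poly_act_add)

lemma poly_act_diff: "poly_act n X (f - g) v = (\<lambda>i. poly_act n X f v i - poly_act n X g v i)"
  using poly_act_add[of n X f "- g" v] poly_act_smult[of n X "-1" g v] by simp

lemma poly_act_mat_vec: "poly_act n X f (mat_vec n X v) = mat_vec n X (poly_act n X f v)"
proof (induction f arbitrary: v)
  case (pCons a f)
  then show ?case using mat_vec_lin[of n X a v 1 "poly_act n X f (mat_vec n X v)"] by simp
qed (simp add: mat_vec_def fun_eq_iff)

lemma poly_act_mult: "poly_act n X (f * g) v = poly_act n X f (poly_act n X g v)"
proof (induction f arbitrary: v)
  case (pCons a f)
  then show ?case by (simp add: poly_act_add poly_act_smult poly_act_mat_vec)
qed simp

text \<open>
  On these vectors \<open>poly_act\<close> is the action of the truncation of size \<open>n\<close>, and two of them agree as soon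
  as their entries below \<open>n\<close> do.
\<close>

definition supp_upto :: "nat \<Rightarrow> (nat \<Rightarrow> real) \<Rightarrow> bool" where
  "supp_upto n v \<longleftrightarrow> (\<forall>i\<ge>n. v i = 0)"

lemma supp_upto_mat_vec [simp]: "supp_upto n (mat_vec n X v)"
  by (simp add: supp_upto_def mat_vec_def)

lemma supp_upto_poly_act [simp]: "supp_upto n v \<Longrightarrow> supp_upto n (poly_act n X f v)"
  by (induction f arbitrary: v) (auto simp: supp_upto_def mat_vec_def)

lemma inner_upto_mat_vec: "inner_upto n w (mat_vec n X v) = inner_upto n (mat_vec n (semi_transpose X) w) v"
proof -
  have "inner_upto n w (mat_vec n X v) = (\<Sum>i<n. \<Sum>j<n. w i * (X i j * v j))"
    by (simp add: inner_upto_def mat_vec_def sum_distrib_left)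
  also have "\<dots> = (\<Sum>j<n. \<Sum>i<n. w i * (X i j * v j))" by (rule sum.swap)
  also have "\<dots> = inner_upto n (mat_vec n (semi_transpose X) w) v"
    by (simp add: inner_upto_def mat_vec_def sum_distrib_right sum_distrib_left semi_transpose_def mult_ac)
  finally show ?thesis .
qed

lemma inner_upto_lin:
  "inner_upto n w (\<lambda>i. a * v i + b * v' i) = a * inner_upto n w v + b * inner_upto n w v'"
  "inner_upto n (\<lambda>i. a * v i + b * v' i) w = a * inner_upto n v w + b * inner_upto n v' w"
  by (simp_all add: inner_upto_def sum_distrib_left sum.distrib[symmetric] algebra_simps)

lemma inner_upto_poly_act:
  "inner_upto n w (poly_act n X f v) = inner_upto n (poly_act n (semi_transpose X) f w) v"
proof (induction f arbitrary: v w)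
  case (pCons a f)
  show ?case
    using inner_upto_lin(1)[of n w a v 1 "poly_act n X f (mat_vec n X v)"]
      inner_upto_lin(2)[of n a w 1 "poly_act n (semi_transpose X) f (mat_vec n (semi_transpose X) w)" v]
    by (simp add: pCons inner_upto_mat_vec poly_act_mat_vec)
qed (simp add: inner_upto_def)

definition unit_fun :: "nat \<Rightarrow> nat \<Rightarrow> real" where
  "unit_fun k = (\<lambda>i. if i = k then 1 else 0)"

lemma supp_upto_unit_fun [simp]: "k < n \<Longrightarrow> supp_upto n (unit_fun k)"
  by (simp add: supp_upto_def unit_fun_def)

definition moment :: "nat \<Rightarrow> semi_inf \<Rightarrow> (nat \<Rightarrow> real) \<Rightarrow> (nat \<Rightarrow> real) \<Rightarrow> nat \<Rightarrow> real" where
  "moment n X w v k = inner_upto n w ((mat_vec n X ^^ k) v)"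

definition functional :: "nat \<Rightarrow> semi_inf \<Rightarrow> (nat \<Rightarrow> real) \<Rightarrow> (nat \<Rightarrow> real) \<Rightarrow> real poly \<Rightarrow> real" where
  "functional n X w v f = inner_upto n w (poly_act n X f v)"

lemma functional_eq_sum: "functional n X w v f = (\<Sum>k\<le>degree f. coeff f k * moment n X w v k)"
proof -
  have "functional n X w v f = (\<Sum>i<n. \<Sum>k\<le>degree f. w i * (coeff f k * (mat_vec n X ^^ k) v i))"
    by (simp add: functional_def inner_upto_def poly_act_def sum_distrib_left)
  also have "\<dots> = (\<Sum>k\<le>degree f. \<Sum>i<n. w i * (coeff f k * (mat_vec n X ^^ k) v i))"
    by (rule sum.swap)
  finally show ?thesis by (simp add: moment_def inner_upto_def sum_distrib_left mult_ac)
qed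

lemma functional_add: "functional n X w v (f + g) = functional n X w v f + functional n X w v g"
  using inner_upto_lin(1)[of n w 1 _ 1] by (simp add: functional_def poly_act_add)

lemma functional_smult: "functional n X w v (Polynomial.smult a f) = a * functional n X w v f"
  using inner_upto_lin(1)[of n w a _ 0 "\<lambda>_. 0"] by (simp add: functional_def poly_act_smult)

lemma functional_0 [simp]: "functional n X w v 0 = 0"
  by (simp add: functional_def inner_upto_def)

lemma functional_sum: "finite A \<Longrightarrow> functional n X w v (\<Sum>a\<in>A. f a) = (\<Sum>a\<in>A. functional n X w v (f a))"
  by (induction A rule: finite_induct) (auto simp: functional_add)

lemma functional_square:
  assumes "degree f < n"
  shows "functional n X w v (f * f) = hankel_form n (moment n X w v) (coeff f)"
proof -
  have f: "f = (\<Sum>i<n. monom (coeff f i) i)"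
    by (rule poly_eqI) (use assms in \<open>auto simp: coeff_sum coeff_eq_0\<close>)
  have mon: "functional n X w v (monom a k) = a * moment n X w v k" for a k
  proof (cases "a = 0")
    case False
    have "(\<Sum>j\<le>k. coeff (monom a k) j * moment n X w v j) = a * moment n X w v k"
      by (subst sum.remove[of _ k]) (auto intro!: sum.neutral)
    then show ?thesis using False by (simp add: functional_eq_sum degree_monom_eq)
  qed simp
  have "f * f = (\<Sum>i<n. \<Sum>j<n. monom (coeff f i * coeff f j) (i + j))"
    by (subst (1 2) f) (simp add: sum_product mult_monom)
  then show ?thesis by (simp add: functional_sum mon hankel_form_def)
qed

lemma square_ge_0:
  "hankel_pd n (moment n X w v) \<Longrightarrow> degree f < n \<Longrightarrow> functional n X w v (f * f) \<ge> 0"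
  by (simp add: functional_square hankel_pd_def)

lemma square_gt_0:
  assumes "hankel_pd n (moment n X w v)" "degree f < n" "f \<noteq> 0"
  shows "functional n X w v (f * f) > 0"
proof -
  have "hankel_form n (moment n X w v) (coeff f) \<noteq> 0"
    using assms leading_coeff_0_iff[of f] unfolding hankel_pd_def by blast
  then show ?thesis using assms(1,2) by (simp add: functional_square hankel_pd_def less_le)
qed

text \<open>
  By \<open>cyclic_inj\<close> and \<open>cyclic_surj\<close> this makes \<open>e\<^sub>0\<close> a cyclic vector of the truncation.
\<close>

definition cyclic :: "nat \<Rightarrow> semi_inf \<Rightarrow> bool" where
  "cyclic n X \<longleftrightarrow> n \<ge> 1 \<and> hankel_pd n (moment n X (unit_fun 0) (unit_fun 0))"

lemma functional_mult_null:
  "poly_act n X g v = (\<lambda>_. 0) \<Longrightarrow> functional n X w v (f * g) = 0"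
  by (simp add: functional_def poly_act_mult inner_upto_def)

text \<open>
  If \<open>f(X)\<close> annihilates \<open>e\<^sub>0\<close> then the square of \<open>f\<close> has the value 0 under a positive definite functional.
\<close>

lemma cyclic_inj:
  assumes "cyclic n X" "degree f < n" "poly_act n X f (unit_fun 0) = (\<lambda>_. 0)"
  shows "f = 0"
  using assms square_gt_0[of n X "unit_fun 0" "unit_fun 0" f] functional_mult_null[OF assms(3), of "unit_fun 0" f]
  by (auto simp: cyclic_def)

text \<open>
  The matrix \<open>K\<close> with the columns \<open>X\<^sup>k e\<^sub>0\<close> is square and, by \<open>cyclic_inj\<close>, has trivial kernel.
\<close>

lemma cyclic_surj:
  assumes c: "cyclic n X" and y: "supp_upto n y"
  shows "\<exists>f. degree f < n \<and> poly_act n X f (unit_fun 0) = y"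
proof -
  have n: "n \<ge> 1" using c by (simp add: cyclic_def)
  define K where "K = mat n n (\<lambda>(i, k). (mat_vec n X ^^ k) (unit_fun 0) i)"
  define pol where "pol c = (\<Sum>k<n. monom (vec_index c k) k)" for c :: "real vec"
  have K: "K \<in> carrier_mat n n" by (simp add: K_def)
  have cf: "coeff (pol c) k = (if k < n then vec_index c k else 0)" for c k
    by (simp add: pol_def coeff_sum)
  have deg: "degree (pol c) < n" for c
  proof -
    have "degree (pol c) \<le> n - 1" by (intro degree_le) (auto simp: cf)
    then show ?thesis using n by linarith
  qed
  have act: "poly_act n X (pol c) (unit_fun 0) i = (if i < n then vec_index (K *\<^sub>v c) i else 0)"
    if "c \<in> carrier_vec n" for c i
  proof (cases "i < n")
    case True
    have "poly_act n X (pol c) (unit_fun 0) i =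
        (\<Sum>k\<le>n - 1. coeff (pol c) k * (mat_vec n X ^^ k) (unit_fun 0) i)"
      using n by (intro poly_act_eq_sum) (auto simp: cf)
    also have "{..n - 1} = {..<n}" using n by auto
    also have "(\<Sum>k<n. coeff (pol c) k * (mat_vec n X ^^ k) (unit_fun 0) i) = vec_index (K *\<^sub>v c) i"
    proof -
      have "vec_index (K *\<^sub>v c) i = (\<Sum>k\<in>{0..<n}. K $$ (i, k) * vec_index c k)"
        using K that True by (auto simp: scalar_prod_def)
      then show ?thesis
        using True by (simp add: cf K_def lessThan_atLeast0 mult.commute)
    qed
    finally show ?thesis using True by simp
  next
    case False
    have "supp_upto n (poly_act n X (pol c) (unit_fun 0))" using n by simp
    then show ?thesis using False by (simp add: supp_upto_def)
  qed
  have "Determinant.det K \<noteq> 0"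
  proof
    assume "Determinant.det K = 0"
    then obtain c where c': "c \<in> carrier_vec n" "c \<noteq> 0\<^sub>v n" "K *\<^sub>v c = 0\<^sub>v n"
      using det_0_iff_vec_prod_zero_field[OF K] by blast
    have "poly_act n X (pol c) (unit_fun 0) = (\<lambda>_. 0)"
      using act[OF c'(1)] c'(3) by (auto simp: fun_eq_iff)
    then have "pol c = 0" using cyclic_inj[OF c deg] by blast
    then have "vec_index c k = 0" if "k < n" for k using cf[of c k] that by simp
    then have "c = 0\<^sub>v n" using c'(1) by (intro eq_vecI) auto
    then show False using c'(2) by blast
  qed
  then have "K \<in> Units (ring_mat TYPE(real) n ())" by (rule det_non_zero_imp_unit[OF K])
  then obtain K' where K': "K' \<in> carrier_mat n n" "K * K' = 1\<^sub>m n"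
    by (auto simp: Units_def ring_mat_def)
  define c where "c = K' *\<^sub>v vec n y"
  have cc: "c \<in> carrier_vec n" using K' by (simp add: c_def)
  have "K *\<^sub>v c = vec n y"
    using K K' by (simp add: c_def assoc_mult_mat_vec[symmetric, of _ n n _ n])
  then have "poly_act n X (pol c) (unit_fun 0) = y"
    using act[OF cc] y by (auto simp: fun_eq_iff supp_upto_def)
  then show ?thesis using deg by blast
qed

text \<open>
  \<open>X\<^sup>n e\<^sub>0\<close> is a combination of the lower powers, and a polynomial that annihilates the cyclic
  vector annihilates every vector.
\<close>

lemma annihilator:
  assumes c: "cyclic n X"
  shows "\<exists>\<mu>. degree \<mu> = n \<and> lead_coeff \<mu> = 1 \<and> (\<forall>v. supp_upto n v \<longrightarrow> poly_act n X \<mu> v = (\<lambda>_. 0))"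
proof -
  have n: "n \<ge> 1" using c by (simp add: cyclic_def)
  have supp: "supp_upto n (poly_act n X (monom 1 n) (unit_fun 0))" using n by simp
  obtain g where g: "degree g < n" "poly_act n X g (unit_fun 0) = poly_act n X (monom 1 n) (unit_fun 0)"
    using cyclic_surj[OF c supp] by blast
  define \<mu> where "\<mu> = monom 1 n - g"
  have cn: "coeff \<mu> n = 1" using g by (simp add: \<mu>_def coeff_eq_0)
  have "degree \<mu> \<le> n" using g by (intro degree_le) (auto simp: \<mu>_def coeff_eq_0)
  with cn have deg: "degree \<mu> = n" by (intro antisym le_degree) auto
  have e: "poly_act n X \<mu> (unit_fun 0) = (\<lambda>_. 0)" by (simp add: \<mu>_def poly_act_diff g)
  have "poly_act n X \<mu> v = (\<lambda>_. 0)" if v: "supp_upto n v" for v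
  proof -
    obtain f where f: "poly_act n X f (unit_fun 0) = v" using cyclic_surj[OF c v] by blast
    have "poly_act n X \<mu> v = poly_act n X (f * \<mu>) (unit_fun 0)"
      by (simp only: f[symmetric] poly_act_mult[symmetric] mult.commute)
    then show ?thesis by (simp add: poly_act_mult e)
  qed
  then show ?thesis using deg cn by auto
qed

definition real_quadratic :: "real \<Rightarrow> real \<Rightarrow> real poly" where
  "real_quadratic \<alpha> \<beta> = [:\<alpha>\<^sup>2 + \<beta>\<^sup>2, - 2 * \<alpha>, 1:]"

lemma real_quadratic_eq: "real_quadratic \<alpha> \<beta> = [:- \<alpha>, 1:] * [:- \<alpha>, 1:] + [:\<beta>\<^sup>2:]"
  by (simp add: real_quadratic_def power2_eq_square)

text \<open>
  The remainder of \<open>f\<close> modulo the quadratic has degree at most 1 and the non-real root \<open>z\<close>.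
\<close>

lemma real_quadratic_dvd:
  fixes f :: "real poly"
  assumes z: "poly (map_poly complex_of_real f) z = 0" and im: "Im z \<noteq> 0"
  shows "real_quadratic (Re z) (Im z) dvd f"
proof -
  interpret h: map_poly_comm_ring_hom "of_real :: real \<Rightarrow> complex" ..
  define q where "q = real_quadratic (Re z) (Im z)"
  have dq: "degree q = 2" by (simp add: q_def real_quadratic_def)
  define r where "r = f mod q"
  have qz: "poly (map_poly complex_of_real q) z = 0"
    by (simp add: q_def real_quadratic_def complex_eq_iff power2_eq_square algebra_simps)
  have "f = q * (f div q) + r" by (simp add: r_def)
  then have "poly (map_poly complex_of_real f) z =
      poly (map_poly complex_of_real q) z * poly (map_poly complex_of_real (f div q)) z
      + poly (map_poly complex_of_real r) z"
    by (metis h.hom_add h.hom_mult poly_add poly_mult)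
  with z qz have rz: "poly (map_poly complex_of_real r) z = 0" by simp
  have "degree r < 2 \<or> r = 0" using degree_mod_less[of q f] dq by (cases "q = 0") (auto simp: r_def)
  then have "degree r \<le> 1" by auto
  then have r: "r = [:coeff r 0, coeff r 1:]"
    by (intro poly_eqI) (auto simp: coeff_pCons coeff_eq_0 split: nat.split)
  have "poly (map_poly complex_of_real [:coeff r 0, coeff r 1:]) z = 0" using rz r by simp
  moreover have mp: "map_poly complex_of_real [:a, b:] = [:complex_of_real a, complex_of_real b:]" for a b
    by (rule poly_eqI) (simp add: coeff_map_poly coeff_pCons split: nat.split)
  ultimately have "complex_of_real (coeff r 0) + z * complex_of_real (coeff r 1) = 0"
    by (simp add: mp)
  then have "coeff r 1 = 0 \<and> coeff r 0 = 0" using im by (auto simp: complex_eq_iff)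
  then have "r = 0" using r by simp
  then show ?thesis by (simp add: r_def q_def[symmetric] mod_eq_0_iff_dvd)
qed

definition linear_prod :: "real set \<Rightarrow> real poly" where
  "linear_prod R = (\<Prod>r\<in>R. [:- r, 1:])"

text \<open>
  Excluding the factors \<open>(x - \<alpha>)\<^sup>2 + \<beta>\<^sup>2\<close> excludes non-real roots for \<open>\<beta> \<noteq> 0\<close> and multiple real roots for
  \<open>\<beta> = 0\<close>.
\<close>

lemma real_rooted_split:
  fixes f :: "real poly"
  assumes "lead_coeff f = 1" and "\<And>\<alpha> \<beta>. \<not> real_quadratic \<alpha> \<beta> dvd f"
  shows "\<exists>R. finite R \<and> f = linear_prod R"
  using assms
proof (induction "degree f" arbitrary: f)
  case 0
  then have "f = 1" by (metis degree_0_id one_poly_def lead_coeff_pCons(2) monic_degree_0)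
  then show ?case by (intro exI[of _ "{}"]) (simp add: linear_prod_def)
next
  case (Suc m)
  have "degree (map_poly complex_of_real f) \<noteq> 0" using Suc(2) by simp
  then have "\<not> constant (poly (map_poly complex_of_real f))"
    by (simp add: constant_degree)
  then obtain z where z: "poly (map_poly complex_of_real f) z = 0"
    using fundamental_theorem_of_algebra by blast
  have "Im z = 0" using real_quadratic_dvd[OF z] Suc(4) by blast
  then obtain r where "z = complex_of_real r" by (metis complex_is_Real_iff Reals_cases)
  then have "poly f r = 0" using z by simp
  then obtain h where h: "f = [:- r, 1:] * h" by (auto simp: poly_eq_0_iff_dvd dvd_def)
  have h0: "h \<noteq> 0" using h Suc(3) by auto
  have "degree f = 1 + degree h" unfolding h using h0 by (subst degree_mult_eq) auto
  moreover have "lead_coeff h = 1" using Suc(3) unfolding h by (simp only: lead_coeff_mult) simp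
  moreover have "\<not> real_quadratic \<alpha> \<beta> dvd h" for \<alpha> \<beta> using Suc(4) h dvd_mult by blast
  ultimately obtain R where R: "finite R" "h = linear_prod R" using Suc(1)[of h] Suc(2) by auto
  have "r \<notin> R"
  proof
    assume "r \<in> R"
    then have "[:- r, 1:] dvd h" unfolding R linear_prod_def using R(1) by (intro dvd_prodI)
    then have "[:- r, 1:] * [:- r, 1:] dvd f" unfolding h by (rule mult_dvd_mono[OF dvd_refl])
    then have "real_quadratic r 0 dvd f" by (simp add: real_quadratic_eq)
    then show False using Suc(4) by blast
  qed
  then have "f = linear_prod (insert r R)" using R h by (simp add: linear_prod_def)
  then show ?case using R by blast
qed

lemma linear_prod_dvd:
  assumes "finite R" "\<And>r. r \<in> R \<Longrightarrow> poly f r = 0"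
  shows "linear_prod R dvd f"
  using assms
proof (induction R arbitrary: f rule: finite_induct)
  case (insert r R)
  then obtain h where h: "f = [:- r, 1:] * h" by (auto simp: poly_eq_0_iff_dvd dvd_def)
  have "poly h s = 0" if "s \<in> R" for s
    using insert.prems[of s] insert.hyps that unfolding h by auto
  then have "linear_prod R dvd h" by (rule insert.IH)
  then show ?case using insert.hyps unfolding h by (simp add: linear_prod_def mult_dvd_mono del: mult_pCons_left)
qed (simp add: linear_prod_def)

text \<open>
  Reduction modulo the annihilator \<open>\<mu>\<close> replaces \<open>f\<close> by a polynomial of degree
  below \<open>n\<close>, and for its square the Hankel form decides.
\<close>

lemma square_ge_0_all:
  assumes "cyclic n X" "hankel_pd n (moment n X w v)" "supp_upto n v"
  shows "functional n X w v (f * f) \<ge> 0"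
proof -
  obtain \<mu> where \<mu>: "degree \<mu> = n" "lead_coeff \<mu> = 1" "poly_act n X \<mu> v = (\<lambda>_. 0)"
    using annihilator[OF assms(1)] assms(3) by blast
  define r where "r = f mod \<mu>"
  have n: "n \<ge> 1" using assms(1) by (simp add: cyclic_def)
  have "f * f = (f - r) * (f + r) + r * r" by (simp add: algebra_simps)
  moreover have "f - r = (f div \<mu>) * \<mu>" by (simp add: r_def minus_mod_eq_div_mult)
  ultimately have "f * f = ((f div \<mu>) * (f + r)) * \<mu> + r * r" by (simp only: mult_ac)
  then have "functional n X w v (f * f) = functional n X w v (r * r)"
    by (simp add: functional_add functional_mult_null[OF \<mu>(3)])
  moreover have "degree r < n" using degree_mod_less[of \<mu> f] \<mu>(1,2) n by (cases "r = 0"; cases "\<mu> = 0") (auto simp: r_def)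
  ultimately show ?thesis using square_ge_0[OF assms(2)] by simp
qed

text \<open>
  If \<open>\<mu> = ((x - \<alpha>)\<^sup>2 + \<beta>\<^sup>2) h\<close>, then the functional of \<open>e\<^sub>0\<close> vanishes at \<open>\<mu> h\<close>, although it is positive at the
  square of \<open>(x - \<alpha>) h\<close> and nonnegative at that of \<open>\<beta> h\<close>; so \<open>\<mu>\<close> is a product of distinct real linear
  factors, and \<open>R\<close> is the set of its roots.  The clause on \<open>\<alpha>\<close>, \<open>\<beta>\<close>, \<open>x\<close> and \<open>y\<close> speaks about the complex
  eigenvector \<open>x + i y\<close> for the eigenvalue \<open>\<alpha> + i \<beta>\<close> and thus says that all complex eigenvalues lie in
  \<open>R\<close>.  The weight of the node \<open>r\<close> is the value at the Lagrange polynomial of \<open>r\<close>, which coincides with its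
  square on \<open>R\<close>; hence it is nonnegative.
\<close>

lemma gauss_quadrature:
  assumes c: "cyclic n X"
  shows "\<exists>R. finite R \<and>
    (\<forall>r\<in>R. \<exists>v. supp_upto n v \<and> v \<noteq> (\<lambda>_. 0) \<and> mat_vec n X v = (\<lambda>i. r * v i)) \<and>
    (\<forall>\<alpha> \<beta> x y. supp_upto n x \<and> supp_upto n y \<and> (x \<noteq> (\<lambda>_. 0) \<or> y \<noteq> (\<lambda>_. 0)) \<and>
       mat_vec n X x = (\<lambda>i. \<alpha> * x i - \<beta> * y i) \<and> mat_vec n X y = (\<lambda>i. \<beta> * x i + \<alpha> * y i)
       \<longrightarrow> \<beta> = 0 \<and> \<alpha> \<in> R) \<and>
    (\<forall>w v. supp_upto n v \<and> hankel_pd n (moment n X w v) \<longrightarrow>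
       (\<exists>W. (\<forall>r. W r \<ge> 0) \<and> (\<forall>f. functional n X w v f = (\<Sum>r\<in>R. W r * poly f r))))"
proof -
  let ?e = "unit_fun 0"
  have n: "n \<ge> 1" and pd: "hankel_pd n (moment n X ?e ?e)" using c by (auto simp: cyclic_def)
  have supp_e: "supp_upto n ?e" using n by simp
  obtain \<mu> where \<mu>: "degree \<mu> = n" "lead_coeff \<mu> = 1"
    "\<And>v. supp_upto n v \<Longrightarrow> poly_act n X \<mu> v = (\<lambda>_. 0)"
    using annihilator[OF c] by blast
  have quad: "functional n X w v (real_quadratic \<alpha> \<beta> * (h * h)) =
     functional n X w v (([:- \<alpha>, 1:] * h) * ([:- \<alpha>, 1:] * h)) + \<beta>\<^sup>2 * functional n X w v (h * h)"
    for w v \<alpha> \<beta> h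
  proof -
    have "real_quadratic \<alpha> \<beta> * (h * h) =
        ([:- \<alpha>, 1:] * h) * ([:- \<alpha>, 1:] * h) + Polynomial.smult (\<beta>\<^sup>2) (h * h)"
      unfolding real_quadratic_eq by (simp add: algebra_simps del: mult_pCons_left mult_pCons_right)
         (simp add: algebra_simps)
    then show ?thesis by (simp only: functional_add functional_smult)
  qed
  have "\<not> real_quadratic \<alpha> \<beta> dvd \<mu>" for \<alpha> \<beta>
  proof
    assume "real_quadratic \<alpha> \<beta> dvd \<mu>"
    then obtain h where h: "\<mu> = real_quadratic \<alpha> \<beta> * h" by (auto simp: dvd_def)
    have h0: "h \<noteq> 0" using \<mu>(2) h by auto
    have dh: "n = 2 + degree h" unfolding \<mu>(1)[symmetric] h
      using h0 by (subst degree_mult_eq) (auto simp: real_quadratic_def)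
    have "functional n X ?e ?e (h * \<mu>) = 0"
      by (rule functional_mult_null) (rule \<mu>(3)[OF supp_e])
    then have "functional n X ?e ?e (real_quadratic \<alpha> \<beta> * (h * h)) = 0" by (simp add: h mult_ac)
    moreover have "functional n X ?e ?e (([:- \<alpha>, 1:] * h) * ([:- \<alpha>, 1:] * h)) > 0"
    proof (rule square_gt_0[OF pd])
      show "degree ([:- \<alpha>, 1:] * h) < n" using h0 dh by (subst degree_mult_eq) auto
      show "[:- \<alpha>, 1:] * h \<noteq> 0" using h0 by (simp del: mult_pCons_left)
    qed
    moreover have "\<beta>\<^sup>2 * functional n X ?e ?e (h * h) \<ge> 0" using square_ge_0[OF pd, of h] dh by simp
    ultimately show False using quad[of ?e ?e \<alpha> \<beta> h] by argo
  qed
  then obtain R where R: "finite R" "\<mu> = linear_prod R" using real_rooted_split[OF \<mu>(2)] by blast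
  have root: "poly \<mu> r = 0 \<longleftrightarrow> r \<in> R" for r
    using R(1) by (auto simp: R(2) linear_prod_def poly_prod)
  have eig: "\<exists>v. supp_upto n v \<and> v \<noteq> (\<lambda>_. 0) \<and> mat_vec n X v = (\<lambda>i. r * v i)" if "r \<in> R" for r
  proof -
    have "[:- r, 1:] dvd \<mu>" using root[of r] that by (simp add: poly_eq_0_iff_dvd)
    then obtain h where h: "\<mu> = [:- r, 1:] * h" by (rule dvdE)
    have h0: "h \<noteq> 0" using \<mu>(2) h by auto
    have dh: "degree h < n" unfolding \<mu>(1)[symmetric] h using h0 by (subst degree_mult_eq) auto
    let ?v = "poly_act n X h ?e"
    have "(\<lambda>_. 0) = poly_act n X [:- r, 1:] ?v" using \<mu>(3)[OF supp_e] unfolding h poly_act_mult by simp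
    then have "mat_vec n X ?v = (\<lambda>i. r * ?v i)" by (simp add: fun_eq_iff)
    moreover have "?v \<noteq> (\<lambda>_. 0)" using cyclic_inj[OF c dh] h0 by blast
    ultimately show ?thesis using supp_e by (intro exI[of _ ?v]) simp
  qed
  have ceig: "\<beta> = 0 \<and> \<alpha> \<in> R"
    if xy: "supp_upto n x" "supp_upto n y" "x \<noteq> (\<lambda>_. 0) \<or> y \<noteq> (\<lambda>_. 0)"
      and Xx: "mat_vec n X x = (\<lambda>i. \<alpha> * x i - \<beta> * y i)" and Xy: "mat_vec n X y = (\<lambda>i. \<beta> * x i + \<alpha> * y i)"
    for \<alpha> \<beta> x y
  proof -
    \<comment> \<open>The real and the imaginary part of the eigenvector are both annihilated by the real quadratic.\<close>
    obtain u where u: "u \<noteq> (\<lambda>_. 0)" "u = x \<or> u = y" using xy by blast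
    have su: "supp_upto n u" using u xy by auto
    have XXx: "mat_vec n X (mat_vec n X x) = (\<lambda>i. \<alpha> * mat_vec n X x i - \<beta> * mat_vec n X y i)"
      using mat_vec_lin[of n X \<alpha> x "-\<beta>" y] by (simp add: Xx)
    have XXy: "mat_vec n X (mat_vec n X y) = (\<lambda>i. \<beta> * mat_vec n X x i + \<alpha> * mat_vec n X y i)"
      using mat_vec_lin[of n X \<beta> x "\<alpha>" y] by (simp add: Xy)
    have "poly_act n X (real_quadratic \<alpha> \<beta>) x = (\<lambda>_. 0)"
      by (simp add: real_quadratic_def XXx fun_eq_iff) (simp add: Xx Xy power2_eq_square algebra_simps)
    moreover have "poly_act n X (real_quadratic \<alpha> \<beta>) y = (\<lambda>_. 0)"
      by (simp add: real_quadratic_def XXy fun_eq_iff) (simp add: Xx Xy power2_eq_square algebra_simps)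
    ultimately have "poly_act n X (real_quadratic \<alpha> \<beta>) u = (\<lambda>_. 0)" using u(2) by blast
    moreover obtain g where g: "degree g < n" "poly_act n X g ?e = u" using cyclic_surj[OF c su] by blast
    ultimately have "poly_act n X (real_quadratic \<alpha> \<beta> * g) ?e = (\<lambda>_. 0)" by (simp add: poly_act_mult)
    from functional_mult_null[OF this, of ?e g]
    have "functional n X ?e ?e (real_quadratic \<alpha> \<beta> * (g * g)) = 0" by (simp add: mult_ac)
    moreover have "functional n X ?e ?e (g * g) > 0"
      using square_gt_0[OF pd g(1)] g(2) u(1) poly_act_0[of n X ?e] by metis
    moreover have "functional n X ?e ?e (([:- \<alpha>, 1:] * g) * ([:- \<alpha>, 1:] * g)) \<ge> 0"
      by (rule square_ge_0_all[OF c pd supp_e])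
    ultimately have "\<beta>\<^sup>2 * functional n X ?e ?e (g * g) \<le> 0" using quad[of ?e ?e \<alpha> \<beta> g] by simp
    with \<open>functional n X ?e ?e (g * g) > 0\<close> have b0: "\<beta> = 0"
      by (metis mult_le_0_iff not_less power2_less_eq_zero_iff zero_le_power2)
    have Xu: "mat_vec n X u = (\<lambda>i. \<alpha> * u i)" using u(2) Xx Xy b0 by auto
    have "poly_act n X f u = (\<lambda>i. poly f \<alpha> * u i)" for f
    proof (induction f)
      case (pCons a f)
      have "poly_act n X f (mat_vec n X u) = (\<lambda>i. \<alpha> * poly_act n X f u i)"
        using poly_act_vec_lin[of n X f \<alpha> u 0 u] by (simp add: Xu)
      then show ?case by (simp add: pCons algebra_simps)
    qed simp
    then have "poly \<mu> \<alpha> = 0" using \<mu>(3)[OF su] u(1) by (metis mult_eq_0_iff)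
    then show ?thesis using b0 root by blast
  qed
  have weights: "\<exists>W. (\<forall>r. W r \<ge> 0) \<and> (\<forall>f. functional n X w v f = (\<Sum>r\<in>R. W r * poly f r))"
    if v: "supp_upto n v" and psd: "hankel_pd n (moment n X w v)" for w v
  proof -
    have null: "functional n X w v f = functional n X w v g" if "\<And>r. r \<in> R \<Longrightarrow> poly f r = poly g r" for f g
    proof -
      have "\<mu> dvd f - g" unfolding R(2) using that by (intro linear_prod_dvd R) auto
      then obtain h where "f - g = h * \<mu>" by (metis dvd_def mult.commute)
      then have "f = h * \<mu> + g" by (metis diff_eq_eq)
      then show ?thesis by (simp add: functional_add functional_mult_null[OF \<mu>(3)[OF v]])
    qed
    define \<phi> where "\<phi> r = Polynomial.smult (1 / (\<Prod>s\<in>R - {r}. r - s)) (linear_prod (R - {r}))" for r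
    have \<phi>: "poly (\<phi> r) s = (if s = r then 1 else 0)" if "s \<in> R" for r s
    proof (cases "s = r")
      case True
      have "(\<Prod>s\<in>R - {r}. r - s) \<noteq> 0" using R(1) by (subst prod_zero_iff) auto
      then show ?thesis using True by (simp add: \<phi>_def linear_prod_def poly_prod)
    next
      case False
      then show ?thesis using R(1) that by (auto simp: \<phi>_def linear_prod_def poly_prod prod_zero_iff)
    qed
    have "functional n X w v (\<phi> r) = functional n X w v (\<phi> r * \<phi> r)" for r
      by (rule null) (simp add: \<phi>)
    then have "functional n X w v (\<phi> r) \<ge> 0" for r using square_ge_0_all[OF c psd v] by simp
    moreover have "functional n X w v f = (\<Sum>r\<in>R. functional n X w v (\<phi> r) * poly f r)" for f
    proof -
      have "functional n X w v f = functional n X w v (\<Sum>r\<in>R. Polynomial.smult (poly f r) (\<phi> r))"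
      proof (rule null)
        fix s assume s: "s \<in> R"
        have "poly (\<Sum>r\<in>R. Polynomial.smult (poly f r) (\<phi> r)) s = (\<Sum>r\<in>R. if r = s then poly f r else 0)"
          unfolding poly_sum by (intro sum.cong refl) (simp add: \<phi>[OF s])
        then show "poly f s = poly (\<Sum>r\<in>R. Polynomial.smult (poly f r) (\<phi> r)) s" using s R(1) by simp
      qed
      then show ?thesis using R(1) by (simp add: functional_sum functional_smult mult.commute)
    qed
    ultimately show ?thesis
      by (intro exI[of _ "\<lambda>r. functional n X w v (\<phi> r)"] conjI allI)
  qed
  show ?thesis
  proof (intro exI[of _ R] conjI ballI allI impI)
    show "finite R" by (rule R(1))
  next
    fix r assume "r \<in> R"
    then show "\<exists>v. supp_upto n v \<and> v \<noteq> (\<lambda>_. 0) \<and> mat_vec n X v = (\<lambda>i. r * v i)" by (rule eig)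
  next
    fix \<alpha> \<beta> x y
    assume xy: "supp_upto n x \<and> supp_upto n y \<and> (x \<noteq> (\<lambda>_. 0) \<or> y \<noteq> (\<lambda>_. 0)) \<and>
       mat_vec n X x = (\<lambda>i. \<alpha> * x i - \<beta> * y i) \<and> mat_vec n X y = (\<lambda>i. \<beta> * x i + \<alpha> * y i)"
    have "\<beta> = 0 \<and> \<alpha> \<in> R" by (rule ceig[of x y]) (use xy in auto)
    then show "\<beta> = 0" "\<alpha> \<in> R" by auto
  next
    fix w v assume "supp_upto n v \<and> hankel_pd n (moment n X w v)"
    then show "\<exists>W. (\<forall>r. W r \<ge> 0) \<and> (\<forall>f. functional n X w v f = (\<Sum>r\<in>R. W r * poly f r))"
      by (intro weights) auto
  qed
qed

section \<open>Weak limits of quadrature formulas\<close>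

text \<open>
  The distribution function of a probability measure is right continuous, so passing to right limits
  does not change it and the measure is recovered from it, up to the factor \<open>c\<close>.
\<close>

lemma lebesgue_stieltjes_cdf:
  assumes M: "real_distribution M" and c: "c \<ge> 0"
  shows "lebesgue_stieltjes (\<lambda>x. c * cdf M x) = density M (\<lambda>_. ennreal c)"
proof -
  interpret M: real_distribution M by (rule M)
  let ?F = "\<lambda>x. c * cdf M x" and ?N = "density M (\<lambda>_. ennreal c)"
  have rc: "continuous (at_right x) ?F" for x
    by (intro continuous_mult continuous_const M.cdf_is_right_cont)
  then have "Lim (at_right x) ?F = ?F x" for x
    by (intro tendsto_Lim) (auto simp: continuous_within)
  then have LS: "lebesgue_stieltjes ?F = interval_measure ?F"
    by (simp add: lebesgue_stieltjes_def)
  have mono: "?F x \<le> ?F y" if "x \<le> y" for x y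
    using M.cdf_nondecreasing[OF that] c by (rule mult_left_mono)
  have bot: "(?F \<longlongrightarrow> 0) at_bot"
    using tendsto_mult[OF tendsto_const M.cdf_lim_at_bot, of c] by simp
  have top: "(?F \<longlongrightarrow> c) at_top"
    using tendsto_mult[OF tendsto_const M.cdf_lim_at_top_prob, of c] by simp
  have em: "emeasure ?N A = ennreal c * emeasure M A" if "A \<in> sets borel" for A
    using that by (simp add: emeasure_density_const)
  have "finite_measure ?N"
    using em[of UNIV] M.emeasure_space_1
    by (intro finite_measureI) (simp add: ennreal_mult_eq_top_iff)
  then have "finite_borel_measure ?N"
    by (simp add: finite_borel_measure_def finite_borel_measure_axioms_def)
  moreover have "finite_borel_measure (interval_measure ?F)"
    by (rule finite_borel_measure_interval_measure[OF mono rc bot top c])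
  moreover have "cdf (interval_measure ?F) = cdf ?N"
    using c by (simp add: cdf_interval_measure[OF mono rc bot] fun_eq_iff)
       (simp add: cdf_def measure_def em enn2real_mult)
  ultimately show ?thesis unfolding LS by (intro cdf_unique')
qed

lemma atomic_distribution:
  fixes R :: "real set"
  assumes R: "finite R" and W: "\<And>r. r \<in> R \<Longrightarrow> W r \<ge> 0" and one: "(\<Sum>r\<in>R. W r) = 1"
  shows "\<exists>M. real_distribution M \<and>
    (\<forall>g::real\<Rightarrow>real. g \<in> borel_measurable borel \<longrightarrow> integral\<^sup>L M g = (\<Sum>r\<in>R. W r * g r))"
proof -
  let ?P = "point_measure R (\<lambda>r. ennreal (W r))"
  have "emeasure ?P (space ?P) = (\<Sum>r\<in>R. ennreal (W r))"
    using R by (simp add: space_point_measure emeasure_point_measure_finite)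
  also have "\<dots> = 1" using W one by (simp add: sum_ennreal)
  finally interpret P: prob_space ?P by (rule prob_spaceI)
  have "real_distribution (distr ?P borel (\<lambda>x. x))"
    by (rule P.real_distribution_distr) simp
  moreover have "integral\<^sup>L (distr ?P borel (\<lambda>x. x)) g = (\<Sum>r\<in>R. W r * g r)"
    if "g \<in> borel_measurable borel" for g :: "real \<Rightarrow> real"
    using that R W by (subst integral_distr) (simp_all add: lebesgue_integral_point_measure_finite)
  ultimately show ?thesis by blast
qed

definition carried_limit :: "real set \<Rightarrow> (nat \<Rightarrow> real poly \<Rightarrow> real) \<Rightarrow> (real \<Rightarrow> real) \<Rightarrow> bool" where
  "carried_limit \<Delta> \<Phi> \<psi> \<longleftrightarrow> mono \<psi> \<and> (\<forall>x. \<psi> x \<ge> 0) \<and> emeasure (lebesgue_stieltjes \<psi>) (- \<Delta>) = 0 \<and>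
    (\<forall>f. (\<lambda>n. \<Phi> n f) \<longlonglongrightarrow> (LINT x:\<Delta>|lebesgue_stieltjes \<psi>. poly f x))"

text \<open>
  After division by \<open>c\<close> the formulas are probability measures on a fixed compact interval, hence
  tight.  The limit is carried by \<open>\<Delta>\<close> because the distance to \<open>\<Delta>\<close>, cut off at 1, is a bounded continuous
  function with integral 0.  A polynomial agrees on \<open>\<Delta>\<close> with the bounded continuous function obtained by
  first clamping the argument to \<open>[-C, C]\<close>, so its integrals converge.
\<close>

lemma quadrature_limit_single:
  fixes \<Delta> :: "real set" and R :: "nat \<Rightarrow> real set" and W :: "nat \<Rightarrow> real \<Rightarrow> real"
  assumes \<Delta>: "closed \<Delta>" "\<Delta> \<subseteq> {-C..C}"
    and R: "\<And>n. finite (R n)" "\<And>n. R n \<subseteq> \<Delta>"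
    and W: "\<And>n r. W n r \<ge> 0" and sumW: "\<And>n. (\<Sum>r\<in>R n. W n r) = c"
  shows "\<exists>s \<psi>. strict_mono (s :: nat \<Rightarrow> nat) \<and>
    carried_limit \<Delta> (\<lambda>n f. \<Sum>r\<in>R (s n). W (s n) r * poly f r) \<psi>"
proof -
  have c: "c \<ge> 0" using W sumW[of 0] by (metis sum_nonneg)
  \<comment> \<open>Mass \<open>c = 0\<close> forces all weights to vanish; then any distribution serves, with the factor 0.\<close>
  have "\<exists>M s. real_distribution M \<and> strict_mono (s :: nat \<Rightarrow> nat) \<and> (c > 0 \<longrightarrow> emeasure M (- \<Delta>) = 0) \<and>
      (\<forall>f. (\<lambda>n. \<Sum>r\<in>R (s n). W (s n) r * poly f r) \<longlonglongrightarrow> c * (LINT x:\<Delta>|M. poly f x))"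
  proof (cases "c = 0")
    case True
    have "W n r = 0" if "r \<in> R n" for n r
      using sumW[of n] True R(1)[of n] W that by (simp add: sum_nonneg_eq_0_iff)
    then have "(\<lambda>n. \<Sum>r\<in>R n. W n r * poly f r) \<longlonglongrightarrow> c * (LINT x:\<Delta>|M. poly f x)" for f M
      using True by simp
    moreover obtain M :: "real measure" where "real_distribution M"
      using atomic_distribution[of "{0}" "\<lambda>_. 1"] by auto
    ultimately show ?thesis using True by (intro exI[of _ M] exI[of _ "\<lambda>n. n"]) (auto simp: strict_mono_def)
  next
    case False
    with c have c: "c > 0" by simp
    have "\<exists>M. real_distribution M \<and>
      (\<forall>g::real\<Rightarrow>real. g \<in> borel_measurable borel \<longrightarrow> integral\<^sup>L M g = (\<Sum>r\<in>R n. W n r / c * g r))" for n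
      using R W c sumW[of n] by (intro atomic_distribution) (auto simp: sum_divide_distrib[symmetric])
    then obtain \<mu> where \<mu>: "\<And>n. real_distribution (\<mu> n)"
      and int: "\<And>n g. g \<in> borel_measurable borel \<Longrightarrow> integral\<^sup>L (\<mu> n) (g :: real \<Rightarrow> real) = (\<Sum>r\<in>R n. W n r / c * g r)"
      by metis
    have "measure (\<mu> n) {-C-1<..C} = 1" for n
    proof -
      interpret real_distribution "\<mu> n" by (rule \<mu>)
      have "measure (\<mu> n) {-C-1<..C} = integral\<^sup>L (\<mu> n) (indicator {-C-1<..C})" by simp
      also have "\<dots> = (\<Sum>r\<in>R n. W n r / c * indicator {-C-1<..C} r)" by (rule int) simp
      also have "\<dots> = (\<Sum>r\<in>R n. W n r / c)"
      proof (intro sum.cong refl)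
        fix r assume "r \<in> R n"
        then have "r \<in> {-C..C}" using R \<Delta> by blast
        then show "W n r / c * indicator {-C-1<..C} r = W n r / c" by (simp add: indicator_def)
      qed
      finally show ?thesis using sumW[of n] c by (simp add: sum_divide_distrib[symmetric])
    qed
    moreover have "-C-1 < C"
    proof -
      have "R 0 \<noteq> {}" using sumW[of 0] c by auto
      then show ?thesis using R(2)[of 0] \<Delta>(2) by force
    qed
    ultimately have "tight \<mu>" using \<mu> unfolding tight_def by (intro conjI allI impI exI[of _ "-C-1"] exI[of _ C]) auto
    then obtain s M where s: "strict_mono (s :: nat \<Rightarrow> nat)" and M: "real_distribution M"
      and conv: "weak_conv_m (\<mu> \<circ> s) M"
      using tight_imp_convergent_subsubsequence[of \<mu> "\<lambda>n. n"] by (auto simp: strict_mono_def comp_def)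
    interpret M: real_distribution M by (rule M)
    have lim: "(\<lambda>n. \<Sum>r\<in>R (s n). W (s n) r / c * g r) \<longlonglongrightarrow> integral\<^sup>L M g"
      if g: "continuous_on UNIV g" "\<And>x. \<bar>g x\<bar> \<le> B" for g :: "real \<Rightarrow> real" and B
    proof -
      have "(\<lambda>n. integral\<^sup>L ((\<mu> \<circ> s) n) g) \<longlonglongrightarrow> integral\<^sup>L M g"
        using g by (intro weak_conv_imp_integral_bdd_continuous_conv[OF _ M conv, where B = B])
          (auto simp: \<mu> continuous_on_eq_continuous_at)
      moreover have "g \<in> borel_measurable borel" using g(1) by (rule borel_measurable_continuous_onI)
      ultimately show ?thesis by (simp add: int)
    qed
    have ne: "\<Delta> \<noteq> {}" using sumW[of 0] c R(2)[of 0] by auto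
    let ?d = "\<lambda>x. min 1 (infdist x \<Delta>)"
    have d_cont: "continuous_on UNIV ?d" by (intro continuous_intros)
    have "(\<lambda>n. \<Sum>r\<in>R (s n). W (s n) r / c * ?d r) \<longlonglongrightarrow> integral\<^sup>L M ?d"
      by (rule lim[OF d_cont, of 1]) (auto simp: min_def infdist_nonneg)
    moreover have "(\<Sum>r\<in>R n. W n r / c * ?d r) = 0" for n
      using R(2)[of n] by (intro sum.neutral) (auto simp: infdist_zero)
    ultimately have "(\<lambda>n::nat. 0) \<longlonglongrightarrow> integral\<^sup>L M ?d" by simp
    then have "integral\<^sup>L M ?d = 0" by (simp add: LIMSEQ_const_iff)
    moreover have "integrable M ?d"
      using d_cont by (intro M.integrable_const_bound[where B = 1])
        (auto simp: infdist_nonneg borel_measurable_continuous_onI)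
    ultimately have "AE x in M. ?d x = 0"
      by (subst (asm) integral_nonneg_eq_0_iff_AE) (auto simp: infdist_nonneg)
    then have AE: "AE x in M. x \<in> \<Delta>"
    proof (rule AE_mp, intro AE_I2 impI)
      fix x assume "?d x = 0"
      then have "infdist x \<Delta> = 0" by (auto simp: min_def split: if_splits)
      then show "x \<in> \<Delta>" using in_closed_iff_infdist_zero[OF \<Delta>(1) ne] by blast
    qed
    have \<Delta>b [measurable]: "\<Delta> \<in> sets borel" using \<Delta>(1) by simp
    have "emeasure M (- \<Delta>) = 0"
      using AE by (subst (asm) AE_iff_null) (auto simp: null_sets_def Compl_eq)
    moreover have "(\<lambda>n. \<Sum>r\<in>R (s n). W (s n) r * poly f r) \<longlonglongrightarrow> c * (LINT x:\<Delta>|M. poly f x)" for f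
    proof -
      define g where "g x = poly f (max (- C) (min C x))" for x
      have gf: "g x = poly f x" if "x \<in> \<Delta>" for x using that \<Delta>(2) by (auto simp: g_def)
      have gc: "continuous_on UNIV g" unfolding g_def by (intro continuous_intros)
      have "compact (poly f ` {- \<bar>C\<bar>..\<bar>C\<bar>})"
        by (intro compact_continuous_image continuous_intros) auto
      then obtain B where B: "\<forall>y\<in>poly f ` {- \<bar>C\<bar>..\<bar>C\<bar>}. norm y \<le> B"
        using compact_imp_bounded bounded_iff by metis
      have "(\<lambda>n. \<Sum>r\<in>R (s n). W (s n) r / c * g r) \<longlonglongrightarrow> integral\<^sup>L M g"
      proof (rule lim[OF gc])
        fix x
        have "max (- C) (min C x) \<in> {- \<bar>C\<bar>..\<bar>C\<bar>}" by (auto simp: max_def min_def)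
        then show "\<bar>g x\<bar> \<le> B" using B by (auto simp: g_def)
      qed
      moreover have "integral\<^sup>L M g = (LINT x:\<Delta>|M. poly f x)"
        unfolding set_lebesgue_integral_def
      proof (rule integral_cong_AE)
        show "g \<in> borel_measurable M" using gc borel_measurable_continuous_onI M.measurable_finite_borel by blast
        show "AE x in M. g x = indicat_real \<Delta> x *\<^sub>R poly f x" using AE by eventually_elim (simp add: gf)
        have [measurable]: "poly f \<in> borel_measurable borel"
          by (intro borel_measurable_continuous_onI continuous_intros)
        show "(\<lambda>x. indicat_real \<Delta> x *\<^sub>R poly f x) \<in> borel_measurable M" by measurable
      qed
      ultimately have "(\<lambda>n. c * (\<Sum>r\<in>R (s n). W (s n) r / c * g r)) \<longlonglongrightarrow> c * (LINT x:\<Delta>|M. poly f x)"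
        by (intro tendsto_mult tendsto_const) simp
      moreover have "c * (\<Sum>r\<in>R n. W n r / c * g r) = (\<Sum>r\<in>R n. W n r * poly f r)" for n
        using c R(2)[of n] by (simp add: sum_distrib_left) (intro sum.cong refl, auto simp: gf)
      ultimately show ?thesis by simp
    qed
    ultimately show ?thesis using M s by blast
  qed
  then obtain M s where M: "real_distribution M" and s: "strict_mono (s :: nat \<Rightarrow> nat)"
    and em: "c > 0 \<longrightarrow> emeasure M (- \<Delta>) = 0"
    and lim: "\<And>f. (\<lambda>n. \<Sum>r\<in>R (s n). W (s n) r * poly f r) \<longlonglongrightarrow> c * (LINT x:\<Delta>|M. poly f x)"
    by blast
  interpret M: real_distribution M by (rule M)
  have \<Delta>b [measurable]: "\<Delta> \<in> sets borel" using \<Delta>(1) by simp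
  let ?\<psi> = "\<lambda>x. c * cdf M x"
  note LS = lebesgue_stieltjes_cdf[OF M c]
  have "emeasure (lebesgue_stieltjes ?\<psi>) (- \<Delta>) = 0"
    unfolding LS using em c \<Delta>b by (cases "c = 0") (auto simp: emeasure_density_const)
  moreover have "(LINT x:\<Delta>|lebesgue_stieltjes ?\<psi>. poly f x) = c * (LINT x:\<Delta>|M. poly f x)" for f
  proof -
    have [measurable]: "poly f \<in> borel_measurable borel"
      by (intro borel_measurable_continuous_onI continuous_intros)
    show ?thesis unfolding LS set_lebesgue_integral_def using c
      by (subst integral_density) auto
  qed
  moreover have "mono ?\<psi>" using c by (intro monoI mult_left_mono M.cdf_nondecreasing)
  moreover have "?\<psi> x \<ge> 0" for x using c M.cdf_nonneg by simp
  ultimately have "carried_limit \<Delta> (\<lambda>n f. \<Sum>r\<in>R (s n). W (s n) r * poly f r) ?\<psi>"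
    using lim by (simp add: carried_limit_def)
  then show ?thesis using s by blast
qed

lemma carried_limit_subseq:
  assumes "carried_limit \<Delta> \<Phi> \<psi>" "strict_mono s"
  shows "carried_limit \<Delta> (\<lambda>n. \<Phi> (s n)) \<psi>"
  using assms LIMSEQ_subseq_LIMSEQ[of "\<lambda>n. \<Phi> n f" _ s for f]
  by (auto simp: carried_limit_def comp_def)

text \<open>
  A common subsequence for finitely many sequences of quadrature formulas arises by extracting
  subsequences one after the other.
\<close>

lemma quadrature_limit:
  fixes \<Delta> :: "real set" and R :: "nat \<Rightarrow> real set" and W :: "'i \<Rightarrow> nat \<Rightarrow> real \<Rightarrow> real"
  assumes \<Delta>: "closed \<Delta>" "\<Delta> \<subseteq> {-C..C}" and I: "finite I"
    and R: "\<And>n. finite (R n)" "\<And>n. R n \<subseteq> \<Delta>"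
    and W: "\<And>i n r. i \<in> I \<Longrightarrow> W i n r \<ge> 0" and sumW: "\<And>i n. i \<in> I \<Longrightarrow> (\<Sum>r\<in>R n. W i n r) = c i"
  shows "\<exists>s \<psi>. strict_mono (s :: nat \<Rightarrow> nat) \<and>
    (\<forall>i\<in>I. carried_limit \<Delta> (\<lambda>n f. \<Sum>r\<in>R (s n). W i (s n) r * poly f r) (\<psi> i))"
  using I W sumW
proof (induction I rule: finite_induct)
  case empty
  show ?case by (intro exI[of _ "\<lambda>n. n"]) (auto simp: strict_mono_def)
next
  case (insert j I)
  then obtain s \<psi> where s: "strict_mono (s :: nat \<Rightarrow> nat)"
    "\<forall>i\<in>I. carried_limit \<Delta> (\<lambda>n f. \<Sum>r\<in>R (s n). W i (s n) r * poly f r) (\<psi> i)"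
    by auto
  obtain t \<psi>' where t: "strict_mono (t :: nat \<Rightarrow> nat)"
    "carried_limit \<Delta> (\<lambda>n f. \<Sum>r\<in>R (s (t n)). W j (s (t n)) r * poly f r) \<psi>'"
    using quadrature_limit_single[OF \<Delta>, of "\<lambda>n. R (s n)" "\<lambda>n. W j (s n)" "c j"] R insert.prems by auto
  have "\<forall>i\<in>insert j I. carried_limit \<Delta> (\<lambda>n f. \<Sum>r\<in>R (s (t n)). W i (s (t n)) r * poly f r) ((\<psi>(j := \<psi>')) i)"
    using t(2) s(2) carried_limit_subseq[OF _ t(1)] insert.hyps by auto
  moreover have "strict_mono (\<lambda>n. s (t n))" using s(1) t(1) by (simp add: strict_mono_def)
  ultimately show ?case by blast
qed

section \<open>Hankel matrices of a positive bidiagonal factorization\<close>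

lemma semi_prod_Nil [simp]: "semi_prod [] = semi_id"
  and semi_prod_Cons [simp]: "semi_prod (X # Xs) = X \<odot> semi_prod Xs"
  by (simp_all add: semi_prod_def)

lemma row_col_finite_semi_prod [simp]:
  "row_col_finite (semi_prod (map (\<lambda>k. lower_bidiagonal (l k)) ks))"
  "row_col_finite (semi_prod (map (\<lambda>k. upper_bidiagonal (l k)) ks))"
  by (induction ks) auto

lemma semi_prod_append [simp]:
  "semi_prod (map (\<lambda>k. lower_bidiagonal (l k)) ks @ Ys) =
    semi_prod (map (\<lambda>k. lower_bidiagonal (l k)) ks) \<odot> semi_prod Ys"
  "semi_prod (map (\<lambda>k. upper_bidiagonal (l k)) ks @ Ys) =
    semi_prod (map (\<lambda>k. upper_bidiagonal (l k)) ks) \<odot> semi_prod Ys"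
  by (induction ks) (auto simp: semi_mult_assoc)

lemma lower_tn_semi_prod:
  "(\<And>k i. k \<in> set ks \<Longrightarrow> l k i \<ge> 0) \<Longrightarrow> lower_tn (semi_prod (map (\<lambda>k. lower_bidiagonal (l k)) ks))"
  by (induction ks) (auto intro: lower_tn.intros)

lemma upper_tn_semi_prod:
  "(\<And>k i. k \<in> set ks \<Longrightarrow> l k i \<ge> 0) \<Longrightarrow> upper_tn (semi_prod (map (\<lambda>k. upper_bidiagonal (l k)) ks))"
  by (induction ks) (auto intro: upper_tn_id upper_tn_mult upper_tn_bidiagonal)

lemma ldu_tn_triangular: "lower_tn X \<Longrightarrow> ldu_tn n X" "upper_tn X \<Longrightarrow> ldu_tn n X"
  using ldu_tn_lower[OF _ ldu_tn_basic(4), of X n] ldu_tn_semi_transpose[of n "semi_transpose X"]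
    ldu_tn_lower[OF _ ldu_tn_basic(4), of "semi_transpose X" n] by (simp_all add: upper_tn_def)

definition lower_prod :: "(nat \<Rightarrow> nat \<Rightarrow> real) \<Rightarrow> nat \<Rightarrow> semi_inf" where
  "lower_prod L a = semi_prod (map (\<lambda>k. lower_bidiagonal (L k)) [1..<a])"

definition upper_prod :: "(nat \<Rightarrow> nat \<Rightarrow> real) \<Rightarrow> nat \<Rightarrow> semi_inf" where
  "upper_prod U b = semi_prod (map (\<lambda>k. upper_bidiagonal (U k)) (rev [1..<b]))"

lemma lower_prod_1 [simp]: "lower_prod L (Suc 0) = semi_id" and upper_prod_1 [simp]: "upper_prod U (Suc 0) = semi_id"
  by (simp_all add: lower_prod_def upper_prod_def)

lemma row_col_finite_prods [simp]: "row_col_finite (lower_prod L a)" "row_col_finite (upper_prod U a)"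
  by (auto simp: lower_prod_def upper_prod_def)

lemma lower_prod_Suc: "a \<ge> 1 \<Longrightarrow> lower_prod L (Suc a) = lower_prod L a \<odot> lower_bidiagonal (L a)"
  by (auto simp: lower_prod_def semi_prod_append)

lemma upper_prod_eq_semi_transpose: "upper_prod U b = semi_transpose (lower_prod U b)"
proof (induction b)
  case (Suc b)
  show ?case
  proof (cases "b \<ge> 1")
    case True
    have "upper_prod U (Suc b) = upper_bidiagonal (U b) \<odot> upper_prod U b"
      using True by (simp add: upper_prod_def)
    then show ?thesis by (simp add: Suc lower_prod_Suc[OF True] semi_transpose_mult)
  qed (simp add: lower_prod_def upper_prod_def)
qed (simp add: lower_prod_def upper_prod_def)

lemma semi_prod_lower_band:
  "i > j + length ks \<Longrightarrow> semi_prod (map (\<lambda>k. lower_bidiagonal (l k)) ks) i j = 0"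
  by (induction ks arbitrary: i) (auto simp: semi_id_apply lower_bidiagonal_mult split: nat.split)

lemma lower_prod_band: "i \<ge> a \<Longrightarrow> a \<ge> 1 \<Longrightarrow> lower_prod L a i 0 = 0"
  unfolding lower_prod_def by (rule semi_prod_lower_band) auto

lemma pow_mult_eq_mat_vec:
  assumes "row_col_finite E"
  shows "(semi_pow (corner n M) k \<odot> E) i 0 = (mat_vec n M ^^ k) (\<lambda>i. E i 0) i"
proof (induction k arbitrary: i)
  case (Suc k)
  have "semi_pow (corner n M) (Suc k) \<odot> E = corner n M \<odot> semi_pow (corner n M) k \<odot> E"
    using assms by (simp add: semi_mult_assoc semi_pow_commute[symmetric])
  then have "(semi_pow (corner n M) (Suc k) \<odot> E) i 0 = (corner n M \<odot> semi_pow (corner n M) k \<odot> E) i 0"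
    by (rule fun_cong[OF fun_cong])
  also have "(corner n M \<odot> semi_pow (corner n M) k \<odot> E) i 0 =
      (\<Sum>j\<le>n. corner n M i j * (semi_pow (corner n M) k \<odot> E) j 0)"
    by (rule semi_mult_eq_sum) (simp add: corner_def)
  also have "\<dots> = mat_vec n M (\<lambda>j. (semi_pow (corner n M) k \<odot> E) j 0) i"
    by (auto simp: mat_vec_def corner_def lessThan_Suc_atMost[symmetric])
  finally show ?case by (simp add: Suc)
qed simp

lemma moment_eq_pow:
  assumes "row_col_finite E" "n \<ge> 1"
  shows "(corner n F \<odot> semi_pow (corner n M) k \<odot> E) 0 0 = moment n M (F 0) (\<lambda>i. E i 0) k"
proof -
  have "(corner n F \<odot> semi_pow (corner n M) k \<odot> E) 0 0 =
      (\<Sum>j\<le>n. corner n F 0 j * (semi_pow (corner n M) k \<odot> E) j 0)"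
    by (rule semi_mult_eq_sum) (simp add: corner_def)
  also have "\<dots> = (\<Sum>j<n. F 0 j * (semi_pow (corner n M) k \<odot> E) j 0)"
    using assms(2) by (simp add: corner_def lessThan_Suc_atMost[symmetric])
  finally show ?thesis by (simp add: moment_def inner_upto_def pow_mult_eq_mat_vec assms)
qed

lemma lower_triangular_prod: "j > i \<Longrightarrow> semi_prod (map (\<lambda>k. lower_bidiagonal (l k)) ks) i j = 0"
  by (induction ks arbitrary: i) (auto simp: semi_id_apply lower_bidiagonal_mult split: nat.split)

lemma upper_triangular_prod: "i > j \<Longrightarrow> semi_prod (map (\<lambda>k. upper_bidiagonal (l k)) ks) i j = 0"
  by (induction ks arbitrary: i) (auto simp: semi_id_apply upper_bidiagonal_mult split: nat.split)

text \<open>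
  Take the corners of \<open>F = U\<^sub>b\<^sub>-\<^sub>1 \<cdots> U\<^sub>1\<close> and \<open>E = L\<^sub>1 \<cdots> L\<^sub>a\<^sub>-\<^sub>1\<close> in \<open>hankel_pd_factorization\<close>: in \<open>M\<close> the factor \<open>U\<^sub>b\<close> stands
  directly to the left of \<open>F\<close> and \<open>L\<^sub>a\<close> directly to the right of \<open>E\<close>.  Truncation respects these
  factorizations, as lower triangular matrices on the left and upper triangular ones on the right
  do not mix the indices below \<open>n\<close> with the others.
\<close>

lemma pbf_hankel_pd:
  assumes pbf: "positive_bidiagonal_factorization p q M L D U"
    and n: "n \<ge> 1" and a: "a \<in> {1..p}" and b: "b \<in> {1..q}"
  shows "hankel_pd n (moment n M (upper_prod U b 0) (\<lambda>i. corner n (lower_prod L a) i 0))"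
proof -
  have pos: "\<And>k i. k \<in> {1..p} \<Longrightarrow> L k i > 0" "\<And>k i. k \<in> {1..q} \<Longrightarrow> U k i > 0" "\<And>i. D i > 0"
    and M: "M = semi_prod (map (\<lambda>k. lower_bidiagonal (L k)) [1..<Suc p] @ [semi_diag D]
           @ map (\<lambda>k. upper_bidiagonal (U k)) (rev [1..<Suc q]))"
    using pbf by (auto simp: positive_bidiagonal_factorization_def)
  define LR where "LR = semi_prod (map (\<lambda>k. lower_bidiagonal (L k)) [Suc a..<Suc p])"
  define UR where "UR = semi_prod (map (\<lambda>k. upper_bidiagonal (U k)) (rev [Suc b..<Suc q]))"
  let ?\<L> = "lower_prod L a" and ?\<U> = "upper_prod U b"
  let ?l = "lower_bidiagonal (L a)" and ?u = "upper_bidiagonal (U b)"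
  have Lsplit: "[1..<Suc p] = [1..<a] @ a # [Suc a..<Suc p]"
    using a upt_add_eq_append[of 1 a "Suc p - a"] upt_conv_Cons[of a "Suc p"] by (simp del: upt_Suc)
  have Usplit: "[1..<Suc q] = [1..<b] @ b # [Suc b..<Suc q]"
    using b upt_add_eq_append[of 1 b "Suc q - b"] upt_conv_Cons[of b "Suc q"] by (simp del: upt_Suc)
  have tn: "ldu_tn n ?\<L>" "ldu_tn n ?\<U>" "ldu_tn n LR" "ldu_tn n UR" "ldu_tn n ?l" "ldu_tn n ?u"
    "ldu_tn n (semi_diag D)"
    unfolding lower_prod_def upper_prod_def LR_def UR_def using a b
    by (intro ldu_tn_triangular(1)[OF lower_tn_semi_prod] ldu_tn_triangular(2)[OF upper_tn_semi_prod]
        ldu_tn_basic(1)[OF pivots_pos] ldu_tn_basic less_imp_le pos; force)+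
  note fin [simp] = tn(1-4)[THEN ldu_tn_row_col_finite]
  have M': "M = ?\<L> \<odot> ?l \<odot> LR \<odot> semi_diag D \<odot> UR \<odot> ?u \<odot> ?\<U>"
    unfolding M Lsplit Usplit
    by (simp add: semi_prod_append lower_prod_def upper_prod_def LR_def UR_def semi_mult_assoc del: upt_Suc)
  have low: "\<And>i j. j > i \<Longrightarrow> ?\<L> i j = 0" and up: "\<And>i j. i > j \<Longrightarrow> ?\<U> i j = 0"
    by (auto simp: lower_prod_def upper_prod_def lower_triangular_prod upper_triangular_prod)
  let ?C = "?\<L> \<odot> ?l \<odot> LR \<odot> semi_diag D \<odot> UR"
  let ?C' = "LR \<odot> semi_diag D \<odot> UR \<odot> ?u \<odot> ?\<U>"
  have "M = (?C \<odot> ?u) \<odot> ?\<U>" unfolding M' by (simp add: semi_mult_assoc)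
  then have M1: "corner n M = corner n ?C \<odot> corner n ?u \<odot> corner n ?\<U>"
  proof -
    have "corner n ((?C \<odot> ?u) \<odot> ?\<U>) = corner n (?C \<odot> ?u) \<odot> corner n ?\<U>"
      by (rule corner_mult_upper[OF _ up]) simp_all
    also have "corner n (?C \<odot> ?u) = corner n ?C \<odot> corner n ?u"
      by (rule corner_mult_upper) (simp_all add: upper_bidiagonal_apply)
    finally show ?thesis using \<open>M = (?C \<odot> ?u) \<odot> ?\<U>\<close> by (simp only: semi_mult_assoc row_col_finite_corner)
  qed
  have "M = ?\<L> \<odot> ?l \<odot> ?C'" unfolding M' by simp
  then have M2: "corner n M = corner n ?\<L> \<odot> corner n ?l \<odot> corner n ?C'"
    by (simp add: corner_mult_lower[of ?\<L>, OF _ low] corner_mult_lower[of ?l] lower_bidiagonal_apply)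
  have "hankel_pd n (\<lambda>k. (corner n ?\<U> \<odot> semi_pow (corner n M) k \<odot> corner n ?\<L>) 0 0)"
    by (rule hankel_pd_factorization[OF n _ _ _ _ _ _ M1 M2])
      (use tn pos a b in \<open>auto intro!: ldu_tn_corner ldu_tn_mult\<close>)
  then show ?thesis using n by (simp add: moment_eq_pow)
qed

section \<open>Entries of \<open>\<Lambda>\<close> and \<open>\<Upsilon>\<close>\<close>

lemma truncation_mult:
  assumes "\<And>i j k. i \<le> N \<Longrightarrow> j \<le> N \<Longrightarrow> k > N \<Longrightarrow> X i k * Y k j = 0"
  shows "truncation (X \<odot> Y) N = truncation X N * truncation Y N"
proof (rule eq_matI)
  fix i j assume "i < dim_row (truncation X N * truncation Y N)" "j < dim_col (truncation X N * truncation Y N)"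
  then have ij: "i \<le> N" "j \<le> N" by (simp_all add: truncation_def)
  then have "(X \<odot> Y) i j = (\<Sum>k\<le>N. X i k * Y k j)" using assms by (intro semi_mult_eq_sum) auto
  then show "truncation (X \<odot> Y) N $$ (i, j) = (truncation X N * truncation Y N) $$ (i, j)"
    using ij by (simp add: truncation_def scalar_prod_def lessThan_Suc_atMost[symmetric] lessThan_atLeast0)
qed (auto simp: truncation_def)

lemma truncation_id: "truncation semi_id N = 1\<^sub>m (Suc N)"
  by (rule eq_matI) (auto simp: truncation_def semi_id_apply)

lemma mat_list_prod_lower:
  "mat_list_prod (Suc N) (map (\<lambda>k. truncation (lower_bidiagonal (l k)) N) ks) =
     truncation (semi_prod (map (\<lambda>k. lower_bidiagonal (l k)) ks)) N"
  by (induction ks) (auto simp: mat_list_prod_def truncation_id truncation_mult lower_bidiagonal_apply)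

lemma mat_list_prod_upper:
  "mat_list_prod (Suc N) (map (\<lambda>k. truncation (upper_bidiagonal (l k)) N) ks) =
     truncation (semi_prod (map (\<lambda>k. upper_bidiagonal (l k)) ks)) N"
  by (induction ks) (auto simp: mat_list_prod_def truncation_id truncation_mult upper_triangular_prod)

text \<open>
  The factors \<open>1 / r\<^sub>k\<^sub>+\<^sub>1\<close> and \<open>1 / s\<^sub>k\<^sub>+\<^sub>1\<close> in the columns of \<open>\<Lambda>\<close> and the rows of \<open>\<Upsilon>\<close>.
\<close>

definition norm_factor :: "(nat \<Rightarrow> nat \<Rightarrow> real) \<Rightarrow> nat \<Rightarrow> real" where
  "norm_factor L k = 1 / (\<Prod>j<k. L (k - j) j)"

lemma norm_factor_nonneg:
  assumes "\<And>k i. k \<in> {1..p} \<Longrightarrow> L k i > 0" "k < p"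
  shows "norm_factor L k \<ge> 0"
  unfolding norm_factor_def using assms
  by (intro divide_nonneg_nonneg prod_nonneg) (auto simp: less_imp_le)

lemma Lambda_mat_entry:
  assumes "i < p" "k < p"
  shows "Lambda_mat p L $$ (i, k) = norm_factor L k * lower_prod L (Suc k) i 0"
proof -
  have p: "Suc (p - 1) = p" using assms by simp
  have "Lambda_mat p L $$ (i, k) = vec_index (Lambda_col p L (Suc k)) i"
    using assms by (simp add: Lambda_mat_def mat_of_cols_index del: upt_Suc)
  also have "\<dots> = norm_factor L k * lower_prod L (Suc k) i 0"
    using assms mat_list_prod_lower[of "p - 1" L "[1..<Suc k]"]
    by (simp add: Lambda_col_def norm_factor_def lower_prod_def truncation_def p del: upt_Suc)
  finally show ?thesis .
qed

lemma Upsilon_mat_entry: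
  assumes "i < q" "k < q"
  shows "Upsilon_mat q U $$ (k, i) = norm_factor U k * upper_prod U (Suc k) 0 i"
proof -
  have q: "Suc (q - 1) = q" using assms by simp
  have "Upsilon_mat q U $$ (k, i) = vec_index (Upsilon_row q U (Suc k)) i"
    using assms by (simp add: Upsilon_mat_def mat_of_rows_index del: upt_Suc)
  also have "\<dots> = norm_factor U k * upper_prod U (Suc k) 0 i"
    using assms mat_list_prod_upper[of "q - 1" U "rev [1..<Suc k]"]
    by (simp add: Upsilon_row_def norm_factor_def upper_prod_def truncation_def q del: upt_Suc)
  finally show ?thesis .
qed

section \<open>Recursion polynomials and unit vectors\<close>

lemma mat_vec_sum: "(\<Sum>a\<in>I. mat_vec n X (v a) j) = mat_vec n X (\<lambda>i. \<Sum>a\<in>I. v a i) j"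
proof -
  have "(\<Sum>a\<in>I. \<Sum>i<n. X j i * v a i) = (\<Sum>i<n. \<Sum>a\<in>I. X j i * v a i)" by (rule sum.swap)
  then show ?thesis by (simp add: mat_vec_def sum_distrib_left)
qed

lemma mat_vec_unit_fun: "k < n \<Longrightarrow> mat_vec n X (unit_fun k) j = (if j < n then X j k else 0)"
proof -
  assume "k < n"
  have "(\<Sum>i<n. X j i * unit_fun k i) = (\<Sum>i<n. if i = k then X j k else 0)"
    by (intro sum.cong refl) (simp add: unit_fun_def)
  then show ?thesis using \<open>k < n\<close> by (simp add: mat_vec_def)
qed

text \<open>
  Let \<open>E\<^sub>k\<close> be the left-hand side.  The recursion at \<open>m\<close> turns into the statement that column \<open>m\<close> of \<open>T\<close>,
  formed with the \<open>E\<^sub>i\<close> in place of the \<open>e\<^sub>i\<close>, equals \<open>T E\<^sub>m\<close>.  As \<open>E\<^sub>i = e\<^sub>i\<close> for \<open>i < m + p\<close>, including \<open>i = m\<close>, and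
  \<open>T\<^sub>m\<^sub>+\<^sub>p\<^sub>,\<^sub>m \<noteq> 0\<close>, this gives \<open>E\<^sub>m\<^sub>+\<^sub>p = e\<^sub>m\<^sub>+\<^sub>p\<close>.  All relations with \<open>m + p < n\<close> survive in the truncation of size \<open>n\<close>.
\<close>

lemma recursion_reaches_unit_vectors:
  assumes p: "p \<ge> 1" and band: "banded p q T" and ext: "\<And>n. T (n + p) n \<noteq> 0"
    and A: "left_recursion_polynomials p q T \<nu> A"
    and v: "\<And>a. a \<in> {1..p} \<Longrightarrow> supp_upto n (v a)"
    and init: "\<And>i. i < p \<Longrightarrow> (\<lambda>j. \<Sum>a=1..p. \<nu> $$ (i, a - 1) * v a j) = unit_fun i"
    and "k < n"
  shows "(\<lambda>j. \<Sum>a=1..p. poly_act n T (A a k) (v a) j) = unit_fun k"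
  using \<open>k < n\<close>
proof (induction k rule: less_induct)
  case (less k)
  show ?case
  proof (cases "k < p")
    case True
    have "poly_act n T (A a k) (v a) j = \<nu> $$ (k, a - 1) * v a j" if "a \<in> {1..p}" for a j
    proof -
      have "\<forall>i\<in>{1..p}. A a (i - 1) = [:\<nu> $$ (i - 1, a - 1):]"
        using A that unfolding left_recursion_polynomials_def by blast
      from bspec[OF this, of "Suc k"] have "A a k = [:\<nu> $$ (k, a - 1):]" using True by simp
      then show ?thesis by simp
    qed
    then show ?thesis using init[OF True] by simp
  next
    case False
    define m where "m = k - p"
    have k: "k = m + p" using False by (simp add: m_def)
    have Tk: "T k m \<noteq> 0" and mk: "m < k" using ext k p by simp_all
    let ?E = "\<lambda>i j. \<Sum>a=1..p. poly_act n T (A a i) (v a) j"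
    have IH: "?E i = unit_fun i" if "i < k" for i
      using less.IH[OF that] less.prems that by simp
    have "(\<Sum>i=m - q..m + p. T i m * ?E i j) = mat_vec n T (?E m) j" for j
    proof -
      have "(\<Sum>i=m - q..m + p. T i m * poly_act n T (A a i) (v a) j) =
          mat_vec n T (poly_act n T (A a m) (v a)) j" if "a \<in> {1..p}" for a
      proof -
        have rec: "(\<Sum>i=m - q..m + p. Polynomial.smult (T i m) (A a i)) = [:0, 1:] * A a m"
          using A that unfolding left_recursion_polynomials_def by blast
        have "(\<Sum>i=m - q..m + p. T i m * poly_act n T (A a i) (v a) j) =
            poly_act n T (\<Sum>i=m - q..m + p. Polynomial.smult (T i m) (A a i)) (v a) j"
          by (simp add: poly_act_sum poly_act_smult)
        also have "\<dots> = mat_vec n T (poly_act n T (A a m) (v a)) j"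
          unfolding rec poly_act_mult by simp
        finally show ?thesis .
      qed
      then have "(\<Sum>a=1..p. \<Sum>i=m - q..m + p. T i m * poly_act n T (A a i) (v a) j) =
          (\<Sum>a=1..p. mat_vec n T (poly_act n T (A a m) (v a)) j)"
        by (intro sum.cong refl)
      moreover have "(\<Sum>a=1..p. \<Sum>i=m - q..m + p. T i m * poly_act n T (A a i) (v a) j) =
          (\<Sum>i=m - q..m + p. T i m * ?E i j)"
        by (subst sum.swap) (simp add: sum_distrib_left)
      ultimately show ?thesis by (simp add: mat_vec_sum)
    qed
    then have rec: "(\<Sum>i=m - q..m + p. T i m * ?E i j) = (if j < n then T j m else 0)" for j
      using IH[OF mk] mk less.prems by (simp add: mat_vec_unit_fun)
    have "{m - q..m + p} = insert k {m - q..<k}" using k by auto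
    then have "(\<Sum>i=m - q..m + p. T i m * ?E i j) = T k m * ?E k j + (\<Sum>i=m - q..<k. T i m * ?E i j)" for j
      by simp
    moreover have "(\<Sum>i=m - q..<k. T i m * ?E i j) = (if m - q \<le> j \<and> j < k then T j m else 0)" for j
    proof -
      have "(\<Sum>i=m - q..<k. T i m * ?E i j) = (\<Sum>i=m - q..<k. if i = j then T j m else 0)"
      proof (intro sum.cong refl)
        fix i assume "i \<in> {m - q..<k}"
        then have e: "?E i j = unit_fun i j" using fun_cong[OF IH[of i]] by simp
        show "T i m * ?E i j = (if i = j then T j m else 0)"
          by (subst e) (simp add: unit_fun_def)
      qed
      then show ?thesis by simp
    qed
    ultimately have "T k m * ?E k j = (if j < n then T j m else 0) - (if m - q \<le> j \<and> j < k then T j m else 0)" for j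
      using rec[of j] by simp
    moreover have "T j m = 0" if "j > k \<or> j < m - q" for j
      using band that k unfolding banded_def by auto
    ultimately have "T k m * ?E k j = T k m * unit_fun k j" for j
      using less.prems mk by (auto simp: unit_fun_def)
    then have "?E k j = unit_fun k j" for j using Tk by (simp only: mult_cancel_left) simp
    then show ?thesis by (simp add: fun_eq_iff)
  qed
qed

section \<open>Eigenvalues of truncations\<close>

lemma eigenvalue_of_real_eigenvector:
  assumes n: "n = Suc N" and v: "supp_upto n v" "v \<noteq> (\<lambda>_. 0)" "mat_vec n T v = (\<lambda>i. r * v i)"
  shows "eigenvalue (map_mat complex_of_real (truncation T N)) (complex_of_real r)"
proof -
  let ?A = "map_mat complex_of_real (truncation T N)"
  let ?v = "vec n (\<lambda>i. complex_of_real (v i))"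
  obtain i where i: "v i \<noteq> 0" using v(2) by blast
  then have "i < n" using v(1) by (auto simp: supp_upto_def not_le[symmetric])
  then have "vec_index ?v i \<noteq> vec_index (0\<^sub>v n) i" using i by simp
  then have "?v \<noteq> 0\<^sub>v n" by metis
  moreover have "?A *\<^sub>v ?v = complex_of_real r \<cdot>\<^sub>v ?v"
  proof (rule eq_vecI)
    fix i assume "i < dim_vec (complex_of_real r \<cdot>\<^sub>v ?v)"
    then have i: "i < n" by simp
    then have "vec_index (?A *\<^sub>v ?v) i = (\<Sum>j<n. complex_of_real (T i j) * complex_of_real (v j))"
      by (simp add: n truncation_def scalar_prod_def lessThan_atLeast0)
    also have "\<dots> = complex_of_real (mat_vec n T v i)" using i by (simp add: mat_vec_def)
    finally show "vec_index (?A *\<^sub>v ?v) i = vec_index (complex_of_real r \<cdot>\<^sub>v ?v) i"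
      using i v(3) by simp
  qed (simp add: n truncation_def)
  ultimately show ?thesis
    unfolding eigenvalue_def eigenvector_def by (intro exI[of _ ?v]) (simp add: n truncation_def)
qed

lemma eigenvector_re_im:
  assumes n: "n = Suc N" and "eigenvalue (map_mat complex_of_real (truncation T N)) z"
  shows "\<exists>x y. supp_upto n x \<and> supp_upto n y \<and> (x \<noteq> (\<lambda>_. 0) \<or> y \<noteq> (\<lambda>_. 0)) \<and>
    mat_vec n T x = (\<lambda>i. Re z * x i - Im z * y i) \<and> mat_vec n T y = (\<lambda>i. Im z * x i + Re z * y i)"
proof -
  let ?A = "map_mat complex_of_real (truncation T N)"
  obtain u where u: "u \<in> carrier_vec n" "u \<noteq> 0\<^sub>v n" "?A *\<^sub>v u = z \<cdot>\<^sub>v u"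
    using assms(2) by (auto simp: eigenvalue_def eigenvector_def truncation_def n)
  define x y where "x i = (if i < n then Re (vec_index u i) else 0)"
    and "y i = (if i < n then Im (vec_index u i) else 0)" for i
  have eq: "(\<Sum>j<n. complex_of_real (T i j) * vec_index u j) = z * vec_index u i" if i: "i < n" for i
  proof -
    have "vec_index (?A *\<^sub>v u) i = (\<Sum>j<n. complex_of_real (T i j) * vec_index u j)"
      using i u(1) by (simp add: n truncation_def scalar_prod_def lessThan_atLeast0)
    then show ?thesis using u(1,3) i by simp
  qed
  have "mat_vec n T x i = Re z * x i - Im z * y i" for i
  proof (cases "i < n")
    case True
    have "mat_vec n T x i = Re (\<Sum>j<n. complex_of_real (T i j) * vec_index u j)"
      using True by (simp add: mat_vec_def x_def)
    then show ?thesis using True by (simp add: eq x_def y_def)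
  qed (simp add: mat_vec_def x_def y_def)
  moreover have "mat_vec n T y i = Im z * x i + Re z * y i" for i
  proof (cases "i < n")
    case True
    have "mat_vec n T y i = Im (\<Sum>j<n. complex_of_real (T i j) * vec_index u j)"
      using True by (simp add: mat_vec_def y_def)
    then show ?thesis using True by (simp add: eq x_def y_def)
  qed (simp add: mat_vec_def x_def y_def)
  moreover have "x \<noteq> (\<lambda>_. 0) \<or> y \<noteq> (\<lambda>_. 0)"
  proof (rule ccontr)
    assume "\<not> ?thesis"
    then have xy: "x i = 0" "y i = 0" for i by simp_all
    have "vec_index u i = 0" if "i < n" for i
      using xy[of i] that by (simp add: x_def y_def complex_eq_iff)
    then have "u = 0\<^sub>v n" using u(1) by (intro eq_vecI) auto
    then show False using u(2) by blast
  qed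
  ultimately show ?thesis by (intro exI[of _ x] exI[of _ y]) (auto simp: supp_upto_def x_def y_def)
qed

lemma row_sum_le_inf_norm:
  assumes "inf_norm T < \<infinity>"
  shows "(\<Sum>j<n. \<bar>T i j\<bar>) \<le> enn2real (inf_norm T)"
proof -
  have "ennreal (\<Sum>j<n. \<bar>T i j\<bar>) = (\<Sum>j<n. ennreal \<bar>T i j\<bar>)" by (simp add: sum_ennreal)
  also have "\<dots> \<le> (\<Sum>j. ennreal \<bar>T i j\<bar>)" by (rule sum_le_suminf) auto
  also have "\<dots> \<le> inf_norm T" unfolding inf_norm_def by (rule SUP_upper) simp
  also have "\<dots> = ennreal (enn2real (inf_norm T))" using assms by (simp add: less_top)
  finally show ?thesis by (simp add: ennreal_le_iff)
qed

text \<open>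
  Gershgorin's argument: look at the row where the eigenvector has its largest entry.
\<close>

lemma eigenvalue_bound:
  assumes T: "inf_norm T < \<infinity>" and v: "supp_upto n v" "v \<noteq> (\<lambda>_. 0)" "mat_vec n T v = (\<lambda>i. r * v i)"
  shows "\<bar>r\<bar> \<le> enn2real (inf_norm T)"
proof -
  obtain i0 where i0: "v i0 \<noteq> 0" using v(2) by blast
  then have i0n: "i0 < n" using v(1) by (auto simp: supp_upto_def not_le[symmetric])
  obtain i where i: "i < n" "\<And>j. j < n \<Longrightarrow> \<bar>v j\<bar> \<le> \<bar>v i\<bar>"
  proof -
    have "Max ((\<lambda>j. \<bar>v j\<bar>) ` {..<n}) \<in> (\<lambda>j. \<bar>v j\<bar>) ` {..<n}" using i0n by (intro Max_in) auto
    then obtain i where "i < n" "Max ((\<lambda>j. \<bar>v j\<bar>) ` {..<n}) = \<bar>v i\<bar>" by auto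
    then show ?thesis using that[of i] by (metis Max_ge finite_imageI finite_lessThan image_eqI lessThan_iff)
  qed
  have pos: "\<bar>v i\<bar> > 0" using i(2)[OF i0n] i0 by linarith
  have "\<bar>r\<bar> * \<bar>v i\<bar> = \<bar>\<Sum>j<n. T i j * v j\<bar>"
    using fun_cong[OF v(3), of i] i(1) by (simp add: mat_vec_def abs_mult)
  also have "\<dots> \<le> (\<Sum>j<n. \<bar>T i j\<bar> * \<bar>v i\<bar>)"
    by (rule sum_abs[THEN order_trans], rule sum_mono) (auto simp: abs_mult intro: mult_left_mono i(2))
  also have "\<dots> \<le> enn2real (inf_norm T) * \<bar>v i\<bar>"
    using row_sum_le_inf_norm[OF T, where i = i and n = n]
    by (simp add: sum_distrib_right[symmetric] mult_right_mono)
  finally show ?thesis using pos by simp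
qed

text \<open>
  If all eigenvalues are real and bounded by \<open>C\<close>, the interval \<open>[-C, C]\<close> is among those whose
  intersection is \<open>Delta T\<close>.
\<close>

lemma Delta_bounds:
  assumes "\<And>z. z \<in> truncation_eigenvalues T \<Longrightarrow> \<exists>r. z = complex_of_real r \<and> \<bar>r\<bar> \<le> C"
  shows "closed (Delta T)" "Delta T \<subseteq> {-C..C}"
    and "\<And>r. complex_of_real r \<in> truncation_eigenvalues T \<Longrightarrow> r \<in> Delta T"
proof -
  show "closed (Delta T)" unfolding Delta_def by (intro closed_Inter) auto
  have "truncation_eigenvalues T \<subseteq> complex_of_real ` {-C..C}"
  proof
    fix z assume "z \<in> truncation_eigenvalues T"
    then obtain r where "z = complex_of_real r" "\<bar>r\<bar> \<le> C" using assms by blast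
    then show "z \<in> complex_of_real ` {-C..C}" by (auto simp: abs_le_iff)
  qed
  then show "Delta T \<subseteq> {-C..C}"
    unfolding Delta_def by (intro Inter_lower) (auto simp: is_interval_cc)
  show "r \<in> Delta T" if "complex_of_real r \<in> truncation_eigenvalues T" for r
    using that unfolding Delta_def by (auto dest!: subsetD)
qed

section \<open>Quadrature formulas for the truncations of \<open>T\<close>\<close>

lemma mat_vec_shift:
  assumes "supp_upto n v"
  shows "mat_vec n (semi_add_scaled_id T s) v = (\<lambda>i. mat_vec n T v i + s * v i)"
proof
  fix i
  show "mat_vec n (semi_add_scaled_id T s) v i = mat_vec n T v i + s * v i"
  proof (cases "i < n")
    case True
    have "(\<Sum>j<n. semi_id i j * v j) = (\<Sum>j<n. if j = i then v i else 0)"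
      by (intro sum.cong refl) (simp add: semi_id_apply)
    then have "(\<Sum>j<n. semi_id i j * v j) = v i" using True by simp
    then show ?thesis using True
      by (simp add: mat_vec_def semi_add_scaled_id_def ring_distribs sum.distrib mult.assoc
          sum_distrib_left[symmetric])
  next
    case False
    then show ?thesis using assms by (simp add: mat_vec_def supp_upto_def)
  qed
qed

lemma poly_act_shift:
  assumes "supp_upto n v"
  shows "poly_act n T f v = poly_act n (semi_add_scaled_id T s) (pcompose f [:- s, 1:]) v"
  using assms
proof (induction f arbitrary: v)
  case (pCons a f)
  let ?M = "semi_add_scaled_id T s"
  let ?g = "pcompose f [:- s, 1:]"
  have "poly_act n ?M ([:- s, 1:] * ?g) v = poly_act n ?M ?g (poly_act n ?M [:- s, 1:] v)"
    by (subst mult.commute) (rule poly_act_mult)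
  also have "poly_act n ?M [:- s, 1:] v = mat_vec n T v"
    using mat_vec_shift[OF pCons.prems] by (simp add: fun_eq_iff)
  also have "poly_act n ?M ?g (mat_vec n T v) = poly_act n T f (mat_vec n T v)"
    by (rule pCons.IH[symmetric]) simp
  finally have "poly_act n ?M ([:- s, 1:] * ?g) v = poly_act n T f (mat_vec n T v)" .
  then show ?case
    by (simp only: pcompose_pCons poly_act_add poly_act_pCons) simp
qed simp

text \<open>
  \<open>gauss_quadrature\<close> applies to the shifted matrix \<open>T + s I\<close>, and the nodes are then moved back by \<open>s\<close>.  The
  vectors of the last clause fit into the truncation only for \<open>n \<ge> p\<close>, while the statements on
  eigenvalues are needed for all \<open>n\<close>, because all truncations enter the definition of \<open>Delta T\<close>.
\<close>

lemma truncation_quadrature: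
  assumes pbf: "positive_bidiagonal_factorization p q (semi_add_scaled_id T s) L D U"
    and p: "p \<ge> 1" and q: "q \<ge> 1" and n: "n \<ge> 1"
  shows "\<exists>R. finite R \<and>
    (\<forall>r\<in>R. \<exists>v. supp_upto n v \<and> v \<noteq> (\<lambda>_. 0) \<and> mat_vec n T v = (\<lambda>i. r * v i)) \<and>
    (\<forall>z. eigenvalue (map_mat complex_of_real (truncation T (n - 1))) z \<longrightarrow> z \<in> complex_of_real ` R) \<and>
    (\<forall>a\<in>{1..p}. \<forall>b\<in>{1..q}. p \<le> n \<longrightarrow>
       (\<exists>W. (\<forall>r. W r \<ge> 0) \<and>
         (\<forall>f. functional n T (upper_prod U b 0) (\<lambda>i. lower_prod L a i 0) f = (\<Sum>r\<in>R. W r * poly f r))))"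
proof -
  let ?M = "semi_add_scaled_id T s"
  note pd = pbf_hankel_pd[OF pbf n]
  have "(\<lambda>i. corner n semi_id i 0) = unit_fun 0" using n by (auto simp: corner_def semi_id_apply unit_fun_def)
  moreover have "semi_id 0 = unit_fun 0" by (auto simp: semi_id_apply unit_fun_def fun_eq_iff)
  ultimately have cyc: "cyclic n ?M" using pd[of 1 1] p q n by (simp add: cyclic_def)
  obtain R where R: "finite R"
    and eig: "\<forall>r\<in>R. \<exists>v. supp_upto n v \<and> v \<noteq> (\<lambda>_. 0) \<and> mat_vec n ?M v = (\<lambda>i. r * v i)"
    and ceig: "\<forall>\<alpha> \<beta> x y. supp_upto n x \<and> supp_upto n y \<and> (x \<noteq> (\<lambda>_. 0) \<or> y \<noteq> (\<lambda>_. 0)) \<and>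
       mat_vec n ?M x = (\<lambda>i. \<alpha> * x i - \<beta> * y i) \<and> mat_vec n ?M y = (\<lambda>i. \<beta> * x i + \<alpha> * y i)
       \<longrightarrow> \<beta> = 0 \<and> \<alpha> \<in> R"
    and quad: "\<forall>w v. supp_upto n v \<and> hankel_pd n (moment n ?M w v) \<longrightarrow>
       (\<exists>W. (\<forall>r. W r \<ge> 0) \<and> (\<forall>f. functional n ?M w v f = (\<Sum>r\<in>R. W r * poly f r)))"
    using gauss_quadrature[OF cyc] by (elim exE conjE) (rule that)
  let ?R = "(\<lambda>r. r - s) ` R"
  have "\<exists>v. supp_upto n v \<and> v \<noteq> (\<lambda>_. 0) \<and> mat_vec n T v = (\<lambda>i. r * v i)" if r: "r \<in> ?R" for r
  proof -
    from r have "r + s \<in> R" by auto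
    then obtain v where v: "supp_upto n v" "v \<noteq> (\<lambda>_. 0)" "mat_vec n ?M v = (\<lambda>i. (r + s) * v i)"
      using eig by blast
    then have "mat_vec n T v = (\<lambda>i. r * v i)"
      using mat_vec_shift[OF v(1), of T s] by (simp add: fun_eq_iff algebra_simps)
    then show ?thesis using v by blast
  qed
  moreover have "z \<in> complex_of_real ` ?R"
    if z: "eigenvalue (map_mat complex_of_real (truncation T (n - 1))) z" for z
  proof -
    have n': "n = Suc (n - 1)" using n by simp
    obtain x y where xy: "supp_upto n x" "supp_upto n y" "x \<noteq> (\<lambda>_. 0) \<or> y \<noteq> (\<lambda>_. 0)"
      "mat_vec n T x = (\<lambda>i. Re z * x i - Im z * y i)" "mat_vec n T y = (\<lambda>i. Im z * x i + Re z * y i)"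
      using eigenvector_re_im[OF n' z] by blast
    have "Im z = 0 \<and> Re z + s \<in> R"
      by (rule ceig[rule_format, of x y]) (use xy in \<open>simp add: mat_vec_shift algebra_simps\<close>)
    then show ?thesis by (intro image_eqI[of _ _ "Re z"] image_eqI[of _ _ "Re z + s"]) (auto simp: complex_eq_iff)
  qed
  moreover have "\<exists>W. (\<forall>r. W r \<ge> 0) \<and>
      (\<forall>f. functional n T (upper_prod U b 0) (\<lambda>i. lower_prod L a i 0) f = (\<Sum>r\<in>?R. W r * poly f r))"
    if a: "a \<in> {1..p}" and b: "b \<in> {1..q}" and pn: "p \<le> n" for a b
  proof -
    let ?w = "upper_prod U b 0" and ?v = "\<lambda>i. lower_prod L a i 0"
    have supp: "supp_upto n ?v" using lower_prod_band[of a _ L] a pn by (auto simp: supp_upto_def)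
    then have "(\<lambda>i. corner n (lower_prod L a) i 0) = ?v"
      using n by (auto simp: corner_def supp_upto_def fun_eq_iff)
    then have "hankel_pd n (moment n ?M ?w ?v)" using pd[OF a b] by simp
    then obtain W where W: "\<And>r. W r \<ge> 0" "\<And>f. functional n ?M ?w ?v f = (\<Sum>r\<in>R. W r * poly f r)"
      using quad supp by blast
    have "functional n T ?w ?v f = (\<Sum>r\<in>?R. W (r + s) * poly f r)" for f
    proof -
      have "functional n T ?w ?v f = functional n ?M ?w ?v (pcompose f [:- s, 1:])"
        unfolding functional_def using poly_act_shift[OF supp] by metis
      also have "\<dots> = (\<Sum>r\<in>R. W r * poly f (r - s))" by (simp add: W poly_pcompose)
      also have "\<dots> = (\<Sum>r\<in>?R. W (r + s) * poly f r)" by (subst sum.reindex) (auto simp: inj_on_def)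
      finally show ?thesis .
    qed
    then show ?thesis using W(1) by (intro exI[of _ "\<lambda>r. W (r + s)"]) auto
  qed
  ultimately show ?thesis using R by (intro exI[of _ ?R]) auto
qed

lemma functional_bilinear:
  assumes "finite A" "finite B"
  shows "functional n X (\<lambda>j. \<Sum>l\<in>B. \<beta> l * w l j) (\<lambda>i. \<Sum>k\<in>A. \<alpha> k * v k i) f =
    (\<Sum>k\<in>A. \<Sum>l\<in>B. \<alpha> k * \<beta> l * functional n X (w l) (v k) f)"
proof -
  have act: "poly_act n X f (\<lambda>i. \<Sum>k\<in>A. \<alpha> k * v k i) = (\<lambda>i. \<Sum>k\<in>A. \<alpha> k * poly_act n X f (v k) i)"
    using assms(1)
  proof (induction A rule: finite_induct)
    case (insert k A)
    then show ?case
      using poly_act_vec_lin[of n X f "\<alpha> k" "v k" 1 "\<lambda>i. \<Sum>k\<in>A. \<alpha> k * v k i"] by simp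
  qed simp
  have "functional n X (\<lambda>j. \<Sum>l\<in>B. \<beta> l * w l j) (\<lambda>i. \<Sum>k\<in>A. \<alpha> k * v k i) f =
    (\<Sum>i<n. \<Sum>k\<in>A. \<Sum>l\<in>B. \<alpha> k * \<beta> l * (w l i * poly_act n X f (v k) i))"
    unfolding functional_def inner_upto_def act
    by (intro sum.cong refl, subst sum.swap) (simp add: sum_product mult_ac)
  also have "\<dots> = (\<Sum>k\<in>A. \<Sum>i<n. \<Sum>l\<in>B. \<alpha> k * \<beta> l * (w l i * poly_act n X f (v k) i))"
    by (rule sum.swap)
  also have "\<dots> = (\<Sum>k\<in>A. \<Sum>l\<in>B. \<Sum>i<n. \<alpha> k * \<beta> l * (w l i * poly_act n X f (v k) i))"
    by (intro sum.cong refl sum.swap)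
  finally show ?thesis by (simp add: functional_def inner_upto_def sum_distrib_left)
qed

section \<open>Orthogonality in the limit\<close>

lemma mat_mult_entry:
  assumes "X \<in> carrier_mat n n" "Y \<in> carrier_mat n n" "i < n" "j < n"
  shows "(X * Y) $$ (i, j) = (\<Sum>k<n. X $$ (i, k) * Y $$ (k, j))"
  using assms by (auto simp: scalar_prod_def lessThan_atLeast0)

text \<open>
  The vectors \<open>L\<^sub>1 \<cdots> L\<^sub>k e\<^sub>0\<close> with \<open>k < p\<close> vanish from the index \<open>p\<close> on, so that no entry is lost
  when \<open>\<Lambda>\<close> keeps only the first \<open>p\<close> of them.
\<close>

lemma coefficient_vector_lower:
  assumes \<A>: "\<A> \<in> carrier_mat p p" and a: "a \<in> {1..p}"
  shows "(\<lambda>i. if i < p then (Lambda_mat p L * \<A>) $$ (i, a - 1) else 0) =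
    (\<lambda>i. \<Sum>k<p. \<A> $$ (k, a - 1) * norm_factor L k * lower_prod L (Suc k) i 0)"
proof
  fix i
  have car: "Lambda_mat p L \<in> carrier_mat p p" unfolding Lambda_mat_def by (rule carrier_matI) simp_all
  show "(if i < p then (Lambda_mat p L * \<A>) $$ (i, a - 1) else 0) =
    (\<Sum>k<p. \<A> $$ (k, a - 1) * norm_factor L k * lower_prod L (Suc k) i 0)"
  proof (cases "i < p")
    case True
    then have "(Lambda_mat p L * \<A>) $$ (i, a - 1) = (\<Sum>k<p. Lambda_mat p L $$ (i, k) * \<A> $$ (k, a - 1))"
      using car \<A> a by (auto simp: scalar_prod_def lessThan_atLeast0)
    then show ?thesis using True by (simp add: Lambda_mat_entry mult_ac)
  next
    case False
    then show ?thesis by (auto simp: lower_prod_band intro!: sum.neutral)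
  qed
qed

lemma coefficient_vector_upper:
  assumes \<B>: "\<B> \<in> carrier_mat q q" and b: "b \<in> {1..q}"
  shows "(\<lambda>j. if j < q then (\<B> * Upsilon_mat q U) $$ (b - 1, j) else 0) =
    (\<lambda>j. \<Sum>k<q. \<B> $$ (b - 1, k) * norm_factor U k * upper_prod U (Suc k) 0 j)"
proof
  fix j
  have car: "Upsilon_mat q U \<in> carrier_mat q q" unfolding Upsilon_mat_def by (rule carrier_matI) simp_all
  show "(if j < q then (\<B> * Upsilon_mat q U) $$ (b - 1, j) else 0) =
    (\<Sum>k<q. \<B> $$ (b - 1, k) * norm_factor U k * upper_prod U (Suc k) 0 j)"
  proof (cases "j < q")
    case True
    then have "(\<B> * Upsilon_mat q U) $$ (b - 1, j) = (\<Sum>k<q. \<B> $$ (b - 1, k) * Upsilon_mat q U $$ (k, j))"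
      using car \<B> b by (auto simp: scalar_prod_def lessThan_atLeast0)
    then show ?thesis using True by (simp add: Upsilon_mat_entry mult_ac)
  next
    case False
    then show ?thesis
      by (auto simp: upper_prod_eq_semi_transpose semi_transpose_def lower_prod_band intro!: sum.neutral)
  qed
qed

lemma banded_semi_transpose: "banded p q T \<Longrightarrow> banded q p (semi_transpose T)"
  by (auto simp: banded_def semi_transpose_def)

text \<open>
  The polynomials \<open>B\<close> play for the transpose of \<open>T\<close> the role that the polynomials \<open>A\<close> play for \<open>T\<close>.
\<close>

lemma right_recursion_semi_transpose:
  "right_recursion_polynomials p q T \<xi> B \<Longrightarrow> left_recursion_polynomials q p (semi_transpose T) \<xi> B"
  by (simp add: left_recursion_polynomials_def right_recursion_polynomials_def semi_transpose_def)

text \<open>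
  Moving \<open>B b l\<close> evaluated at \<open>T\<close> to the left factor of the pairing gives the inner product of \<open>e\<^sub>l\<close>
  and \<open>e\<^sub>k\<close>.
\<close>

lemma biorthogonal_truncation:
  assumes E: "(\<lambda>j. \<Sum>a=1..p. poly_act n T (A a k) (v a) j) = unit_fun k"
    and F: "(\<lambda>j. \<Sum>b=1..q. poly_act n (semi_transpose T) (B b l) (w b) j) = unit_fun l"
    and kl: "k < n" "l < n"
  shows "(\<Sum>a=1..p. \<Sum>b=1..q. functional n T (w b) (v a) (B b l * A a k)) = (if k = l then 1 else 0)"
proof -
  let ?e = "\<lambda>a. poly_act n T (A a k) (v a)" and ?f = "\<lambda>b. poly_act n (semi_transpose T) (B b l) (w b)"
  have "(\<Sum>a=1..p. \<Sum>b=1..q. functional n T (w b) (v a) (B b l * A a k)) =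
      (\<Sum>a=1..p. \<Sum>b=1..q. \<Sum>i<n. ?f b i * ?e a i)"
    by (simp add: functional_def poly_act_mult inner_upto_poly_act[of n _ _ "B _ _"]) (simp add: inner_upto_def)
  also have "\<dots> = (\<Sum>a=1..p. \<Sum>i<n. \<Sum>b=1..q. ?f b i * ?e a i)"
    by (intro sum.cong refl sum.swap)
  also have "\<dots> = (\<Sum>i<n. \<Sum>a=1..p. \<Sum>b=1..q. ?f b i * ?e a i)" by (rule sum.swap)
  also have "\<dots> = (\<Sum>i<n. (\<Sum>b=1..q. ?f b i) * (\<Sum>a=1..p. ?e a i))"
    by (intro sum.cong refl, subst sum.swap) (simp add: sum_product)
  also have "\<dots> = (\<Sum>i<n. unit_fun l i * unit_fun k i)"
    using fun_cong[OF E] fun_cong[OF F] by simp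
  also have "\<dots> = (\<Sum>i<n. if i = k then unit_fun l k else 0)"
    by (intro sum.cong refl) (simp add: unit_fun_def)
  finally show ?thesis using kl by (simp add: unit_fun_def)
qed

theorem theorem9p1:
  fixes p q :: nat
    and T :: "nat \<Rightarrow> nat \<Rightarrow> real"
    and s :: real
    and L U :: "nat \<Rightarrow> nat \<Rightarrow> real"
    and D :: "nat \<Rightarrow> real"
    and \<nu> \<xi> \<A> \<B> :: "real mat"
    and A B :: "nat \<Rightarrow> nat \<Rightarrow> real poly"
  assumes "p \<ge> 1" and "q \<ge> 1"
    and "banded p q T" and "extreme_diagonals_nonzero p q T"
    and "inf_norm T < \<infinity>"
    and "s \<ge> 0"
    and "positive_bidiagonal_factorization p q (semi_add_scaled_id T s) L D U"
    and "lower_unitriangular p \<nu>" and "lower_unitriangular q \<xi>"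
    and "left_recursion_polynomials p q T \<nu> A"
    and "right_recursion_polynomials p q T \<xi> B"
    and "upper_unitriangular p \<A>" and "nonneg_entries \<A>"
    and "lower_unitriangular q \<B>" and "nonneg_entries \<B>"
    and "mat_inverse (transpose_mat \<nu>) = Some (Lambda_mat p L * \<A>)"
    and "mat_inverse \<xi> = Some (\<B> * Upsilon_mat q U)"
  shows "compact (Delta T) \<and>
    (\<exists>\<psi> :: nat \<Rightarrow> nat \<Rightarrow> real \<Rightarrow> real.
       (\<forall>b\<in>{1..q}. \<forall>a\<in>{1..p}.
          mono (\<psi> b a) \<and> (\<forall>x. \<psi> b a x \<ge> 0) \<and>
          emeasure (lebesgue_stieltjes (\<psi> b a)) (- Delta T) = 0) \<and>
       (\<forall>k l. (\<Sum>a = 1..p. \<Sum>b = 1..q.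
          (LINT x : Delta T | lebesgue_stieltjes (\<psi> b a). poly (B b l) x * poly (A a k) x))
          = (if k = l then 1 else 0)))"
proof -
  note pq = assms(1,2) and pbf = assms(7)
  have car: "\<nu> \<in> carrier_mat p p" "\<xi> \<in> carrier_mat q q" "\<A> \<in> carrier_mat p p" "\<B> \<in> carrier_mat q q"
    using assms(8,9,12,14) by (auto simp: lower_unitriangular_def upper_unitriangular_def)
  let ?C = "enn2real (inf_norm T)"
  have eig_real: "\<exists>r. z = complex_of_real r \<and> \<bar>r\<bar> \<le> ?C" if z: "z \<in> truncation_eigenvalues T" for z
  proof -
    obtain N where N: "eigenvalue (map_mat complex_of_real (truncation T N)) z"
      using z by (auto simp: truncation_eigenvalues_def)
    have Suc_N: "Suc N \<ge> 1" by simp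
    obtain R where "\<forall>r\<in>R. \<exists>v. supp_upto (Suc N) v \<and> v \<noteq> (\<lambda>_. 0) \<and> mat_vec (Suc N) T v = (\<lambda>i. r * v i)"
      "\<forall>z. eigenvalue (map_mat complex_of_real (truncation T (Suc N - 1))) z \<longrightarrow> z \<in> complex_of_real ` R"
      using truncation_quadrature[OF pbf pq Suc_N] by (elim exE conjE) (rule that)
    then show ?thesis using N eigenvalue_bound[OF assms(5)] by fastforce
  qed
  have \<Delta>: "closed (Delta T)" "Delta T \<subseteq> {-?C..?C}"
    "\<And>r. complex_of_real r \<in> truncation_eigenvalues T \<Longrightarrow> r \<in> Delta T"
    using Delta_bounds[of T ?C, OF eig_real] by auto
  have "compact (Delta T)"
    using \<Delta>(1,2) by (meson bounded_closed_interval bounded_subset compact_eq_bounded_closed)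
  \<comment> \<open>Truncations at least as large as the supports of \<open>v a\<close> and \<open>w b\<close>, so that the masses are constant.\<close>
  define n where "n N = N + p + q" for N
  have n: "n N \<ge> 1" "p \<le> n N" "q \<le> n N" "N < n N" for N using pq by (auto simp: n_def)
  define quad where "quad N R a b W \<longleftrightarrow> (\<forall>r. W r \<ge> 0) \<and>
      (\<forall>f. functional (n N) T (upper_prod U b 0) (\<lambda>i. lower_prod L a i 0) f = (\<Sum>r\<in>R. W r * poly f r))"
    for N R a b and W :: "real \<Rightarrow> real"
  have "\<exists>R. finite R \<and>
    (\<forall>r\<in>R. \<exists>v. supp_upto (n N) v \<and> v \<noteq> (\<lambda>_. 0) \<and> mat_vec (n N) T v = (\<lambda>i. r * v i)) \<and>
    (\<forall>a\<in>{1..p}. \<forall>b\<in>{1..q}. \<exists>W. quad N R a b W)" for N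
  proof -
    obtain R where "finite R"
      "\<forall>r\<in>R. \<exists>v. supp_upto (n N) v \<and> v \<noteq> (\<lambda>_. 0) \<and> mat_vec (n N) T v = (\<lambda>i. r * v i)"
      "\<forall>a\<in>{1..p}. \<forall>b\<in>{1..q}. p \<le> n N \<longrightarrow> (\<exists>W. quad N R a b W)"
      using truncation_quadrature[OF pbf pq n(1)[of N], folded quad_def] by (elim exE conjE) (rule that)
    then show ?thesis using n(2)[of N] by (intro exI[of _ R] conjI) simp_all
  qed
  then have "\<forall>N. \<exists>R. finite R \<and>
    (\<forall>r\<in>R. \<exists>v. supp_upto (n N) v \<and> v \<noteq> (\<lambda>_. 0) \<and> mat_vec (n N) T v = (\<lambda>i. r * v i)) \<and>
    (\<forall>a\<in>{1..p}. \<forall>b\<in>{1..q}. \<exists>W. quad N R a b W)" by (rule allI)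
  from choice[OF this] obtain R where RR: "\<forall>N. finite (R N) \<and>
    (\<forall>r\<in>R N. \<exists>v. supp_upto (n N) v \<and> v \<noteq> (\<lambda>_. 0) \<and> mat_vec (n N) T v = (\<lambda>i. r * v i)) \<and>
    (\<forall>a\<in>{1..p}. \<forall>b\<in>{1..q}. \<exists>W. quad N (R N) a b W)" by (rule exE)
  have R: "finite (R N)" for N using spec[OF RR, of N] by (elim conjE)
  have eig: "\<exists>v. supp_upto (n N) v \<and> v \<noteq> (\<lambda>_. 0) \<and> mat_vec (n N) T v = (\<lambda>i. r * v i)"
    if "r \<in> R N" for N r
    using spec[OF RR, of N] that by (elim conjE) (rule bspec)
  define W where "W N a b = (SOME W. quad N (R N) a b W)" for N a b
  have "quad N (R N) a b (W N a b)" if "a \<in> {1..p}" "b \<in> {1..q}" for N a b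
  proof -
    have "\<forall>a\<in>{1..p}. \<forall>b\<in>{1..q}. \<exists>W. quad N (R N) a b W" using spec[OF RR, of N] by (elim conjE)
    then have "\<exists>W. quad N (R N) a b W" using that by blast
    then show ?thesis unfolding W_def by (rule someI_ex)
  qed
  then have W: "W N a b r \<ge> 0"
    "functional (n N) T (upper_prod U b 0) (\<lambda>i. lower_prod L a i 0) f = (\<Sum>r\<in>R N. W N a b r * poly f r)"
    if "a \<in> {1..p}" "b \<in> {1..q}" for N a b r f
    using that unfolding quad_def by simp_all
  have R\<Delta>: "R N \<subseteq> Delta T" for N
  proof
    fix r assume "r \<in> R N"
    then obtain v where "supp_upto (n N) v" "v \<noteq> (\<lambda>_. 0)" "mat_vec (n N) T v = (\<lambda>i. r * v i)"
      using eig by blast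
    moreover have "n N = Suc (n N - 1)" using n(1)[of N] by simp
    ultimately have "complex_of_real r \<in> truncation_eigenvalues T"
      unfolding truncation_eigenvalues_def using eigenvalue_of_real_eigenvector by blast
    then show "r \<in> Delta T" by (rule \<Delta>(3))
  qed
  define v where "v a i = (if i < p then (Lambda_mat p L * \<A>) $$ (i, a - 1) else 0)" for a i
  define w where "w b j = (if j < q then (\<B> * Upsilon_mat q U) $$ (b - 1, j) else 0)" for b j
  define \<alpha> where "\<alpha> a k = \<A> $$ (k, a - 1) * norm_factor L k" for a k
  define \<beta> where "\<beta> b k = \<B> $$ (b - 1, k) * norm_factor U k" for b k
  have pos: "\<And>k i. k \<in> {1..p} \<Longrightarrow> L k i > 0" "\<And>k i. k \<in> {1..q} \<Longrightarrow> U k i > 0"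
    using pbf by (auto simp: positive_bidiagonal_factorization_def)
  have \<alpha>: "\<alpha> a k \<ge> 0" if "a \<in> {1..p}" "k < p" for a k
    using assms(13) that norm_factor_nonneg[of p L k] pos(1) car(3)
    by (auto simp: \<alpha>_def nonneg_entries_def intro!: mult_nonneg_nonneg)
  have \<beta>: "\<beta> b k \<ge> 0" if "b \<in> {1..q}" "k < q" for b k
    using assms(15) that norm_factor_nonneg[of q U k] pos(2) car(4)
    by (auto simp: \<beta>_def nonneg_entries_def intro!: mult_nonneg_nonneg)
  define V where "V ba N r = (\<Sum>k<p. \<Sum>l<q. \<alpha> (snd ba) k * \<beta> (fst ba) l * W N (Suc k) (Suc l) r)" for ba N r
  have V0: "V ba N r \<ge> 0" if "ba \<in> {1..q} \<times> {1..p}" for ba N r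
    using that \<alpha> \<beta> W(1) unfolding V_def by (auto intro!: sum_nonneg mult_nonneg_nonneg)
  have Vf: "functional (n N) T (w b) (v a) f = (\<Sum>r\<in>R N. V (b, a) N r * poly f r)"
    if ab: "a \<in> {1..p}" "b \<in> {1..q}" for N a b f
  proof -
    have "v a = (\<lambda>i. \<Sum>k<p. \<alpha> a k * lower_prod L (Suc k) i 0)"
      unfolding v_def \<alpha>_def using coefficient_vector_lower[OF car(3) ab(1)] by simp
    moreover have "w b = (\<lambda>j. \<Sum>l<q. \<beta> b l * upper_prod U (Suc l) 0 j)"
      unfolding w_def \<beta>_def using coefficient_vector_upper[OF car(4) ab(2)] by simp
    ultimately have "functional (n N) T (w b) (v a) f =
        (\<Sum>k<p. \<Sum>l<q. \<alpha> a k * \<beta> b l * functional (n N) T (upper_prod U (Suc l) 0) (\<lambda>i. lower_prod L (Suc k) i 0) f)"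
      using functional_bilinear[of "{..<p}" "{..<q}" "n N" T "\<beta> b" "\<lambda>l. upper_prod U (Suc l) 0" "\<alpha> a"
          "\<lambda>k i. lower_prod L (Suc k) i 0" f] by simp
    also have "\<dots> = (\<Sum>k<p. \<Sum>l<q. \<Sum>r\<in>R N. \<alpha> a k * \<beta> b l * W N (Suc k) (Suc l) r * poly f r)"
      by (intro sum.cong refl) (simp add: W(2) sum_distrib_left mult.assoc)
    also have "\<dots> = (\<Sum>k<p. \<Sum>r\<in>R N. \<Sum>l<q. \<alpha> a k * \<beta> b l * W N (Suc k) (Suc l) r * poly f r)"
      by (intro sum.cong refl sum.swap)
    also have "\<dots> = (\<Sum>r\<in>R N. \<Sum>k<p. \<Sum>l<q. \<alpha> a k * \<beta> b l * W N (Suc k) (Suc l) r * poly f r)"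
      by (rule sum.swap)
    finally show ?thesis by (simp add: V_def sum_distrib_right)
  qed
  have mass: "(\<Sum>r\<in>R N. V ba N r) = (\<Sum>i<p. w (fst ba) i * v (snd ba) i)"
    if "ba \<in> {1..q} \<times> {1..p}" for ba N
  proof -
    have "(\<Sum>r\<in>R N. V ba N r) = functional (n N) T (w (fst ba)) (v (snd ba)) 1"
      using that Vf[of "snd ba" "fst ba" N 1] by (cases ba) simp
    also have "\<dots> = (\<Sum>i<n N. w (fst ba) i * v (snd ba) i)" by (simp add: functional_def inner_upto_def)
    also have "\<dots> = (\<Sum>i<p. w (fst ba) i * v (snd ba) i)"
      using n(2)[of N] by (intro sum.mono_neutral_right) (auto simp: v_def)
    finally show ?thesis .
  qed
  have "\<exists>t \<psi>. strict_mono (t :: nat \<Rightarrow> nat) \<and> (\<forall>ba\<in>{1..q} \<times> {1..p}.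
      carried_limit (Delta T) (\<lambda>N f. \<Sum>r\<in>R (t N). V ba (t N) r * poly f r) (\<psi> ba))"
    by (rule quadrature_limit[OF \<Delta>(1,2) _ R R\<Delta> V0 mass]) simp_all
  then obtain t \<psi> where t: "strict_mono (t :: nat \<Rightarrow> nat)"
    and \<psi>: "\<forall>ba\<in>{1..q} \<times> {1..p}.
      carried_limit (Delta T) (\<lambda>N f. \<Sum>r\<in>R (t N). V ba (t N) r * poly f r) (\<psi> ba)"
    by (elim exE conjE) (rule that)
  have biorth: "(\<Sum>a=1..p. \<Sum>b=1..q. functional (n N) T (w b) (v a) (B b l * A a k)) = (if k = l then 1 else 0)"
    if kl: "k < n N" "l < n N" for k l N
  proof (rule biorthogonal_truncation[OF _ _ kl])
    note inv = mat_inverse(2)[OF _ assms(16), of p] mat_inverse(2)[OF _ assms(17), of q]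
    show "(\<lambda>j. \<Sum>a=1..p. poly_act (n N) T (A a k) (v a) j) = unit_fun k"
    proof (rule recursion_reaches_unit_vectors[OF pq(1) assms(3) _ assms(10) _ _ kl(1)])
      show "T (m + p) m \<noteq> 0" for m using assms(4) by (simp add: extreme_diagonals_nonzero_def)
      show "supp_upto (n N) (v a)" for a using n(2)[of N] by (auto simp: supp_upto_def v_def)
      fix i assume i: "i < p"
      have VV: "Lambda_mat p L * \<A> \<in> carrier_mat p p" and one: "(Lambda_mat p L * \<A>) * transpose_mat \<nu> = 1\<^sub>m p"
        using inv(1) car(1) by auto
      show "(\<lambda>j. \<Sum>a=1..p. \<nu> $$ (i, a - 1) * v a j) = unit_fun i"
      proof
        fix j
        have "(\<Sum>a=1..p. \<nu> $$ (i, a - 1) * v a j) = (\<Sum>a<p. \<nu> $$ (i, a) * v (Suc a) j)"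
          by (simp add: sum.atLeast1_atMost_eq)
        also have "\<dots> = (if j < p then ((Lambda_mat p L * \<A>) * transpose_mat \<nu>) $$ (j, i) else 0)"
        proof (cases "j < p")
          case True
          have "((Lambda_mat p L * \<A>) * transpose_mat \<nu>) $$ (j, i) =
              (\<Sum>a<p. (Lambda_mat p L * \<A>) $$ (j, a) * \<nu> $$ (i, a))"
            using VV car(1) i True by (subst mat_mult_entry[of _ p]) auto
          then show ?thesis using True by (simp add: v_def mult.commute)
        qed (simp add: v_def)
        also have "\<dots> = unit_fun i j" unfolding one using i by (auto simp: unit_fun_def)
        finally show "(\<Sum>a=1..p. \<nu> $$ (i, a - 1) * v a j) = unit_fun i j" .
      qed
    qed
    show "(\<lambda>j. \<Sum>b=1..q. poly_act (n N) (semi_transpose T) (B b l) (w b) j) = unit_fun l"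
    proof (rule recursion_reaches_unit_vectors[OF pq(2) banded_semi_transpose[OF assms(3)] _
          right_recursion_semi_transpose[OF assms(11)] _ _ kl(2)])
      show "semi_transpose T (m + q) m \<noteq> 0" for m using assms(4) by (simp add: extreme_diagonals_nonzero_def semi_transpose_def)
      show "supp_upto (n N) (w b)" for b using n(3)[of N] by (auto simp: supp_upto_def w_def)
      fix i assume i: "i < q"
      have WW: "\<B> * Upsilon_mat q U \<in> carrier_mat q q" and one: "\<xi> * (\<B> * Upsilon_mat q U) = 1\<^sub>m q"
        using inv(2) car(2) by auto
      show "(\<lambda>j. \<Sum>b=1..q. \<xi> $$ (i, b - 1) * w b j) = unit_fun i"
      proof
        fix j
        have "(\<Sum>b=1..q. \<xi> $$ (i, b - 1) * w b j) = (\<Sum>b<q. \<xi> $$ (i, b) * w (Suc b) j)"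
          by (simp add: sum.atLeast1_atMost_eq)
        also have "\<dots> = (if j < q then (\<xi> * (\<B> * Upsilon_mat q U)) $$ (i, j) else 0)"
        proof (cases "j < q")
          case True
          have "(\<xi> * (\<B> * Upsilon_mat q U)) $$ (i, j) = (\<Sum>b<q. \<xi> $$ (i, b) * (\<B> * Upsilon_mat q U) $$ (b, j))"
            using WW car(2) i True by (intro mat_mult_entry)
          then show ?thesis using True by (simp add: w_def)
        qed (simp add: w_def)
        also have "\<dots> = unit_fun i j" unfolding one using i by (auto simp: unit_fun_def)
        finally show "(\<Sum>b=1..q. \<xi> $$ (i, b - 1) * w b j) = unit_fun i j" .
      qed
    qed
  qed
  let ?\<psi> = "\<lambda>b a. \<psi> (b, a)"
  have "(\<Sum>a = 1..p. \<Sum>b = 1..q.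
          (LINT x : Delta T | lebesgue_stieltjes (?\<psi> b a). poly (B b l) x * poly (A a k) x))
          = (if k = l then 1 else 0)" for k l
  proof -
    have "(\<lambda>N. \<Sum>a = 1..p. \<Sum>b = 1..q. \<Sum>r\<in>R (t N). V (b, a) (t N) r * poly (B b l * A a k) r) \<longlonglongrightarrow>
        (\<Sum>a = 1..p. \<Sum>b = 1..q. (LINT x : Delta T | lebesgue_stieltjes (?\<psi> b a). poly (B b l * A a k) x))"
      using \<psi> unfolding carried_limit_def by (intro tendsto_sum) (simp del: poly_mult)
    moreover have "\<forall>\<^sub>F N in sequentially. (\<Sum>a = 1..p. \<Sum>b = 1..q. \<Sum>r\<in>R (t N). V (b, a) (t N) r * poly (B b l * A a k) r) =
        (if k = l then 1 else 0)"
      using eventually_ge_at_top[of "max k l"]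
    proof eventually_elim
      case (elim N)
      have "N \<le> t N" using t by (rule seq_suble)
      then have "k < n (t N)" "l < n (t N)" using elim n(4)[of "t N"] by auto
      note * = biorth[OF this]
      have "(\<Sum>a = 1..p. \<Sum>b = 1..q. \<Sum>r\<in>R (t N). V (b, a) (t N) r * poly (B b l * A a k) r) =
          (\<Sum>a=1..p. \<Sum>b=1..q. functional (n (t N)) T (w b) (v a) (B b l * A a k))"
        by (intro sum.cong refl) (simp only: Vf)
      with * show ?case by (simp only:)
    qed
    ultimately have "(\<lambda>N::nat. if k = l then 1 else 0 :: real) \<longlonglongrightarrow>
        (\<Sum>a = 1..p. \<Sum>b = 1..q. (LINT x : Delta T | lebesgue_stieltjes (?\<psi> b a). poly (B b l * A a k) x))"
      by (rule Lim_transform_eventually)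
    then show ?thesis by (simp only: LIMSEQ_const_iff poly_mult)
  qed
  moreover have "mono (?\<psi> b a) \<and> (\<forall>x. ?\<psi> b a x \<ge> 0) \<and> emeasure (lebesgue_stieltjes (?\<psi> b a)) (- Delta T) = 0"
    if "b \<in> {1..q}" "a \<in> {1..p}" for a b
    using bspec[OF \<psi>, of "(b, a)"] that by (simp add: carried_limit_def)
  ultimately show ?thesis using \<open>compact (Delta T)\<close> by (intro conjI exI[of _ ?\<psi>]) auto
qed

end
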